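(* Let $\alpha > 1$ and $s \le \tfrac{1}{\alpha}$. Then $$\dim_H\Big\{\lambda \in \big(\tfrac12,\tfrac23\big) : W_\lambda(\alpha) \notin \mathcal{G}^s(I_\lambda)\Big\} \le s.$$
   Context: $\dim_H$ denotes Hausdorff dimension. For $\lambda \in (\tfrac12,1)$ let $I_\lambda = [0, \lambda/(1-\lambda)]$ and $$W_\lambda(\alpha) = \bigcap_{m\in\mathbb{N}}\bigcup_{n\ge m}\bigcup_{\omega\in\{0,1\}^n}\Big\{x\in I_\lambda : \Big|x-\sum_{i=1}^n \omega_i\lambda^i\Big| < 2^{-n\alpha}\Big\}.$$ For $s \ge 0$, $\mathcal{G}^s$ is the set of all $G_\delta$ sets $A \subseteq \mathbb{R}$ such that for every countable collection $\{f_j\}_{j\in\mathbb{N}}$ of similarity transformations $f_j:\mathbb{R}\to\mathbb{R}$, $\dim_H\big(\bigcap_j f_j(A)\big) \ge s$. For an interval $I$, $\mathcal{G}^s(I) = \{A \subseteq I : A + \operatorname{diam}(I)\cdot\mathbb{Z} \in \mathcal{G}^s\}$. *)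

theory Defs
  imports "HOL-Analysis.Analysis"
begin

section \<open>Hausdorff measure and Hausdorff dimension\<close>

text \<open>
  The value \<open>diam(U)\<^sup>t\<close> with the usual conventions: the empty set contributes \<open>0\<close>, and
  \<open>diam(U)\<^sup>0 = 1\<close> for every nonempty \<open>U\<close>, including singletons.  (The case \<open>t = 0\<close> is
  separate because \<open>0 powr 0 = 0\<close>.)
\<close>

definition diam_power :: "real \<Rightarrow> 'a::metric_space set \<Rightarrow> ennreal" where
  "diam_power t U =
     (if U = {} then 0 else if t = 0 then 1 else ennreal (diameter U powr t))"

text \<open>
  Boundedness of the covering sets is required explicitly, since \<^const>\<open>diameter\<close> is
  unspecified on unbounded sets.
\<close>

definition hausdorff_premeasure :: "real \<Rightarrow> real \<Rightarrow> 'a::metric_space set \<Rightarrow> ennreal" where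
  "hausdorff_premeasure t \<delta> A =
     (INF U \<in> {U :: nat \<Rightarrow> 'a set. A \<subseteq> (\<Union>i. U i) \<and> (\<forall>i. bounded (U i) \<and> diameter (U i) \<le> \<delta>)}.
        (\<Sum>i. diam_power t (U i)))"

definition hausdorff_measure :: "real \<Rightarrow> 'a::metric_space set \<Rightarrow> ennreal" where
  "hausdorff_measure t A = (SUP \<delta> \<in> {0<..}. hausdorff_premeasure t \<delta> A)"

text \<open>In particular the dimension of the empty set is \<open>0\<close>.\<close>

definition hausdorff_dim :: "'a::metric_space set \<Rightarrow> ereal" where
  "hausdorff_dim A = Inf {ereal t | t. 0 \<le> t \<and> hausdorff_measure t A = 0}"


section \<open>Sets with large intersections\<close>

definition is_similarity :: "(real \<Rightarrow> real) \<Rightarrow> bool" where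
  "is_similarity f \<longleftrightarrow> (\<exists>r>0. \<forall>x y. dist (f x) (f y) = r * dist x y)"

definition large_intersection :: "real \<Rightarrow> real set set" where
  "large_intersection s =
     {A. gdelta_in euclidean A \<and>
         (\<forall>f :: nat \<Rightarrow> real \<Rightarrow> real. (\<forall>j. is_similarity (f j)) \<longrightarrow>
            ereal s \<le> hausdorff_dim (\<Inter>j. f j ` A))}"

definition large_intersection_on :: "real \<Rightarrow> real set \<Rightarrow> real set set" where
  "large_intersection_on s I =
     {A. A \<subseteq> I \<and> {a + diameter I * of_int k | a k. a \<in> A} \<in> large_intersection s}"


section \<open>Points well approximable by finite power sums\<close>

definition I_int :: "real \<Rightarrow> real set" where
  "I_int l = {0 .. l / (1 - l)}"

definition W_set :: "real \<Rightarrow> real \<Rightarrow> real set" where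
  "W_set l \<alpha> =
     (\<Inter>m::nat. \<Union>n\<in>{m..}. \<Union>\<omega> \<in> {1..n} \<rightarrow>\<^sub>E {0, 1::real}.
        {x \<in> I_int l. \<bar>x - (\<Sum>i=1..n. \<omega> i * l ^ i)\<bar> < 2 powr (- (real n * \<alpha>))})"

end

theory Submission
  imports Defs
begin

text \<open>
  Write \<open>F\<^sub>n(S)\<close> for the sum of \<open>l\<^sup>i\<close> over \<open>i \<in> S \<subseteq> {1..n}\<close>.  A power series with constant term \<open>1\<close> and
  coefficients in \<open>{-1, 0, 1}\<close> has no double zero in \<open>[1/2, 2/3]\<close>; quantitatively, \<open>F\<^sub>n(S) - F\<^sub>n(T)\<close> is
  small only for \<open>l\<close> in one short interval.  A weighted covering argument on the dyadic tree (in the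
  place of an integral against a Frostman measure on the parameters) turns this into: for \<open>t < s\<close>,
  outside a set of dimension at most \<open>s\<close>, the number of pairs \<open>S, T\<close> with \<open>F\<^sub>n(S)\<close> and \<open>F\<^sub>n(T)\<close> within
  \<open>2\<^sup>-\<^sup>k\<close> is \<open>O(4\<^sup>n 2\<^sup>-\<^sup>k\<^sup>t)\<close>.  For such \<open>l\<close>, self-similarity puts into every small interval a large family
  of points \<open>F\<^sub>n(S)\<close> whose counting measure satisfies a Frostman condition with exponent \<open>t < 1/\<alpha>\<close>,
  down to the scale \<open>2\<^sup>-\<^sup>n\<^sup>\<alpha>\<close>.  Since \<open>t < 1\<close>, replacing the mass of a bounded density on each dyadic
  interval of a sufficiently high level by such a measure costs nothing in the Frostman condition.
  Hence countably many similar images can be treated one after the other, and the mass distribution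
  principle bounds the dimension of their intersection from below.
\<close>

section \<open>Transversality\<close>

text \<open>No limit measure is formed in either half. For the parameters, a pair \<open>S\<close>,
  \<open>T\<close> puts equal weights on the two dyadic intervals that can contain its close
  parameters. Dyadic intervals are nested or disjoint, so such a fractional cover can be rounded to
  a genuine one without loss. The cost stays bounded because about 4^n 2^-i pairs first differ at
  position i, while their intervals are longer by a factor 2^i: the sum of 2^(i(s-1)) converges for
  s < 1. The margin s - t then supplies a summable factor 2^(-k(s-t)). For the intersection,
  compactness of nested supports means that a cover is only ever compared with one finite level of a
  flow. The obstacle is the constant C of a local replacement, which would multiply up over
  infinitely many steps; a flow of bounded density has a spare factor 2^(-L(1-t)) on intervals of
  level L, which absorbs C when L is large. The bound 1/\<alpha> on the exponent comes from the last
  scale: among 2^n points a single one has mass 2^-n, and this must be at most 2^(-n \<alpha>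
  t).\<close>

primrec hval :: "real list \<Rightarrow> real \<Rightarrow> real" where
  "hval [] x = 0"
| "hval (c # cs) x = c + x * hval cs x"

fun padd :: "real list \<Rightarrow> real list \<Rightarrow> real list" where
  "padd [] ds = ds"
| "padd cs [] = cs"
| "padd (c # cs) (d # ds) = (c + d) # padd cs ds"

lemma hval_padd [simp]: "hval (padd cs ds) x = hval cs x + hval ds x"
  by (induction cs ds rule: padd.induct) (auto simp: algebra_simps)

lemma hval_map_mult [simp]: "hval (map ((*) a) cs) x = a * hval cs x"
  by (induction cs) (auto simp: algebra_simps)

lemma hval_append: "hval (cs @ ds) x = hval cs x + x ^ length cs * hval ds x"
  by (induction cs) (auto simp: algebra_simps)

lemma hval_replicate_0 [simp]: "hval (replicate n 0) x = 0"
  by (induction n) auto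

lemma hval_map_upt: "hval (map c [0..<n]) x = (\<Sum>j<n. c j * x ^ j)"
  by (induction n) (auto simp: hval_append)

text \<open>\<open>ubound\<close> needs a variable that starts at 0, so a certificate on [lo, hi] is
  rewritten in the distance u = hi - x from the right end.\<close>

primrec pshift :: "real \<Rightarrow> real list \<Rightarrow> real list" where
  "pshift h [] = []"
| "pshift h (c # cs) = (let ds = pshift h cs in padd (c # map ((*) (- 1)) ds) (map ((*) h) ds))"

lemma hval_pshift: "hval (pshift h cs) u = hval cs (h - u)"
  by (induction cs) (auto simp: Let_def algebra_simps)

text \<open>One-sided interval arithmetic in Horner form: if the inner value is at most b, then u
  times it is at most 0 for b <= 0 (worst case u = 0) and at most w b otherwise (worst case u = w).
  Since u >= 0, lower bounds never enter.\<close>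

primrec ubound :: "real \<Rightarrow> real list \<Rightarrow> real" where
  "ubound w [] = 0"
| "ubound w (c # cs) = (let b = ubound w cs in if b \<le> 0 then c else c + w * b)"

lemma hval_le_ubound:
  assumes "0 \<le> u" "u \<le> w"
  shows "hval cs u \<le> ubound w cs"
proof (induction cs)
  case (Cons c cs)
  have "u * hval cs u \<le> u * ubound w cs"
    using Cons assms by (intro mult_left_mono) auto
  moreover have "u * ubound w cs \<le> w * ubound w cs" if "ubound w cs > 0"
    using that assms by (intro mult_right_mono) auto
  moreover have "u * ubound w cs \<le> 0" if "ubound w cs \<le> 0"
    using that assms by (simp add: mult_nonneg_nonpos)
  ultimately have "u * hval cs u \<le> (if ubound w cs \<le> 0 then 0 else w * ubound w cs)"
    by (smt (verit))
  then show ?case by (auto simp: Let_def split: if_splits)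
qed auto

definition coeffs_prefix :: "real list \<Rightarrow> real \<Rightarrow> real \<Rightarrow> nat \<Rightarrow> real list" where
  "coeffs_prefix bs A B N =
     map (\<lambda>j. if j < length bs then bs ! j * (A + B * real j) else \<bar>A + B * real j\<bar>) [0..<N]"

text \<open>
  For \<open>f = \<Sum>j. b j * x ^ j\<close> the combination \<open>A * f + B * x * f'\<close> has the coefficients \<open>b j * (A + B * j)\<close>.  If the
  coefficients \<open>b j\<close> with \<open>j < length bs\<close> are prescribed, the polynomial below, divided by \<open>(1 - x)\<^sup>2\<close>,
  bounds it from above: up to \<open>N\<close> unknown coefficients are replaced by the worst sign, and beyond \<open>N\<close>,
  where \<open>A + B * j \<ge> 0\<close>, the series is summed.  Where the bound is negative, \<open>f\<close> and \<open>f'\<close> do not both vanish.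
\<close>
definition cert_poly :: "real list \<Rightarrow> real \<Rightarrow> real \<Rightarrow> nat \<Rightarrow> real list" where
  "cert_poly bs A B N =
     (let cs = coeffs_prefix bs A B N; r = A + B * real N in
      padd (padd cs (0 # map ((*) (- 2)) cs)) (padd (0 # 0 # cs) (replicate N 0 @ [r, B - r])))"

lemma hval_cert_poly:
  "hval (cert_poly bs A B N) x =
     (1 - x)\<^sup>2 * hval (coeffs_prefix bs A B N) x + x ^ N * ((A + B * real N) * (1 - x) + B * x)"
  by (simp add: cert_poly_def Let_def hval_append power2_eq_square algebra_simps)

text \<open>The factor (1 - x)^2 clears the denominators of the arithmetic-geometric series. In
  \<open>cert_sound\<close> the boundary term at \<open>M\<close> is nonnegative and is dropped,
  which makes the certificate uniform in the degree.\<close>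

lemma arith_geom_sum:
  fixes x :: real
  assumes "N \<le> M"
  shows "(1 - x)\<^sup>2 * (\<Sum>j=N..<M. (A + B * real j) * x ^ j) =
     x ^ N * ((A + B * real N) * (1 - x) + B * x) - x ^ M * ((A + B * real M) * (1 - x) + B * x)"
  using assms
proof (induction M rule: dec_induct)
  case (step M)
  then show ?case by (simp add: algebra_simps power2_eq_square)
qed simp

lemma cert_sound:
  assumes b: "\<And>j. \<bar>b j\<bar> \<le> 1" and pre: "\<And>j. j < length bs \<Longrightarrow> b j = bs ! j"
    and x: "0 \<le> x" "x < 1" and "N \<le> M" "0 \<le> B" "0 \<le> A + B * real N"
  shows "(1 - x)\<^sup>2 * (\<Sum>j<M. b j * (A + B * real j) * x ^ j) \<le> hval (cert_poly bs A B N) x"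
proof -
  have nn: "A + B * real j \<ge> 0" if "j \<ge> N" for j
  proof -
    have "B * real N \<le> B * real j" using that assms by (intro mult_left_mono) auto
    with assms show ?thesis by linarith
  qed
  have "(\<Sum>j<M. b j * (A + B * real j) * x ^ j) =
      (\<Sum>j<N. b j * (A + B * real j) * x ^ j) + (\<Sum>j=N..<M. b j * (A + B * real j) * x ^ j)"
    using \<open>N \<le> M\<close> by (subst sum.union_disjoint [symmetric]) (auto intro!: sum.cong)
  moreover have "(\<Sum>j<N. b j * (A + B * real j) * x ^ j) \<le> hval (coeffs_prefix bs A B N) x"
    unfolding coeffs_prefix_def hval_map_upt
  proof (intro sum_mono mult_right_mono)
    fix j
    have "b j * (A + B * real j) \<le> \<bar>b j\<bar> * \<bar>A + B * real j\<bar>"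
      by (metis abs_ge_self abs_mult)
    also have "\<dots> \<le> 1 * \<bar>A + B * real j\<bar>" by (intro mult_right_mono b) auto
    finally show "b j * (A + B * real j)
       \<le> (if j < length bs then bs ! j * (A + B * real j) else \<bar>A + B * real j\<bar>)"
      using pre by auto
  qed (use x in auto)
  moreover have "(\<Sum>j=N..<M. b j * (A + B * real j) * x ^ j) \<le> (\<Sum>j=N..<M. (A + B * real j) * x ^ j)"
  proof (intro sum_mono mult_right_mono)
    fix j assume j: "j \<in> {N..<M}"
    have "b j * (A + B * real j) \<le> 1 * (A + B * real j)"
      using b[of j] nn[of j] j by (intro mult_right_mono) auto
    then show "b j * (A + B * real j) \<le> A + B * real j" by simp
  qed (use x in auto)
  ultimately have "(1 - x)\<^sup>2 * (\<Sum>j<M. b j * (A + B * real j) * x ^ j) \<le>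
     (1 - x)\<^sup>2 * (hval (coeffs_prefix bs A B N) x + (\<Sum>j=N..<M. (A + B * real j) * x ^ j))"
    by (intro mult_left_mono) auto
  also have "\<dots> \<le> hval (cert_poly bs A B N) x"
  proof -
    have "x ^ M * ((A + B * real M) * (1 - x) + B * x) \<ge> 0"
      using x nn[OF \<open>N \<le> M\<close>] \<open>0 \<le> B\<close> by auto
    then show ?thesis
      unfolding hval_cert_poly distrib_left arith_geom_sum[OF \<open>N \<le> M\<close>] by linarith
  qed
  finally show ?thesis .
qed

text \<open>A case distinction on the next coefficient at each \<open>Node\<close>; the trees used below were found by a
  computer search.\<close>
datatype cert_tree = Leaf real real nat | Node cert_tree cert_tree cert_tree

text \<open>The limits on \<open>A\<close> and \<open>B\<close> and the gap 1/10000 make the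
  certificate quantitative, as \<open>transversality_deriv\<close> requires. \<open>N <= 20\<close>
  ensures \<open>N <= M\<close> for every length \<open>M >= 20\<close>.\<close>

primrec check :: "real \<Rightarrow> real \<Rightarrow> cert_tree \<Rightarrow> real list \<Rightarrow> bool" where
  "check lo hi (Leaf A B N) bs \<longleftrightarrow>
     \<bar>A\<bar> \<le> 20 \<and> 0 \<le> B \<and> B \<le> 1 \<and> 0 \<le> A + B * real N \<and> N \<le> 20 \<and>
     ubound (hi - lo) (pshift hi (cert_poly bs A B N)) \<le> - 1 / 10000"
| "check lo hi (Node t1 t2 t3) bs \<longleftrightarrow>
     check lo hi t1 (bs @ [- 1]) \<and> check lo hi t2 (bs @ [0]) \<and> check lo hi t3 (bs @ [1])"

lemma check_sound:
  assumes "check lo hi t bs"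
    and b: "\<And>j. b j \<in> {-1, 0, 1}" and pre: "\<And>j. j < length bs \<Longrightarrow> b j = bs ! j"
    and x: "0 \<le> lo" "lo \<le> x" "x \<le> hi" "hi < 1" and M: "20 \<le> M"
  shows "\<exists>A B. \<bar>A\<bar> \<le> 20 \<and> 0 \<le> B \<and> B \<le> 1 \<and>
           (\<Sum>j<M. b j * (A + B * real j) * x ^ j) \<le> - 1 / 10000"
  using assms(1) pre
proof (induction t arbitrary: bs)
  case (Leaf A B N)
  have b1: "\<bar>b j\<bar> \<le> 1" for j using b[of j] by auto
  define S where "S = (\<Sum>j<M. b j * (A + B * real j) * x ^ j)"
  have "hval (cert_poly bs A B N) x = hval (pshift hi (cert_poly bs A B N)) (hi - x)"
    by (simp add: hval_pshift)
  also have "\<dots> \<le> ubound (hi - lo) (pshift hi (cert_poly bs A B N))"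
    using x by (intro hval_le_ubound) auto
  also have "\<dots> \<le> - 1 / 10000" using Leaf by simp
  finally have le: "(1 - x)\<^sup>2 * S \<le> - 1 / 10000"
    using cert_sound[of b bs x N M B A] b1 Leaf x M unfolding S_def by fastforce
  \<comment> \<open>Dividing a negative bound by the factor (1 - x)^2 <= 1 only lowers it, so the
    gap survives.\<close>
  have "(1 - x)\<^sup>2 \<le> 1" using x by (simp add: power_le_one)
  moreover have "S < 0"
  proof (rule ccontr)
    assume "\<not> S < 0"
    then have "(1 - x)\<^sup>2 * S \<ge> 0" by simp
    with le show False by simp
  qed
  ultimately have "1 * S \<le> (1 - x)\<^sup>2 * S"
    by (intro mult_right_mono_neg) auto
  with le have "S \<le> - 1 / 10000" by simp
  with Leaf(1) show ?case unfolding S_def check.simps by blast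
next
  case (Node t1 t2 t3)
  have *: "\<And>j. j < length (bs @ [c]) \<Longrightarrow> b j = (bs @ [c]) ! j" if "b (length bs) = c" for c
    using Node.prems(2) that by (auto simp: nth_append less_Suc_eq)
  from b[of "length bs"] consider "b (length bs) = - 1" | "b (length bs) = 0" | "b (length bs) = 1"
    by auto
  then show ?case
  proof cases
    case 1 with Node * show ?thesis by (auto simp del: length_append)
  next
    case 2 with Node * show ?thesis by (auto simp del: length_append)
  next
    case 3 with Node * show ?thesis by (auto simp del: length_append)
  qed
qed


section \<open>Certificates on three subintervals of [1/2, 2/3]\<close>

lemma replicate_numeral: "replicate (numeral k) x = x # replicate (pred_numeral k) x"
  by (simp add: numeral_eq_Suc)

text \<open>Here -4 f + x f' is negative whatever the coefficients after the leading 1. Towards 2/3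
  more of them must be known: in the next two trees, every branch that fixes more than four further
  coefficients begins with 1 - x - x^2 - x^3 + x^4. A leaf with \<open>B = 0\<close> shows that f
  itself is negative.\<close>

lemma check_low: "check (1/2) (16/25) (Leaf (-4) 1 4) [1]"
  by (simp add: cert_poly_def coeffs_prefix_def Let_def upt_rec replicate_numeral)

lemma check_mid:
  "check (16/25) (33/50)
     (Node (Node (Node (Node (Leaf 2 1 5) (Leaf 1 0 5) (Node (Leaf 2 1 6) (Leaf (-6) 1 6) (Leaf (-7) 1 7)))
       (Leaf (-5) 1 5) (Leaf (-6) 1 6)) (Leaf (-5) 1 5) (Leaf (-10) 1 10)) (Leaf (-7) 1 7) (Leaf (-15) 1 15)) [1]"
  by (simp add: cert_poly_def coeffs_prefix_def Let_def upt_rec replicate_numeral)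

lemma check_high:
  "check (33/50) (2/3)
     (Node (Node (Node (Node (Leaf 2 1 5) (Leaf 1 0 5) (Node (Leaf 2 1 6)
       (Node (Leaf 2 1 7) (Leaf 2 1 7) (Node (Leaf 2 1 8) (Leaf 1 0 8) (Node (Leaf 2 1 9)
       (Node (Leaf 2 1 10) (Leaf 2 1 10) (Leaf (-10) 1 10)) (Leaf (-10) 1 10)))) (Leaf (-7) 1 7)))
       (Leaf (-5) 1 5) (Leaf (-6) 1 6)) (Leaf (-5) 1 5) (Leaf (-9) 1 9)) (Leaf (-7) 1 7) (Leaf (-15) 1 15)) [1]"
  by (simp add: cert_poly_def coeffs_prefix_def Let_def upt_rec replicate_numeral)


lemma transversality_sum:
  assumes b: "\<And>j. b j \<in> {-1, 0, 1}" "b 0 = 1" and x: "1/2 \<le> x" "x \<le> 2/3" and M: "20 \<le> M"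
  shows "\<exists>A B. \<bar>A\<bar> \<le> 20 \<and> 0 \<le> B \<and> B \<le> 1 \<and>
           (\<Sum>j<M. b j * (A + B * real j) * x ^ j) \<le> - 1 / 10000"
proof -
  have pre: "\<And>j. j < length [1 :: real] \<Longrightarrow> b j = [1] ! j" using b by auto
  consider "x \<le> 16/25" | "16/25 \<le> x" "x \<le> 33/50" | "33/50 \<le> x" by linarith
  then show ?thesis
  proof cases
    case 1
    show ?thesis
      by (rule check_sound[OF check_low b(1) pre _ x(1) 1 _ M]) auto
  next
    case 2
    show ?thesis
      by (rule check_sound[OF check_mid b(1) pre _ 2 _ M]) auto
  next
    case 3
    show ?thesis
      by (rule check_sound[OF check_high b(1) pre _ 3 x(2) _ M]) auto
  qed
qed

section \<open>From negative combinations of f and f' to separation of parameters\<close>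

definition psum :: "(nat \<Rightarrow> real) \<Rightarrow> nat \<Rightarrow> real \<Rightarrow> real" where
  "psum b M x = (\<Sum>j<M. b j * x ^ j)"

definition dpsum :: "(nat \<Rightarrow> real) \<Rightarrow> nat \<Rightarrow> real \<Rightarrow> real" where
  "dpsum b M x = (\<Sum>j<M. b j * (real j * x ^ (j - 1)))"

lemma psum_has_real_derivative: "(psum b M has_real_derivative dpsum b M x) (at x)"
  unfolding psum_def dpsum_def
  by (auto intro!: derivative_eq_intros sum.cong)

text \<open>The sum in \<open>transversality_sum\<close> equals A f + B x f'. If |f| <= 10^-6, the
  first summand is at most 2 * 10^-5 in absolute value, which leaves B x f' <= -8 * 10^-5. This
  forces f' < 0, and B x <= 1 then gives f' <= B x f'.\<close>

lemma transversality_deriv: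
  assumes b: "\<And>j. b j \<in> {-1, 0, 1}" "b 0 = 1" and x: "1/2 \<le> x" "x \<le> 2/3" and M: "20 \<le> M"
    and small: "\<bar>psum b M x\<bar> \<le> 1 / 10^6"
  shows "dpsum b M x \<le> - 1 / 10^6"
proof -
  obtain A B where AB: "\<bar>A\<bar> \<le> 20" "0 \<le> B" "B \<le> 1"
      and le: "(\<Sum>j<M. b j * (A + B * real j) * x ^ j) \<le> - 1 / 10000"
    using transversality_sum[of b x M, OF b x M] by blast
  have "x * dpsum b M x = (\<Sum>j<M. b j * real j * x ^ j)"
    unfolding dpsum_def sum_distrib_left
  proof (intro sum.cong refl)
    fix j show "x * (b j * (real j * x ^ (j - 1))) = b j * real j * x ^ j"
      by (cases j) auto
  qed
  then have "(\<Sum>j<M. b j * (A + B * real j) * x ^ j) = A * psum b M x + B * (x * dpsum b M x)"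
    by (simp add: psum_def sum_distrib_left algebra_simps flip: sum.distrib)
  moreover have "\<bar>A * psum b M x\<bar> \<le> 20 * (1 / 10^6)"
    unfolding abs_mult by (intro mult_mono AB small) auto
  ultimately have *: "B * (x * dpsum b M x) \<le> - 8 / 10^5" using le by simp
  have neg: "dpsum b M x < 0"
  proof (rule ccontr)
    assume "\<not> ?thesis"
    then have "B * (x * dpsum b M x) \<ge> 0" using AB x by simp
    with * show False by simp
  qed
  have "B * x \<le> 1 * 1" using AB x by (intro mult_mono) auto
  then have "1 * dpsum b M x \<le> (B * x) * dpsum b M x" using neg
    by (intro mult_right_mono_neg) auto
  with * show ?thesis by (simp add: mult.assoc)
qed

lemma first_crossing:
  fixes f :: "real \<Rightarrow> real"
  assumes cont: "continuous_on {x..z} f" and "x \<le> z" "f x < d" "d \<le> f z"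
  obtains w where "x < w" "w \<le> z" "f w = d" "\<And>v. x \<le> v \<Longrightarrow> v < w \<Longrightarrow> f v < d"
proof -
  define S where "S = {v \<in> {x..z}. f v = d}"
  have ex: "\<exists>u. x \<le> u \<and> u \<le> v \<and> f u = d" if "x \<le> v" "v \<le> z" "d \<le> f v" for v
    using IVT'[of f x d v] assms that continuous_on_subset[OF cont, of "{x..v}"] by auto
  have "closed S" unfolding S_def
    by (intro continuous_closed_preimage_constant cont) auto
  moreover have "bounded S" unfolding S_def
    by (rule bounded_subset[of "{x..z}"]) auto
  ultimately have "compact S" by (simp add: compact_eq_bounded_closed)
  moreover have "S \<noteq> {}" using ex[of z] assms unfolding S_def by auto
  ultimately obtain w where w: "w \<in> S" "\<And>v. v \<in> S \<Longrightarrow> w \<le> v"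
    using compact_attains_inf[of S] by blast
  have "f v < d" if v: "x \<le> v" "v < w" for v
  proof (rule ccontr)
    assume "\<not> f v < d"
    moreover have "v \<le> z" using v w unfolding S_def by auto
    ultimately obtain u where "x \<le> u" "u \<le> v" "f u = d" using ex[of v] v by auto
    then have "u \<in> S" using v w unfolding S_def by auto
    with w(2)[of u] \<open>u \<le> v\<close> v show False by auto
  qed
  moreover have "x \<noteq> w" using w assms unfolding S_def by auto
  ultimately show thesis using w that[of w] unfolding S_def by auto
qed

lemma last_crossing:
  fixes f :: "real \<Rightarrow> real"
  assumes cont: "continuous_on {z..y} f" and "z \<le> y" "f z \<le> d" "d < f y"
  obtains w where "z \<le> w" "w < y" "f w = d" "\<And>v. w < v \<Longrightarrow> v \<le> y \<Longrightarrow> d < f v"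
proof -
  have "continuous_on {- y..- z} (\<lambda>t. - f (- t))"
    by (intro continuous_intros continuous_on_compose2[OF cont]) auto
  moreover have "- y \<le> - z" "- f (- (- y)) < - d" "- d \<le> - f (- (- z))" using assms by auto
  ultimately show thesis
  proof (rule first_crossing)
    fix w assume w: "- y < w" "w \<le> - z" "- f (- w) = - d"
      "\<And>v. - y \<le> v \<Longrightarrow> v < w \<Longrightarrow> - f (- v) < - d"
    have "d < f v" if "- w < v" "v \<le> y" for v
      using w(4)[of "- v"] that by auto
    with w(1-3) show thesis by (intro that[of "- w"]) auto
  qed
qed

text \<open>Wherever |f| <= 10^-6 the slope is at most -10^-6. Between two points inside this band
  the graph cannot leave the band, so the slope bound holds on the whole segment and the mean value
  theorem gives the claim.\<close>

lemma transversality: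
  assumes b: "\<And>j. b j \<in> {-1, 0, 1}" "b 0 = 1" and M: "20 \<le> M"
    and x: "1/2 \<le> x" "x \<le> 2/3" and y: "1/2 \<le> y" "y \<le> 2/3"
    and r: "\<bar>psum b M x\<bar> \<le> r" "\<bar>psum b M y\<bar> \<le> r"
  shows "\<bar>x - y\<bar> \<le> 2 * 10^6 * r"
proof -
  have main: "y - x \<le> 2 * 10^6 * r"
    if "x < y" "1/2 \<le> x" "y \<le> 2/3" "\<bar>psum b M x\<bar> \<le> r" "\<bar>psum b M y\<bar> \<le> r" for x y
  proof (cases "r < 1 / 10^6")
    case False
    with that show ?thesis by simp
  next
    case True
    define f where "f = psum b M"
    define d :: real where "d = 1 / 10^6"
    have fd: "(f has_real_derivative dpsum b M z) (at z)" for z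
      unfolding f_def by (rule psum_has_real_derivative)
    have cont: "continuous_on S f" for S
      by (meson fd DERIV_isCont continuous_at_imp_continuous_on)
    have tr: "dpsum b M z \<le> - d" if "\<bar>f z\<bar> \<le> d" "x \<le> z" "z \<le> y" for z
      using transversality_deriv[of b z M, OF b _ _ M] that \<open>1/2 \<le> x\<close> \<open>y \<le> 2/3\<close>
      unfolding f_def d_def by auto
    have fx: "\<bar>f x\<bar> < d" "\<bar>f y\<bar> < d" using that True unfolding f_def d_def by auto
    \<comment> \<open>At its first arrival at the level d, f would come from below, against the
      negative slope. \<open>gtd\<close> is the mirror argument at the last departure from
      -d.\<close>
    have ltd: "f z < d" if z: "x \<le> z" "z \<le> y" for z
    proof (rule ccontr)
      assume nz: "\<not> f z < d"
      then obtain w where w: "x < w" "w \<le> z" "f w = d" "\<And>v. x \<le> v \<Longrightarrow> v < w \<Longrightarrow> f v < d"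
        using first_crossing[OF cont z(1), of d] fx nz by (metis abs_less_iff linorder_not_less)
      have "x < w" by (rule w)
      have "dpsum b M w < 0" using tr[of w] w z fx unfolding d_def by (auto simp: d_def)
      then obtain e where e: "e > 0" "\<And>h. h > 0 \<Longrightarrow> h < e \<Longrightarrow> f w < f (w - h)"
        using DERIV_neg_dec_left[OF fd] by blast
      define h where "h = min (e / 2) (w - x)"
      have "f w < f (w - h)" using e \<open>x < w\<close> by (intro e) (auto simp: h_def)
      moreover have "f (w - h) < d" using e \<open>x < w\<close> by (intro w) (auto simp: h_def)
      ultimately show False using w by simp
    qed
    have gtd: "- d < f z" if z: "x \<le> z" "z \<le> y" for z
    proof (rule ccontr)
      assume nz: "\<not> - d < f z"
      then obtain w where w: "z \<le> w" "w < y" "f w = - d" "\<And>v. w < v \<Longrightarrow> v \<le> y \<Longrightarrow> - d < f v"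
        using last_crossing[OF cont z(2), of "- d"] fx nz
        by (metis abs_less_iff linorder_not_less minus_less_iff)
      have "dpsum b M w < 0" using tr[of w] w z fx by (auto simp: d_def)
      then obtain e where e: "e > 0" "\<And>h. h > 0 \<Longrightarrow> h < e \<Longrightarrow> f w > f (w + h)"
        using DERIV_neg_dec_right[OF fd] by blast
      define h where "h = min (e / 2) (y - w)"
      have "f (w + h) < f w" using e w(2) by (intro e) (auto simp: h_def)
      moreover have "- d < f (w + h)" using e w(2) by (intro w) (auto simp: h_def)
      ultimately show False using w by simp
    qed
    obtain z where z: "x < z" "z < y" "f y - f x = (y - x) * dpsum b M z"
      using MVT2[OF \<open>x < y\<close>, of f "dpsum b M"] fd by blast
    have "dpsum b M z \<le> - d" using tr[of z] ltd[of z] gtd[of z] z by auto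
    then have "(y - x) * dpsum b M z \<le> (y - x) * (- d)" using that by (intro mult_left_mono) auto
    then have "(y - x) * d \<le> 2 * r" using z that unfolding f_def by auto
    then show ?thesis unfolding d_def by simp
  qed
  have "0 \<le> r" using r by linarith
  then show ?thesis
    using main[of x y] main[of y x] x y r by (cases x y rule: linorder_cases) auto
qed

section \<open>Hausdorff measure and weighted covers\<close>

lemma hausdorff_premeasure_le:
  assumes "A \<subseteq> (\<Union>i. U i)" "\<And>i. bounded (U i)" "\<And>i. diameter (U i) \<le> \<delta>"
  shows "hausdorff_premeasure t \<delta> A \<le> (\<Sum>i. diam_power t (U i))"
  unfolding hausdorff_premeasure_def by (rule INF_lower) (use assms in auto)

lemma hausdorff_premeasure_mono:
  assumes "A \<subseteq> B"
  shows "hausdorff_premeasure t \<delta> A \<le> hausdorff_premeasure t \<delta> B"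
  unfolding hausdorff_premeasure_def by (rule INF_superset_mono) (use assms in auto)

lemma hausdorff_premeasure_cover:
  assumes "hausdorff_premeasure t \<delta> A < e"
  obtains U where "A \<subseteq> (\<Union>i. U i)" "\<And>i. bounded (U i)" "\<And>i. diameter (U i) \<le> \<delta>"
    "(\<Sum>i. diam_power t (U i)) < e"
  using assms unfolding hausdorff_premeasure_def INF_less_iff by auto

lemma hausdorff_premeasure_finite_cover:
  assumes "finite S" "A \<subseteq> (\<Union>p\<in>S. U p)" "\<And>p. p \<in> S \<Longrightarrow> bounded (U p)"
    "\<And>p. p \<in> S \<Longrightarrow> diameter (U p) \<le> \<delta>" "0 \<le> \<delta>"
  shows "hausdorff_premeasure t \<delta> A \<le> (\<Sum>p\<in>S. diam_power t (U p))"
proof -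
  obtain g where g: "bij_betw g {..<card S} S"
    using ex_bij_betw_nat_finite[OF \<open>finite S\<close>] by (auto simp: atLeast0LessThan)
  \<comment> \<open>Padding by the empty set is free: its \<open>diam_power\<close> is 0 for every
    exponent, including 0.\<close>
  define V where "V i = (if i < card S then U (g i) else {})" for i
  have "A \<subseteq> (\<Union>i. V i)"
  proof
    fix x assume "x \<in> A"
    then obtain p where "p \<in> S" "x \<in> U p" using assms by auto
    then obtain i where "i < card S" "g i = p" using g by (metis bij_betw_iff_bijections lessThan_iff)
    then have "x \<in> V i" using \<open>x \<in> U p\<close> by (auto simp: V_def)
    then show "x \<in> (\<Union>i. V i)" by blast
  qed
  moreover have "bounded (V i)" "diameter (V i) \<le> \<delta>" for i
    using bij_betwE[OF g] assms by (auto simp: V_def)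
  ultimately have "hausdorff_premeasure t \<delta> A \<le> (\<Sum>i. diam_power t (V i))"
    by (rule hausdorff_premeasure_le)
  also have "\<dots> = (\<Sum>i<card S. diam_power t (V i))"
    by (rule suminf_finite) (auto simp: V_def diam_power_def)
  also have "\<dots> = (\<Sum>i<card S. diam_power t (U (g i)))" by (simp add: V_def)
  also have "\<dots> = (\<Sum>p\<in>S. diam_power t (U p))"
    by (rule sum.reindex_bij_betw[OF g])
  finally show ?thesis .
qed

lemma hausdorff_premeasure_UN_le:
  "hausdorff_premeasure t \<delta> (\<Union>i::nat. A i) \<le> (\<Sum>i. hausdorff_premeasure t \<delta> (A i))"
proof (cases "\<exists>i. hausdorff_premeasure t \<delta> (A i) = \<infinity>")
  case True
  then obtain i where i: "hausdorff_premeasure t \<delta> (A i) = \<infinity>" by blast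
  have "hausdorff_premeasure t \<delta> (A i) \<le> (\<Sum>i. hausdorff_premeasure t \<delta> (A i))"
    using sum_le_suminf[of "\<lambda>i. hausdorff_premeasure t \<delta> (A i)" "{i}"] by simp
  with i have "(\<Sum>i. hausdorff_premeasure t \<delta> (A i)) = \<infinity>" by (simp add: top_unique)
  then show ?thesis by simp
next
  case False
  show ?thesis
  proof (rule ennreal_le_epsilon)
    fix e :: real assume "0 < e"
    have "\<exists>U. A i \<subseteq> (\<Union>j. U j) \<and> (\<forall>j. bounded (U j) \<and> diameter (U j) \<le> \<delta>) \<and>
        (\<Sum>j. diam_power t (U j)) \<le> hausdorff_premeasure t \<delta> (A i) + ennreal (e * (1/2)^Suc i)" for i
    proof -
      have "hausdorff_premeasure t \<delta> (A i) < hausdorff_premeasure t \<delta> (A i) + ennreal (e * (1/2)^Suc i)"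
        using False \<open>0 < e\<close> by (auto simp: top.not_eq_extremum)
      then show ?thesis by (rule hausdorff_premeasure_cover) (metis less_imp_le)
    qed
    then obtain U where U: "\<And>i. A i \<subseteq> (\<Union>j. U i j)" "\<And>i j. bounded (U i j)" "\<And>i j. diameter (U i j) \<le> \<delta>"
      "\<And>i. (\<Sum>j. diam_power t (U i j)) \<le> hausdorff_premeasure t \<delta> (A i) + ennreal (e * (1/2)^Suc i)"
      by metis
    define V where "V n = case_prod U (prod_decode n)" for n
    have "hausdorff_premeasure t \<delta> (\<Union>i. A i) \<le> (\<Sum>n. diam_power t (V n))"
    proof (rule hausdorff_premeasure_le)
      show "(\<Union>i. A i) \<subseteq> (\<Union>n. V n)"
      proof
        fix x assume "x \<in> (\<Union>i. A i)"
        then obtain i j where "x \<in> U i j" using U(1) by blast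
        then have "x \<in> V (prod_encode (i, j))" by (simp add: V_def)
        then show "x \<in> (\<Union>n. V n)" by blast
      qed
    qed (auto simp: V_def U split: prod.split)
    also have "\<dots> = (\<Sum>i. \<Sum>j. diam_power t (U i j))"
      unfolding V_def
      using suminf_ennreal_2dimen[of "\<lambda>i. \<Sum>j. diam_power t (U i j)" "\<lambda>p. diam_power t (case_prod U p)"]
      by simp
    also have "\<dots> \<le> (\<Sum>i. hausdorff_premeasure t \<delta> (A i) + ennreal (e * (1/2)^Suc i))"
      by (intro suminf_le U) auto
    also have "\<dots> = (\<Sum>i. hausdorff_premeasure t \<delta> (A i)) + (\<Sum>i. ennreal (e * (1/2)^Suc i))"
      by (intro suminf_add[symmetric]) auto
    also have "(\<Sum>i. ennreal (e * (1/2)^Suc i)) = ennreal e"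
      using power_half_series \<open>0 < e\<close> sums_mult[OF power_half_series, of e]
      by (intro suminf_ennreal_eq) auto
    finally show "hausdorff_premeasure t \<delta> (\<Union>i. A i) \<le> (\<Sum>i. hausdorff_premeasure t \<delta> (A i)) + ennreal e" .
  qed
qed

lemma hausdorff_measure_eq_0_iff:
  "hausdorff_measure t A = 0 \<longleftrightarrow> (\<forall>\<delta>>0. hausdorff_premeasure t \<delta> A = 0)"
proof -
  have "hausdorff_measure t A = 0 \<longleftrightarrow> hausdorff_measure t A \<le> 0" by simp
  also have "\<dots> \<longleftrightarrow> (\<forall>\<delta>>0. hausdorff_premeasure t \<delta> A = 0)"
    unfolding hausdorff_measure_def SUP_le_iff by auto
  finally show ?thesis .
qed

lemma hausdorff_measure_null_UN:
  assumes "\<And>i::nat. hausdorff_measure t (A i) = 0"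
  shows "hausdorff_measure t (\<Union>i. A i) = 0"
  unfolding hausdorff_measure_eq_0_iff
proof safe
  fix \<delta> :: real assume "\<delta> > 0"
  with assms have "(\<Sum>i. hausdorff_premeasure t \<delta> (A i)) = 0"
    unfolding hausdorff_measure_eq_0_iff by simp
  then show "hausdorff_premeasure t \<delta> (\<Union>i. A i) = 0"
    using hausdorff_premeasure_UN_le[of t \<delta> A] by simp
qed

lemma hausdorff_measure_null_mono:
  assumes "A \<subseteq> B" "hausdorff_measure t B = 0"
  shows "hausdorff_measure t A = 0"
  using assms hausdorff_premeasure_mono[OF assms(1)] unfolding hausdorff_measure_eq_0_iff
  by (metis le_zero_eq)

text \<open>Exponents just above s suffice. The cap s' will be 1, because the estimate for the
  parameters is confined to exponents below 1.\<close>

lemma hausdorff_dim_le: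
  assumes "0 \<le> s" "s < s'" "\<And>t. s < t \<Longrightarrow> t < s' \<Longrightarrow> hausdorff_measure t A = 0"
  shows "hausdorff_dim A \<le> ereal s"
proof (rule ereal_le_epsilon2)
  fix e :: real assume "0 < e"
  define t where "t = min (s + e) ((s + s') / 2)"
  have "hausdorff_dim A \<le> ereal t"
    unfolding hausdorff_dim_def using assms \<open>0 < e\<close>
    by (intro Inf_lower) (auto simp: t_def min_def)
  also have "\<dots> \<le> ereal s + ereal e" by (simp add: t_def)
  finally show "hausdorff_dim A \<le> ereal s + ereal e" .
qed

section \<open>Dyadic intervals\<close>

definition dyad :: "nat \<Rightarrow> real \<Rightarrow> int" where
  "dyad q x = \<lfloor>2 ^ q * x\<rfloor>"

text \<open>Closed, while \<open>dyad\<close> indexes half-open intervals: finite unions of these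
  become the compact supports needed later.\<close>

definition dyad_int :: "nat \<Rightarrow> int \<Rightarrow> real set" where
  "dyad_int q z = {z / 2 ^ q .. (z + 1) / 2 ^ q}"

lemma dyad_div:
  assumes "r \<le> q"
  shows "dyad q x div 2 ^ (q - r) = dyad r x"
proof -
  have "(2 :: real) ^ q * x / real_of_int (2 ^ (q - r)) = 2 ^ r * x"
    using assms by (simp add: power_diff_power_eq field_simps flip: power_add)
  then show ?thesis
    using floor_divide_real_eq_div[of "2 ^ (q - r)" "2 ^ q * x"] by (simp add: dyad_def)
qed

lemma dyad_Suc_div: "dyad (Suc q) x div 2 = dyad q x"
  using dyad_div[of q "Suc q" x] by simp

lemma in_dyad_int: "x \<in> dyad_int q (dyad q x)"
proof -
  have "of_int (dyad q x) \<le> 2 ^ q * x" "2 ^ q * x < of_int (dyad q x) + 1"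
    unfolding dyad_def by linarith+
  then show ?thesis by (auto simp: dyad_int_def field_simps)
qed

lemma bounded_dyad_int [simp]: "bounded (dyad_int q z)"
  by (simp add: dyad_int_def)

lemma diameter_dyad_int [simp]: "diameter (dyad_int q z) = (1 / 2) ^ q"
proof -
  have "(z + 1) / 2 ^ q - z / 2 ^ q = (1 / 2 :: real) ^ q"
    by (simp add: power_divide flip: diff_divide_distrib)
  moreover have "z / 2 ^ q \<le> ((z + 1) / 2 ^ q :: real)" by (intro divide_right_mono) auto
  ultimately show ?thesis unfolding dyad_int_def by (subst diameter_closed_interval) auto
qed

lemma half_power_powr: "((1 / 2) ^ q :: real) powr s = 2 powr (- (real q * s))"
proof -
  have "((1 / 2) ^ q :: real) = 2 powr (- real q)"
    by (simp add: powr_minus powr_realpow power_one_over inverse_eq_divide)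
  then show ?thesis by (simp add: powr_powr)
qed

text \<open>Induction from the leaves of the dyadic tree; \<open>h\<close> is the total weight that the point receives from
  the ancestors of the current interval.\<close>
lemma weighted_cover_aux:
  fixes lev :: "'p \<Rightarrow> nat" and pos :: "'p \<Rightarrow> int" and w :: "'p \<Rightarrow> real" and c :: "nat \<Rightarrow> real"
  assumes "finite P" and w: "\<And>p. p \<in> P \<Longrightarrow> 0 \<le> w p" and c: "\<And>q. 0 \<le> c q"
    and L: "\<And>p. p \<in> P \<Longrightarrow> lev p < L"
  shows "\<exists>S. finite S \<and>
     (\<forall>x. dyad r x = y \<and> 1 \<le> h + sum w {p \<in> P. r \<le> lev p \<and> pos p div 2 ^ (lev p - r) = y \<and> dyad (lev p) x = pos p}
        \<longrightarrow> (\<exists>(q, z) \<in> S. dyad q x = z)) \<and>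
     (1 - h) * (\<Sum>(q, z)\<in>S. c q) \<le> (\<Sum>p\<in>{p \<in> P. r \<le> lev p \<and> pos p div 2 ^ (lev p - r) = y}. w p * c (lev p))"
proof (induction "L - r" arbitrary: r y h)
  case 0
  then have *: "{p \<in> P. r \<le> lev p \<and> Q p} = {}" for Q using L by fastforce
  show ?case
  proof (cases "h \<ge> 1")
    case True
    \<comment> \<open>Past the last level no weights remain. The single interval is affordable
      because (1 - h) * c r <= 0.\<close>
    then show ?thesis using c[of r] unfolding * by (intro exI[of _ "{(r, y)}"]) (auto simp: mult_nonpos_nonneg)
  next
    case False
    then show ?thesis unfolding * by (intro exI[of _ "{}"]) auto
  qed
next
  case (Suc k)
  define below where "below r y = {p \<in> P. r \<le> lev p \<and> pos p div 2 ^ (lev p - r) = y}" for r y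
  define own where "own = {p \<in> P. lev p = r \<and> pos p = y}"
  define T where "T r y = (\<Sum>p\<in>below r y. w p * c (lev p))" for r y
  have fin [simp]: "finite (below r y)" "finite own" for r y
    using \<open>finite P\<close> by (auto simp: below_def own_def)
  have below_eq: "below r y = own \<union> (below (Suc r) (2 * y) \<union> below (Suc r) (2 * y + 1))"
  proof -
    have step: "pos p div 2 ^ (lev p - r) = pos p div 2 ^ (lev p - Suc r) div 2" if "Suc r \<le> lev p" for p
      using that by (simp add: Suc_diff_Suc flip: zdiv_zmult2_eq power_Suc2)
    show ?thesis
    proof (intro set_eqI)
      fix p
      show "p \<in> below r y \<longleftrightarrow> p \<in> own \<union> (below (Suc r) (2 * y) \<union> below (Suc r) (2 * y + 1))"
      proof (cases "Suc r \<le> lev p")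
        case True
        have "(a::int) div 2 = y \<longleftrightarrow> a = 2 * y \<or> a = 2 * y + 1" for a by presburger
        with True step[OF True] show ?thesis by (auto simp: below_def own_def)
      next
        case False
        then show ?thesis by (auto simp: below_def own_def le_Suc_eq)
      qed
    qed
  qed
  have disj: "own \<inter> (below (Suc r) (2 * y) \<union> below (Suc r) (2 * y + 1)) = {}"
    "below (Suc r) (2 * y) \<inter> below (Suc r) (2 * y + 1) = {}"
    by (auto simp: below_def own_def)
  have nn: "0 \<le> T r y" for r y
    unfolding T_def by (intro sum_nonneg mult_nonneg_nonneg w c) (auto simp: below_def)
  have ownT: "(\<Sum>p\<in>own. w p * c (lev p)) = sum w own * c r"
    unfolding sum_distrib_right by (intro sum.cong) (auto simp: own_def)
  have Teq: "T r y = sum w own * c r + (T (Suc r) (2 * y) + T (Suc r) (2 * y + 1))"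
    unfolding T_def below_eq ownT[symmetric]
    by (simp add: sum.union_disjoint disj)
  have own_nn: "0 \<le> sum w own" by (intro sum_nonneg w) (auto simp: own_def)
  define h' where "h' = h + sum w own"
  have hit: "h + sum w {p \<in> below r y. dyad (lev p) x = pos p} =
      h' + sum w {p \<in> below (Suc r) (dyad (Suc r) x). dyad (lev p) x = pos p}" if "dyad r x = y" for x
  proof -
    have "{p \<in> below r y. dyad (lev p) x = pos p} =
        own \<union> {p \<in> below (Suc r) (dyad (Suc r) x). dyad (lev p) x = pos p}"
    proof (intro set_eqI)
      fix p
      show "p \<in> {p \<in> below r y. dyad (lev p) x = pos p} \<longleftrightarrow>
         p \<in> own \<union> {p \<in> below (Suc r) (dyad (Suc r) x). dyad (lev p) x = pos p}"
      proof (cases "Suc r \<le> lev p")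
        case True
        with that dyad_div[of r "lev p" x] dyad_div[of "Suc r" "lev p" x] show ?thesis
          by (auto simp: below_def own_def)
      next
        case False
        with that show ?thesis by (auto simp: below_def own_def le_Suc_eq not_le less_Suc_eq)
      qed
    qed
    moreover have "own \<inter> {p \<in> below (Suc r) (dyad (Suc r) x). dyad (lev p) x = pos p} = {}"
      by (auto simp: below_def own_def)
    ultimately show ?thesis by (simp add: sum.union_disjoint h'_def)
  qed
  have goal_cong: "{p \<in> P. r \<le> lev p \<and> pos p div 2 ^ (lev p - r) = y \<and> dyad (lev p) x = pos p}
      = {p \<in> below r y. dyad (lev p) x = pos p}" for r y x
    by (auto simp: below_def)
  show ?case
    unfolding goal_cong
    unfolding below_def[symmetric] T_def[symmetric]
  proof (cases "h' \<ge> 1")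
    case True
    \<comment> \<open>Every point of the interval has already received weight h' >= 1, so the
      interval covers itself; its own weight h' - h >= 1 - h pays for it.\<close>
    have "(1 - h) * c r \<le> sum w own * c r"
      using True c[of r] by (intro mult_right_mono) (auto simp: h'_def)
    also have "\<dots> \<le> T r y" unfolding Teq using nn by simp
    finally show "\<exists>S. finite S \<and>
      (\<forall>x. dyad r x = y \<and> 1 \<le> h + sum w {p \<in> below r y. dyad (lev p) x = pos p}
        \<longrightarrow> (\<exists>(q, z) \<in> S. dyad q x = z)) \<and> (1 - h) * (\<Sum>(q, z)\<in>S. c q) \<le> T r y"
      by (intro exI[of _ "{(r, y)}"]) auto
  next
    case False
    have IH: "\<exists>S. finite S \<and>
      (\<forall>x. dyad (Suc r) x = y' \<and> 1 \<le> h' + sum w {p \<in> below (Suc r) y'. dyad (lev p) x = pos p}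
        \<longrightarrow> (\<exists>(q, z) \<in> S. dyad q x = z)) \<and> (1 - h') * (\<Sum>(q, z)\<in>S. c q) \<le> T (Suc r) y'" for y'
      using Suc(1)[of "Suc r" y' h'] Suc(2) unfolding goal_cong below_def[symmetric] T_def[symmetric]
      by simp
    obtain S1 where S1: "finite S1"
      "\<And>x. dyad (Suc r) x = 2 * y \<Longrightarrow> 1 \<le> h' + sum w {p \<in> below (Suc r) (2 * y). dyad (lev p) x = pos p}
         \<Longrightarrow> \<exists>(q, z) \<in> S1. dyad q x = z"
      "(1 - h') * (\<Sum>(q, z)\<in>S1. c q) \<le> T (Suc r) (2 * y)"
      using IH[of "2 * y"] by blast
    obtain S2 where S2: "finite S2"
      "\<And>x. dyad (Suc r) x = 2 * y + 1 \<Longrightarrow> 1 \<le> h' + sum w {p \<in> below (Suc r) (2 * y + 1). dyad (lev p) x = pos p}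
         \<Longrightarrow> \<exists>(q, z) \<in> S2. dyad q x = z"
      "(1 - h') * (\<Sum>(q, z)\<in>S2. c q) \<le> T (Suc r) (2 * y + 1)"
      using IH[of "2 * y + 1"] by blast
    define C where "C S = (\<Sum>(q, z)\<in>S. c q)" for S :: "(nat \<times> int) set"
    have "C (S1 \<union> S2) + C (S1 \<inter> S2) = C S1 + C S2"
      unfolding C_def by (intro sum.union_inter S1 S2)
    moreover have "0 \<le> C (S1 \<inter> S2)" unfolding C_def by (intro sum_nonneg) (auto simp: c)
    ultimately have CU: "C (S1 \<union> S2) \<le> C S1 + C S2" by linarith
    \<comment> \<open>The cheaper of the two children's covers together and the interval itself. Its
      cost is at most c r, so the weight at this node pays the share h' - h of it and the children
      pay the share 1 - h'.\<close>
    define S where "S = (if C (S1 \<union> S2) \<le> c r then S1 \<union> S2 else {(r, y)})"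
    have CS: "C S \<le> c r" "C S \<le> C S1 + C S2"
      using CU by (auto simp: S_def C_def[of "{(r, y)}"])
    have "(1 - h) * C S = sum w own * C S + (1 - h') * C S" by (simp add: h'_def algebra_simps)
    also have "\<dots> \<le> sum w own * c r + (1 - h') * (C S1 + C S2)"
      using CS own_nn False by (intro add_mono mult_left_mono) auto
    also have "\<dots> \<le> T r y"
      unfolding Teq using S1(3) S2(3) unfolding C_def[symmetric] by (simp add: algebra_simps)
    finally have "(1 - h) * C S \<le> T r y" .
    moreover have "\<exists>(q, z) \<in> S. dyad q x = z"
      if x: "dyad r x = y" "1 \<le> h + sum w {p \<in> below r y. dyad (lev p) x = pos p}" for x
    proof (cases "C (S1 \<union> S2) \<le> c r")
      case True
      have "dyad (Suc r) x = 2 * y \<or> dyad (Suc r) x = 2 * y + 1"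
        using dyad_Suc_div[of r x] x by presburger
      then show ?thesis
      proof
        assume *: "dyad (Suc r) x = 2 * y"
        show ?thesis using S1(2)[OF *] x hit[OF x(1)] True unfolding * S_def by auto
      next
        assume *: "dyad (Suc r) x = 2 * y + 1"
        show ?thesis using S2(2)[OF *] x hit[OF x(1)] True unfolding * S_def by auto
      qed
    qed (use x in \<open>auto simp: S_def\<close>)
    moreover have "finite S" using S1 S2 by (auto simp: S_def)
    ultimately show "\<exists>S. finite S \<and>
      (\<forall>x. dyad r x = y \<and> 1 \<le> h + sum w {p \<in> below r y. dyad (lev p) x = pos p}
        \<longrightarrow> (\<exists>(q, z) \<in> S. dyad q x = z)) \<and> (1 - h) * (\<Sum>(q, z)\<in>S. c q) \<le> T r y"
      unfolding C_def by blast
  qed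
qed

text \<open>Rounds a fractional cover to a genuine one at no greater cost. It does the work of
  testing the weights against a Frostman measure, by duality on a tree.\<close>

lemma weighted_cover:
  fixes lev :: "'p \<Rightarrow> nat" and pos :: "'p \<Rightarrow> int" and w :: "'p \<Rightarrow> real" and c :: "nat \<Rightarrow> real"
  assumes "finite P" and w: "\<And>p. p \<in> P \<Longrightarrow> 0 \<le> w p" and c: "\<And>q. 0 \<le> c q"
  obtains S where "finite S"
    "\<And>x. 0 \<le> x \<Longrightarrow> x < 1 \<Longrightarrow> 1 \<le> sum w {p \<in> P. dyad (lev p) x = pos p} \<Longrightarrow> \<exists>(q, z) \<in> S. dyad q x = z"
    "(\<Sum>(q, z)\<in>S. c q) \<le> (\<Sum>p\<in>P. w p * c (lev p))"
proof -
  define L where "L = Suc (Max (insert 0 (lev ` P)))"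
  have L: "lev p < L" if "p \<in> P" for p
    using that \<open>finite P\<close> by (auto simp: L_def less_Suc_eq_le)
  obtain S where S: "finite S" 
    "\<And>x. dyad 0 x = 0 \<Longrightarrow> 1 \<le> 0 + sum w {p \<in> P. 0 \<le> lev p \<and> pos p div 2 ^ (lev p - 0) = 0 \<and> dyad (lev p) x = pos p}
        \<Longrightarrow> (\<exists>(q, z) \<in> S. dyad q x = z)"
     "(1 - 0) * (\<Sum>(q, z)\<in>S. c q) \<le> (\<Sum>p\<in>{p \<in> P. 0 \<le> lev p \<and> pos p div 2 ^ (lev p - 0) = 0}. w p * c (lev p))"
    using weighted_cover_aux[of P w c lev L 0 0 0 pos, OF \<open>finite P\<close> w c L] by blast
  show thesis
  proof (rule that[OF S(1)])
    fix x :: real assume x: "0 \<le> x" "x < 1" "1 \<le> sum w {p \<in> P. dyad (lev p) x = pos p}"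
    have 0: "dyad 0 x = 0" using x by (simp add: dyad_def floor_eq_iff)
    have "{p \<in> P. 0 \<le> lev p \<and> pos p div 2 ^ (lev p - 0) = 0 \<and> dyad (lev p) x = pos p} =
      {p \<in> P. dyad (lev p) x = pos p}"
      using dyad_div[of 0 _ x] 0 by (auto; metis diff_zero le0)
    then show "\<exists>(q, z) \<in> S. dyad q x = z" using S(2)[OF 0] x by simp
  next
    have "(\<Sum>p\<in>{p \<in> P. 0 \<le> lev p \<and> pos p div 2 ^ (lev p - 0) = 0}. w p * c (lev p)) \<le> (\<Sum>p\<in>P. w p * c (lev p))"
      by (intro sum_mono2) (auto simp: \<open>finite P\<close> w c)
    with S(3) show "(\<Sum>(q, z)\<in>S. c q) \<le> (\<Sum>p\<in>P. w p * c (lev p))" by simp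
  qed
qed

text \<open>A Borel-Cantelli argument. Small diameters come for free: as s > 0, a total cost below
  \<delta>^s forces each single interval to be at most \<delta> long.\<close>

lemma hausdorff_measure_limsup_null:
  fixes S :: "nat \<Rightarrow> (nat \<times> int) set" and a :: "nat \<Rightarrow> real"
  assumes "0 < s" and fin: "\<And>k. finite (S k)"
    and cover: "\<And>k x. x \<in> B k \<Longrightarrow> \<exists>(q, z) \<in> S k. dyad q x = z"
    and cost: "\<And>k. (\<Sum>(q, z)\<in>S k. 2 powr (- (real q * s))) \<le> a k"
    and "summable a"
  shows "hausdorff_measure s {x. \<forall>K. \<exists>k\<ge>K. x \<in> B k} = 0"
  unfolding hausdorff_measure_eq_0_iff
proof safe
  fix \<delta> :: real assume "\<delta> > 0"
  have a_nn: "0 \<le> a k" for k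
    using sum_nonneg[of "S k" "\<lambda>(q, z). 2 powr (- (real q * s))"] cost[of k] by force
  have "a \<longlonglongrightarrow> 0" using \<open>summable a\<close> by (rule summable_LIMSEQ_zero)
  then have "\<forall>\<^sub>F k in sequentially. a k < \<delta> powr s" using \<open>\<delta> > 0\<close> by (intro order_tendstoD) auto
  then obtain K0 where K0: "\<And>k. k \<ge> K0 \<Longrightarrow> a k < \<delta> powr s"
    unfolding eventually_sequentially by blast
  have pre: "hausdorff_premeasure s \<delta> (B k) \<le> ennreal (a k)" if "k \<ge> K0" for k
  proof -
    have "hausdorff_premeasure s \<delta> (B k) \<le> (\<Sum>p\<in>S k. diam_power s (case_prod dyad_int p))"
    proof (rule hausdorff_premeasure_finite_cover)
      show "B k \<subseteq> (\<Union>p\<in>S k. case_prod dyad_int p)"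
        using cover[of _ k] in_dyad_int by fastforce
      fix p assume p: "p \<in> S k"
      obtain q z where [simp]: "p = (q, z)" by force
      have "2 powr (- (real q * s)) \<le> (\<Sum>(q, z)\<in>S k. 2 powr (- (real q * s)))"
        using member_le_sum[of p "S k" "\<lambda>(q, z). 2 powr (- (real q * s))"] p fin by auto
      also have "\<dots> < \<delta> powr s" using cost[of k] K0[OF that] by linarith
      finally have "((1/2) ^ q) powr s < \<delta> powr s" by (simp add: half_power_powr)
      then show "diameter (case_prod dyad_int p) \<le> \<delta>"
        using powr_mono2[of s \<delta> "(1/2) ^ q"] \<open>0 < s\<close> \<open>0 < \<delta>\<close> by force
    qed (use fin \<open>\<delta> > 0\<close> in \<open>auto split: prod.split\<close>)
    also have "\<dots> \<le> (\<Sum>p\<in>S k. ennreal (case p of (q, z) \<Rightarrow> 2 powr (- (real q * s))))"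
      using \<open>0 < s\<close> by (intro sum_mono) (auto simp: diam_power_def half_power_powr split: prod.split)
    also have "\<dots> = ennreal (\<Sum>(q, z)\<in>S k. 2 powr (- (real q * s)))"
      by (intro sum_ennreal) auto
    also have "\<dots> \<le> ennreal (a k)" using cost by (intro ennreal_leI)
    finally show ?thesis .
  qed
  have "hausdorff_premeasure s \<delta> {x. \<forall>K. \<exists>k\<ge>K. x \<in> B k} \<le> ennreal e" if "e > 0" for e
  proof -
    obtain K1 where K1: "\<And>n. n \<ge> K1 \<Longrightarrow> norm (\<Sum>i. a (i + n)) < e"
      using suminf_exist_split[OF \<open>e > 0\<close> \<open>summable a\<close>] by blast
    define K where "K = max K0 K1"
    have "hausdorff_premeasure s \<delta> {x. \<forall>K. \<exists>k\<ge>K. x \<in> B k} \<le> hausdorff_premeasure s \<delta> (\<Union>i. B (i + K))"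
    proof (intro hausdorff_premeasure_mono subsetI)
      fix x assume "x \<in> {x. \<forall>K. \<exists>k\<ge>K. x \<in> B k}"
      then obtain k where "k \<ge> K" "x \<in> B k" by blast
      then have "x \<in> B ((k - K) + K)" by simp
      then show "x \<in> (\<Union>i. B (i + K))" by blast
    qed
    also have "\<dots> \<le> (\<Sum>i. hausdorff_premeasure s \<delta> (B (i + K)))"
      by (rule hausdorff_premeasure_UN_le)
    also have "\<dots> \<le> (\<Sum>i. ennreal (a (i + K)))"
      by (intro suminf_le pre) (auto simp: K_def)
    also have "\<dots> = ennreal (\<Sum>i. a (i + K))"
      using \<open>summable a\<close> by (intro suminf_ennreal2 a_nn) (simp add: summable_iff_shift)
    also have "\<dots> \<le> ennreal e" using K1[of K] by (intro ennreal_leI) (auto simp: K_def)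
    finally show ?thesis .
  qed
  then have "hausdorff_premeasure s \<delta> {x. \<forall>K. \<exists>k\<ge>K. x \<in> B k} \<le> 0"
    by (intro ennreal_le_epsilon[of 0]) simp
  then show "hausdorff_premeasure s \<delta> {x. \<forall>K. \<exists>k\<ge>K. x \<in> B k} = 0" by simp
qed

section \<open>The exceptional parameters\<close>

definition fsum :: "real \<Rightarrow> nat set \<Rightarrow> real" where
  "fsum l S = (\<Sum>i\<in>S. l ^ i)"

text \<open>Without the condition S \<noteq> T, the 2^n diagonal pairs would make every parameter
  bad as soon as k t >= n.\<close>

definition close_pairs :: "real \<Rightarrow> nat \<Rightarrow> nat \<Rightarrow> (nat set \<times> nat set) set" where
  "close_pairs l n k =
     {(S, T). S \<subseteq> {1..n} \<and> T \<subseteq> {1..n} \<and> S \<noteq> T \<and> \<bar>fsum l S - fsum l T\<bar> \<le> (1 / 2) ^ k}"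

lemma close_pairs_subset: "close_pairs l n k \<subseteq> Pow {1..n} \<times> Pow {1..n}"
  by (auto simp: close_pairs_def)

lemma finite_close_pairs [simp]: "finite (close_pairs l n k)"
  by (rule finite_subset[OF close_pairs_subset]) auto

lemma card_close_pairs_le: "card (close_pairs l n k) \<le> 4 ^ n"
proof -
  have "card (close_pairs l n k) \<le> card (Pow {1..n} \<times> Pow {1..n})"
    by (intro card_mono close_pairs_subset) auto
  also have "\<dots> = 2 ^ n * 2 ^ n" by (simp add: card_cartesian_product card_Pow)
  also have "\<dots> = (2 * 2) ^ n" by (simp only: power_mult_distrib)
  finally show ?thesis by simp
qed

definition first_diff :: "nat set \<Rightarrow> nat set \<Rightarrow> nat" where
  "first_diff S T = (LEAST i. (i \<in> S) \<noteq> (i \<in> T))"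

lemma first_diff:
  assumes "S \<noteq> T"
  shows "(first_diff S T \<in> S) \<noteq> (first_diff S T \<in> T)"
    and "\<And>j. j < first_diff S T \<Longrightarrow> j \<in> S \<longleftrightarrow> j \<in> T"
proof -
  obtain i where "(i \<in> S) \<noteq> (i \<in> T)" using assms by auto
  then show "(first_diff S T \<in> S) \<noteq> (first_diff S T \<in> T)"
    unfolding first_diff_def by (rule LeastI)
  show "\<And>j. j < first_diff S T \<Longrightarrow> j \<in> S \<longleftrightarrow> j \<in> T"
    unfolding first_diff_def by (drule not_less_Least) auto
qed

lemma first_diff_in:
  assumes "S \<noteq> T" "S \<subseteq> {1..n}" "T \<subseteq> {1..n}"
  shows "first_diff S T \<in> {1..n}"
  using first_diff(1)[OF assms(1)] assms by blast

text \<open>Dividing by the sign and the power at the first difference normalises the polynomial to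
  constant term 1, the form that the certificates treat.\<close>

lemma fsum_diff_factor:
  assumes "S \<noteq> T" "S \<subseteq> {1..n}" "T \<subseteq> {1..n}"
  obtains b :: "nat \<Rightarrow> real" and M \<sigma> where "\<And>j. b j \<in> {- 1, 0, 1}" "b 0 = 1" "20 \<le> M"
    "\<bar>\<sigma>\<bar> = (1 :: real)" "\<And>x. fsum x S - fsum x T = \<sigma> * x ^ first_diff S T * psum b M x"
proof -
  define i where "i = first_diff S T"
  define \<sigma> :: real where "\<sigma> = (if i \<in> S then 1 else - 1)"
  define b :: "nat \<Rightarrow> real" where "b j = \<sigma> * (indicat_real S (i + j) - indicat_real T (i + j))" for j
  \<comment> \<open>The padding coefficients vanish; they serve only to reach the length 20 assumed
    by the certificates.\<close>
  define M where "M = n + 20"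
  have "fsum x S - fsum x T = \<sigma> * x ^ i * psum b M x" for x
  proof -
    have ind: "fsum x U = (\<Sum>j<i + M. indicat_real U j * x ^ j)" if "U \<subseteq> {1..n}" for U
    proof -
      have "fsum x U = (\<Sum>j\<in>{..<i + M} \<inter> U. x ^ j)"
        unfolding fsum_def by (intro sum.cong) (use that in \<open>auto simp: M_def\<close>)
      also have "\<dots> = (\<Sum>j<i + M. indicat_real U j * x ^ j)"
        by (subst sum.inter_restrict, simp, intro sum.cong) (auto simp: indicator_def)
      finally show ?thesis .
    qed
    have "fsum x S - fsum x T = (\<Sum>j<i + M. (indicat_real S j - indicat_real T j) * x ^ j)"
      using assms by (simp add: ind sum_subtractf left_diff_distrib)
    also have "\<dots> = (\<Sum>j=i..<i + M. (indicat_real S j - indicat_real T j) * x ^ j)"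
      by (rule sum.mono_neutral_right)
         (use first_diff(2)[OF assms(1)] in \<open>auto simp: i_def indicator_def\<close>)
    also have "\<dots> = (\<Sum>j<M. (indicat_real S (i + j) - indicat_real T (i + j)) * x ^ (i + j))"
      by (rule sum.reindex_bij_witness[of _ "\<lambda>j. i + j" "\<lambda>j. j - i"]) auto
    also have "\<dots> = \<sigma> * x ^ i * psum b M x"
      unfolding psum_def sum_distrib_left
      by (intro sum.cong) (auto simp: b_def power_add \<sigma>_def)
    finally show ?thesis .
  qed
  moreover have "b j \<in> {- 1, 0, 1}" for j by (auto simp: b_def \<sigma>_def indicator_def)
  moreover have "b 0 = 1"
    using first_diff(1)[OF assms(1)] by (auto simp: b_def \<sigma>_def i_def indicator_def)
  ultimately show thesis using that[of b M \<sigma>] by (auto simp: M_def \<sigma>_def i_def)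
qed

text \<open>The constant \<open>21\<close> comes from \<open>2 * 10^6 \<le> 2^21\<close>.  The truncated subtraction is intended: the bound
  is trivial when the exponent would be negative.\<close>
lemma close_parameters:
  assumes ST: "S \<noteq> T" "S \<subseteq> {1..n}" "T \<subseteq> {1..n}"
    and x: "1/2 \<le> x" "x \<le> 2/3" and y: "1/2 \<le> y" "y \<le> 2/3"
    and cl: "\<bar>fsum x S - fsum x T\<bar> \<le> (1 / 2) ^ k" "\<bar>fsum y S - fsum y T\<bar> \<le> (1 / 2) ^ k"
  shows "\<bar>x - y\<bar> \<le> (1 / 2) ^ (k - first_diff S T - 21)"
proof (cases "first_diff S T + 21 \<le> k")
  case False
  then have "k - first_diff S T - 21 = 0" by simp
  then have "(1 / 2) ^ (k - first_diff S T - 21) = (1 :: real)" by (simp only: power_0)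
  with x y show ?thesis by simp
next
  case True
  obtain b M \<sigma> where b: "\<And>j. b j \<in> {- 1, 0, 1}" "b 0 = 1" "20 \<le> M" and "\<bar>\<sigma>\<bar> = (1 :: real)"
      and fac: "\<And>x. fsum x S - fsum x T = \<sigma> * x ^ first_diff S T * psum b M x"
    using fsum_diff_factor[OF ST] by metis
  define i where "i = first_diff S T"
  have small: "\<bar>psum b M z\<bar> \<le> 2 ^ i * (1 / 2) ^ k"
    if z: "1/2 \<le> z" "\<bar>fsum z S - fsum z T\<bar> \<le> (1 / 2) ^ k" for z
  proof -
    have "(1/2) ^ i * \<bar>psum b M z\<bar> \<le> z ^ i * \<bar>psum b M z\<bar>"
      using z by (intro mult_right_mono power_mono) auto
    also have "\<dots> \<le> (1/2) ^ k"
      using z fac[of z] \<open>\<bar>\<sigma>\<bar> = 1\<close> by (simp add: abs_mult i_def)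
    finally show ?thesis by (simp add: power_one_over field_simps)
  qed
  have "\<bar>x - y\<bar> \<le> 2 * 10^6 * (2 ^ i * (1 / 2) ^ k)"
    by (rule transversality[of b M, OF b x y small small]) (use x y cl in auto)
  also have "\<dots> \<le> 2 ^ 21 * (2 ^ i * (1 / 2) ^ k)" by (intro mult_right_mono) auto
  also have "\<dots> = (1 / 2) ^ (k - i - 21)"
  proof -
    define m where "m = k - i - 21"
    have "k = 21 + i + m" using True by (simp add: m_def i_def)
    then have "(1 / 2 :: real) ^ k = (1 / 2) ^ 21 * (1 / 2) ^ i * (1 / 2) ^ m" by (simp only: power_add)
    then have "2 ^ 21 * (2 ^ i * (1 / 2 :: real) ^ k) =
        (2 ^ 21 * (1 / 2) ^ 21) * (2 ^ i * (1 / 2) ^ i) * (1 / 2) ^ m" by (simp only: mult_ac)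
    also have "\<dots> = (1 / 2) ^ m" unfolding power_mult_distrib[symmetric] by simp
    finally show ?thesis unfolding m_def .
  qed
  finally show ?thesis by (simp add: i_def)
qed

lemma dyad_two_values:
  assumes diam: "\<And>x y. x \<in> Z \<Longrightarrow> y \<in> Z \<Longrightarrow> \<bar>x - y\<bar> \<le> (1 / 2) ^ q" and pos: "\<And>x. x \<in> Z \<Longrightarrow> 0 \<le> x"
  shows "\<exists>z. \<forall>x\<in>Z. dyad q x = z \<or> dyad q x = z + 1"
proof (cases "Z = {}")
  case False
  define A where "A = (\<lambda>x. nat (dyad q x)) ` Z"
  have "(LEAST a. a \<in> A) \<in> A" using False LeastI_ex[of "\<lambda>a. a \<in> A"] by (auto simp: A_def)
  then obtain x0 where x0: "x0 \<in> Z" "nat (dyad q x0) = (LEAST a. a \<in> A)" by (auto simp: A_def)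
  have nn: "0 \<le> dyad q x" if "x \<in> Z" for x using pos[OF that] by (simp add: dyad_def)
  have "dyad q x0 \<le> dyad q x" "dyad q x \<le> dyad q x0 + 1" if "x \<in> Z" for x
  proof -
    have "(LEAST a. a \<in> A) \<le> nat (dyad q x)" using that Least_le[of "\<lambda>a. a \<in> A"] by (auto simp: A_def)
    then show "dyad q x0 \<le> dyad q x" using x0 nn[OF x0(1)] nn[OF that] by simp
    have "x \<le> x0 + (1 / 2) ^ q" using diam[OF that x0(1)] by linarith
    then have "2 ^ q * x \<le> 2 ^ q * x0 + 1" by (simp add: field_simps power_one_over)
    then show "dyad q x \<le> dyad q x0 + 1" unfolding dyad_def by linarith
  qed
  then have "\<forall>x\<in>Z. dyad q x = dyad q x0 \<or> dyad q x = dyad q x0 + 1" by force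
  then show ?thesis by blast
qed auto

text \<open>Below i the set T agrees with S, so S and the part of T from i on determine the
  pair.\<close>

lemma card_first_diff:
  "card {(S, T). S \<subseteq> {1..n} \<and> T \<subseteq> {1..n} \<and> S \<noteq> T \<and> first_diff S T = i} \<le> 2 ^ n * 2 ^ (Suc n - i)"
proof -
  let ?A = "{(S, T). S \<subseteq> {1..n} \<and> T \<subseteq> {1..n} \<and> S \<noteq> T \<and> first_diff S T = i}"
  let ?f = "\<lambda>(S, T). (S, T \<inter> {i..})"
  have "inj_on ?f ?A"
  proof (rule inj_onI)
    fix p p' assume "p \<in> ?A" "p' \<in> ?A" "?f p = ?f p'"
    then obtain S T T' where p: "p = (S, T)" "p' = (S, T')" and
      *: "S \<noteq> T" "S \<noteq> T'" "first_diff S T = i" "first_diff S T' = i" "T \<inter> {i..} = T' \<inter> {i..}"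
      by auto
    have "j \<in> T \<longleftrightarrow> j \<in> T'" for j
    proof (cases "j < i")
      case True
      with * first_diff(2)[OF *(1), of j] first_diff(2)[OF *(2), of j] show ?thesis by simp
    next
      case False
      with *(5) show ?thesis by (metis IntD1 IntI atLeast_iff linorder_not_less)
    qed
    then show "p = p'" unfolding p by blast
  qed
  moreover have "?f ` ?A \<subseteq> Pow {1..n} \<times> Pow {i..n}" by auto
  ultimately have "card ?A \<le> card (Pow {1..n} \<times> Pow {i..n})"
    by (intro card_inj_on_le) auto
  also have "\<dots> = 2 ^ n * 2 ^ (Suc n - i)" by (simp add: card_cartesian_product card_Pow)
  finally show ?thesis .
qed

text \<open>Pairs with first difference i number at most 2 * 4^n * 2^-i, so the sum is dominated by
  a geometric series of ratio 2^(s-1). This is where s < 1 is used.\<close>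

lemma sum_first_diff_le:
  assumes s: "0 < s" "s < 1"
  shows "(\<Sum>(S, T)\<in>{(S, T). S \<subseteq> {1..n} \<and> T \<subseteq> {1..n} \<and> S \<noteq> T}. 2 powr (real (first_diff S T) * s))
     \<le> 4 ^ n * (2 / (1 - 2 powr (s - 1)))"
proof -
  let ?P = "{(S, T). S \<subseteq> {1..n} \<and> T \<subseteq> {1..n} \<and> S \<noteq> T}"
  have fin: "finite ?P" by (rule finite_subset[of _ "Pow {1..n} \<times> Pow {1..n}"]) auto
  define r :: real where "r = 2 powr (s - 1)"
  have r: "0 < r" "r < 1" using s by (auto simp: r_def powr_less_one)
  have "(\<Sum>(S, T)\<in>?P. 2 powr (real (first_diff S T) * s)) =
      (\<Sum>i\<in>{1..n}. \<Sum>(S, T)\<in>{p \<in> ?P. case_prod first_diff p = i}. 2 powr (real (first_diff S T) * s))"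
  proof (rule sum.group[symmetric, OF fin])
    show "case_prod first_diff ` ?P \<subseteq> {1..n}" using first_diff_in by (clarify, blast)
  qed simp
  also have "\<dots> = (\<Sum>i\<in>{1..n}. real (card {p \<in> ?P. case_prod first_diff p = i}) * 2 powr (real i * s))"
  proof (intro sum.cong refl)
    fix i
    have "(\<Sum>(S, T)\<in>{p \<in> ?P. case_prod first_diff p = i}. 2 powr (real (first_diff S T) * s)) =
        (\<Sum>p\<in>{p \<in> ?P. case_prod first_diff p = i}. 2 powr (real i * s))"
      by (intro sum.cong) auto
    then show "(\<Sum>(S, T)\<in>{p \<in> ?P. case_prod first_diff p = i}. 2 powr (real (first_diff S T) * s)) =
        real (card {p \<in> ?P. case_prod first_diff p = i}) * 2 powr (real i * s)" by simp
  qed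
  also have "\<dots> \<le> (\<Sum>i\<in>{1..n}. 4 ^ n * 2 * r ^ i)"
  proof (intro sum_mono)
    fix i assume i: "i \<in> {1..n}"
    have "{p \<in> ?P. case_prod first_diff p = i} =
        {(S, T). S \<subseteq> {1..n} \<and> T \<subseteq> {1..n} \<and> S \<noteq> T \<and> first_diff S T = i}" by auto
    then have "real (card {p \<in> ?P. case_prod first_diff p = i}) \<le> real (2 ^ n * 2 ^ (Suc n - i))"
      using card_first_diff[of n i] by (simp only: of_nat_le_iff)
    also have "\<dots> = 4 ^ n * 2 * (1 / 2) ^ i"
    proof -
      have "2 ^ (Suc n - i) * (2 ^ i :: real) = 2 * 2 ^ n" using i by (simp flip: power_add)
      moreover have "(4 :: real) ^ n = 2 ^ n * 2 ^ n" by (simp flip: power_mult_distrib)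
      ultimately show ?thesis by (simp add: power_one_over field_simps)
    qed
    finally have "real (card {p \<in> ?P. case_prod first_diff p = i}) * 2 powr (real i * s) \<le>
        4 ^ n * 2 * (1 / 2) ^ i * 2 powr (real i * s)" by (intro mult_right_mono) auto
    moreover have "(1 / 2) ^ i * 2 powr (real i * s) = r ^ i"
    proof -
      have "(1 / 2 :: real) ^ i = 2 powr (- real i)"
        using half_power_powr[of i 1] by simp
      then have "(1 / 2) ^ i * 2 powr (real i * s) = 2 powr ((s - 1) * real i)"
        by (simp add: algebra_simps flip: powr_add)
      also have "\<dots> = r ^ i" by (simp add: r_def powr_power mult.commute)
      finally show ?thesis .
    qed
    ultimately show "real (card {p \<in> ?P. case_prod first_diff p = i}) * 2 powr (real i * s) \<le> 4 ^ n * 2 * r ^ i"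
      by (simp only: mult.assoc)
  qed
  also have "\<dots> = 4 ^ n * (2 * (\<Sum>i\<in>{1..n}. r ^ i))" by (simp add: sum_distrib_left mult.assoc)
  also have "\<dots> \<le> 4 ^ n * (2 * (1 / (1 - r)))"
  proof (intro mult_left_mono)
    have "(\<Sum>i\<in>{1..n}. r ^ i) \<le> (\<Sum>i. r ^ i)"
      using r by (intro sum_le_suminf summable_geometric) auto
    then show "(\<Sum>i\<in>{1..n}. r ^ i) \<le> 1 / (1 - r)" using r by (simp add: suminf_geometric)
  qed auto
  finally show ?thesis by (simp add: r_def)
qed

lemma sum_UN_nonneg_le:
  fixes f :: "'a \<Rightarrow> real"
  assumes "finite I" "\<And>i. i \<in> I \<Longrightarrow> finite (A i)" "\<And>x. 0 \<le> f x"
  shows "sum f (\<Union>i\<in>I. A i) \<le> (\<Sum>i\<in>I. sum f (A i))"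
  using assms(1,2)
proof (induction I rule: finite_induct)
  case (insert i I)
  have "sum f (A i \<union> (\<Union>j\<in>I. A j)) + sum f (A i \<inter> (\<Union>j\<in>I. A j)) = sum f (A i) + sum f (\<Union>j\<in>I. A j)"
    using insert by (intro sum.union_inter) auto
  moreover have "0 \<le> sum f (A i \<inter> (\<Union>j\<in>I. A j))" by (intro sum_nonneg assms)
  ultimately show ?case using insert by simp
qed simp

definition bad_params :: "real \<Rightarrow> nat \<Rightarrow> nat \<Rightarrow> real set" where
  "bad_params t n k =
     {x. 1/2 \<le> x \<and> x \<le> 2/3 \<and> 4 ^ n * 2 powr (- (real k * t)) \<le> real (card (close_pairs x n k))}"

text \<open>The parameters at which a given pair is close lie in two adjacent dyadic intervals, by
  transversality. A bad parameter is hit by at least \<theta> pairs, so weights 1/\<theta> form a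
  fractional cover of the bad set.\<close>

lemma bad_params_cover:
  assumes s: "0 < s" "s < 1"
  obtains S where "finite S" "\<And>x. x \<in> bad_params t n k \<Longrightarrow> \<exists>(q, z)\<in>S. dyad q x = z"
    "(\<Sum>(q, z)\<in>S. 2 powr (- (real q * s))) \<le> 2 ^ 23 / (1 - 2 powr (s - 1)) * 2 powr (- (real k * (s - t)))"
proof -
  define Q where "Q = {(S, T). S \<subseteq> {1..n} \<and> T \<subseteq> {1..n} \<and> S \<noteq> T}"
  have finQ: "finite Q" unfolding Q_def by (rule finite_subset[of _ "Pow {1..n} \<times> Pow {1..n}"]) auto
  define lev where "lev = (\<lambda>(S, T). k - first_diff S T - 21)"
  define Z where "Z = (\<lambda>(S, T). {x. 1/2 \<le> x \<and> x \<le> 2/3 \<and> \<bar>fsum x S - fsum x T\<bar> \<le> (1 / 2) ^ k})"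
  have "\<exists>z. \<forall>x\<in>Z p. dyad (lev p) x = z \<or> dyad (lev p) x = z + 1" if "p \<in> Q" for p
  proof (rule dyad_two_values)
    obtain S T where p: "p = (S, T)" "S \<noteq> T" "S \<subseteq> {1..n}" "T \<subseteq> {1..n}"
      using \<open>p \<in> Q\<close> by (auto simp: Q_def)
    show "\<bar>x - y\<bar> \<le> (1 / 2) ^ lev p" if "x \<in> Z p" "y \<in> Z p" for x y
      using close_parameters[OF p(2-4), of x y k] that unfolding Z_def lev_def p(1) by simp
    show "0 \<le> x" if "x \<in> Z p" for x using that unfolding Z_def p(1) by simp
  qed
  then obtain z where z: "\<And>p x. p \<in> Q \<Longrightarrow> x \<in> Z p \<Longrightarrow> dyad (lev p) x = z p \<or> dyad (lev p) x = z p + 1"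
    by metis
  define \<theta> where "\<theta> = 4 ^ n * 2 powr (- (real k * t))"
  have "\<theta> > 0" by (simp add: \<theta>_def)
  define P where "P = Q \<times> {0, 1 :: int}"
  define pos where "pos = (\<lambda>(p, e). z p + e)"
  define w :: "(nat set \<times> nat set) \<times> int \<Rightarrow> real" where "w = (\<lambda>_. 1 / \<theta>)"
  have finP: "finite P" using finQ by (simp add: P_def)
  obtain S where S: "finite S"
    "\<And>x. 0 \<le> x \<Longrightarrow> x < 1 \<Longrightarrow> 1 \<le> sum w {p \<in> P. dyad (lev (fst p)) x = pos p} \<Longrightarrow> \<exists>(q, z)\<in>S. dyad q x = z"
    "(\<Sum>(q, z)\<in>S. 2 powr (- (real q * s))) \<le> (\<Sum>p\<in>P. w p * 2 powr (- (real (lev (fst p)) * s)))"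
    using weighted_cover[of P w "\<lambda>q. 2 powr (- (real q * s))" "\<lambda>p. lev (fst p)" pos] finP \<open>\<theta> > 0\<close>
    unfolding w_def by auto
  show thesis
  proof (rule that[OF S(1)])
    fix x assume x: "x \<in> bad_params t n k"
    then have x01: "1/2 \<le> x" "x \<le> 2/3" and big: "\<theta> \<le> real (card (close_pairs x n k))"
      by (auto simp: bad_params_def \<theta>_def)
    let ?H = "{p \<in> P. dyad (lev (fst p)) x = pos p}"
    have "card (close_pairs x n k) \<le> card ?H"
    proof (rule card_inj_on_le)
      show "inj_on (\<lambda>p. (p, dyad (lev p) x - z p)) (close_pairs x n k)" by (auto intro: inj_onI)
      show "(\<lambda>p. (p, dyad (lev p) x - z p)) ` close_pairs x n k \<subseteq> ?H"
      proof
        fix y assume "y \<in> (\<lambda>p. (p, dyad (lev p) x - z p)) ` close_pairs x n k"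
        then obtain p where p: "p \<in> close_pairs x n k" "y = (p, dyad (lev p) x - z p)" by blast
        have "p \<in> Q" "x \<in> Z p" using p x01 by (auto simp: close_pairs_def Q_def Z_def)
        from z[OF this] p \<open>p \<in> Q\<close> show "y \<in> ?H" by (auto simp: P_def pos_def)
      qed
      show "finite ?H" using finP by simp
    qed
    with big have "\<theta> \<le> real (card ?H)" by linarith
    with \<open>\<theta> > 0\<close> have "1 \<le> sum w ?H" by (simp add: w_def field_simps)
    with S(2) x01 show "\<exists>(q, z)\<in>S. dyad q x = z" by simp
  next
    have "(\<Sum>p\<in>P. w p * 2 powr (- (real (lev (fst p)) * s))) =
        (\<Sum>p\<in>Q. \<Sum>e\<in>{0, 1 :: int}. 1 / \<theta> * 2 powr (- (real (lev p) * s)))"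
      unfolding P_def sum.cartesian_product by (simp add: w_def case_prod_beta)
    also have "\<dots> = (\<Sum>p\<in>Q. 2 / \<theta> * 2 powr (- (real (lev p) * s)))" by simp
    \<comment> \<open>Truncated subtraction can only raise the level, so lev >= k - first_diff - 21
      as integers, and 21 s <= 21.\<close>
    also have "\<dots> \<le> (\<Sum>p\<in>Q. 2 / \<theta> * (2 ^ 21 * 2 powr (- (real k * s)) * 2 powr (real (case_prod first_diff p) * s)))"
    proof (intro sum_mono mult_left_mono)
      fix p assume "p \<in> Q"
      obtain U T where p: "p = (U, T)" by force
      have "real k \<le> real (lev p) + real (first_diff U T) + 21" by (simp add: lev_def p)
      then have "real k * s \<le> (real (lev p) + real (first_diff U T) + 21) * s"
        using s by (intro mult_right_mono) auto
      then have "- (real (lev p) * s) \<le> 21 * s + (- (real k * s) + real (first_diff U T) * s)"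
        by (simp add: algebra_simps)
      also have "\<dots> \<le> 21 + (- (real k * s) + real (first_diff U T) * s)" using s by simp
      finally have "2 powr (- (real (lev p) * s)) \<le> 2 powr (21 + (- (real k * s) + real (first_diff U T) * s))"
        by simp
      also have "\<dots> = 2 ^ 21 * 2 powr (- (real k * s)) * 2 powr (real (first_diff U T) * s)"
        unfolding powr_add by simp
      finally show "2 powr (- (real (lev p) * s)) \<le>
          2 ^ 21 * 2 powr (- (real k * s)) * 2 powr (real (case_prod first_diff p) * s)" by (simp add: p)
    qed (use \<open>\<theta> > 0\<close> in auto)
    also have "\<dots> = 2 ^ 22 / \<theta> * 2 powr (- (real k * s)) * (\<Sum>p\<in>Q. 2 powr (real (case_prod first_diff p) * s))"
      by (simp add: sum_distrib_left mult.assoc)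
    also have "\<dots> \<le> 2 ^ 22 / \<theta> * 2 powr (- (real k * s)) * (4 ^ n * (2 / (1 - 2 powr (s - 1))))"
      using sum_first_diff_le[OF s, of n] \<open>\<theta> > 0\<close>
      by (intro mult_left_mono) (auto simp: Q_def case_prod_beta)
    \<comment> \<open>The exponent 23 is 21 from transversality, one for the two intervals per pair,
      and one from \<open>sum_first_diff_le\<close>; 4^n cancels against \<theta>.\<close>
    also have "\<dots> = 2 ^ 23 / (1 - 2 powr (s - 1)) * (2 powr (- (real k * s)) * 2 powr (real k * t))"
    proof -
      have "2 ^ 22 / \<theta> * 4 ^ n = 2 ^ 22 * 2 powr (real k * t)"
        unfolding \<theta>_def by (simp add: powr_minus field_simps)
      moreover have "2 ^ 22 / \<theta> * 2 powr (- (real k * s)) * (4 ^ n * (2 / (1 - 2 powr (s - 1)))) =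
          (2 ^ 22 / \<theta> * 4 ^ n) * 2 powr (- (real k * s)) * (2 / (1 - 2 powr (s - 1)))"
        by (simp only: mult_ac)
      ultimately show ?thesis by simp
    qed
    also have "2 powr (- (real k * s)) * 2 powr (real k * t) = 2 powr (- (real k * (s - t)))"
      by (simp add: algebra_simps flip: powr_add)
    finally show "(\<Sum>(q, z)\<in>S. 2 powr (- (real q * s))) \<le>
        2 ^ 23 / (1 - 2 powr (s - 1)) * 2 powr (- (real k * (s - t)))" using S(3) by linarith
  qed
qed

text \<open>The range \<open>n \<le> 4 k\<close> keeps the union over \<open>n\<close> in the Borel--Cantelli argument finite for
  each \<open>k\<close>; coarser scales are recovered in \<open>few_close_pairs_all_scales\<close> by truncation.\<close>
definition few_close_pairs :: "real \<Rightarrow> real \<Rightarrow> bool" where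
  "few_close_pairs l t \<longleftrightarrow>
     (\<exists>n0. \<forall>n\<ge>n0. \<forall>k. n \<le> 4 * k \<longrightarrow> real (card (close_pairs l n k)) < 4 ^ n * 2 powr (- (real k * t)))"

text \<open>The cost of covering the bad set for n and k does not depend on n. The union over n <= 4
  k therefore costs at most (4 k + 1) C r^k with r = 2^(t-s) < 1, which is summable in k.\<close>

lemma hausdorff_measure_exceptional_params:
  assumes s: "0 < s" "s < 1" and "t < s"
  shows "hausdorff_measure s {l \<in> {1/2<..<2/3}. \<not> few_close_pairs l t} = 0"
proof -
  define C :: real where "C = 2 ^ 23 / (1 - 2 powr (s - 1))"
  have "\<exists>S. finite S \<and> (\<forall>x\<in>bad_params t n k. \<exists>(q, z)\<in>S. dyad q x = z) \<and>
      (\<Sum>(q, z)\<in>S. 2 powr (- (real q * s))) \<le> C * 2 powr (- (real k * (s - t)))" for n k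
    by (rule bad_params_cover[OF s, of t n k]) (auto simp: C_def)
  then obtain S where S: "\<And>n k. finite (S n k)"
    "\<And>n k x. x \<in> bad_params t n k \<Longrightarrow> \<exists>(q, z)\<in>S n k. dyad q x = z"
    "\<And>n k. (\<Sum>(q, z)\<in>S n k. 2 powr (- (real q * s))) \<le> C * 2 powr (- (real k * (s - t)))"
    by metis
  define r :: real where "r = 2 powr (- (s - t))"
  have r: "0 < r" "r < 1" using \<open>t < s\<close> by (auto simp: r_def powr_less_one)
  have rk: "2 powr (- (real k * (s - t))) = r ^ k" for k
  proof -
    have "- (real k * (s - t)) = real k * (- (s - t))" by (simp add: algebra_simps)
    then show ?thesis unfolding r_def by (simp add: powr_power del: minus_diff_eq mult_minus_right)
  qed
  have "C > 0" using s by (simp add: C_def powr_less_one)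
  have "hausdorff_measure s {x. \<forall>K. \<exists>k\<ge>K. x \<in> (\<Union>n\<le>4 * k. bad_params t n k)} = 0"
  proof (rule hausdorff_measure_limsup_null[where S = "\<lambda>k. \<Union>n\<le>4 * k. S n k" and a = "\<lambda>k. 4 * C * (real (Suc k) * r ^ k)"])
    show "summable (\<lambda>k. 4 * C * (real (Suc k) * r ^ k))"
      using geometric_deriv_sums[of r] r by (intro summable_mult) (auto simp: sums_iff)
    show "(\<Sum>(q, z)\<in>(\<Union>n\<le>4 * k. S n k). 2 powr (- (real q * s))) \<le> 4 * C * (real (Suc k) * r ^ k)" for k
    proof -
      have "(\<Sum>(q, z)\<in>(\<Union>n\<le>4 * k. S n k). 2 powr (- (real q * s))) \<le>
          (\<Sum>n\<le>4 * k. \<Sum>(q, z)\<in>S n k. 2 powr (- (real q * s)))"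
        by (rule sum_UN_nonneg_le) (auto simp: S)
      also have "\<dots> \<le> (\<Sum>n\<le>4 * k. C * r ^ k)" by (intro sum_mono S(3)[unfolded rk])
      also have "\<dots> = real (Suc (4 * k)) * (C * r ^ k)" by simp
      also have "\<dots> \<le> real (4 * Suc k) * (C * r ^ k)"
        using \<open>C > 0\<close> r by (intro mult_right_mono) auto
      finally show ?thesis by (simp add: algebra_simps)
    qed
    show "\<exists>(q, z)\<in>(\<Union>n\<le>4 * k. S n k). dyad q x = z" if "x \<in> (\<Union>n\<le>4 * k. bad_params t n k)" for k x
      using that S(2) by (meson UN_iff)
  qed (use s S in auto)
  moreover have "{l \<in> {1/2<..<2/3}. \<not> few_close_pairs l t} \<subseteq>
      {x. \<forall>K. \<exists>k\<ge>K. x \<in> (\<Union>n\<le>4 * k. bad_params t n k)}"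
  proof safe
    fix l :: real and K assume l: "l \<in> {1/2<..<2/3}" "\<not> few_close_pairs l t"
    \<comment> \<open>A failure at some n >= 4 K with n <= 4 k forces k >= K, so the failing k are
      unbounded.\<close>
    then obtain n k where "n \<ge> 4 * K" "n \<le> 4 * k" "4 ^ n * 2 powr (- (real k * t)) \<le> real (card (close_pairs l n k))"
      unfolding few_close_pairs_def by (meson not_less)
    with l show "\<exists>k\<ge>K. l \<in> (\<Union>n\<le>4 * k. bad_params t n k)"
      by (intro exI[of _ k]) (auto simp: bad_params_def)
  qed
  ultimately show ?thesis using hausdorff_measure_null_mono by blast
qed

section \<open>Close pairs at coarse scales\<close>

lemma fsum_mono_bounds:
  assumes "0 < l" "l < 1" "S \<subseteq> {m + 1..n}"
  shows "0 \<le> fsum l S" "fsum l S \<le> l ^ m * (l / (1 - l))"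
proof -
  show "0 \<le> fsum l S" using assms by (auto simp: fsum_def intro!: sum_nonneg)
  have "finite S" using assms(3) finite_subset by blast
  have "fsum l S = (\<Sum>i\<in>(\<lambda>i. i - (m + 1)) ` S. l ^ (m + 1) * l ^ i)"
    unfolding fsum_def
  proof (subst sum.reindex)
    have ge: "m + 1 \<le> i" if "i \<in> S" for i using assms(3) that by auto
    show "inj_on (\<lambda>i. i - (m + 1)) S" by (intro inj_onI) (use ge eq_diff_iff in metis)
    show "sum ((^) l) S = sum ((\<lambda>i. l ^ (m + 1) * l ^ i) \<circ> (\<lambda>i. i - (m + 1))) S"
      using assms(3) by (intro sum.cong) (auto simp flip: power_add power_Suc)
  qed
  also have "\<dots> = l ^ (m + 1) * (\<Sum>i\<in>(\<lambda>i. i - (m + 1)) ` S. l ^ i)" by (simp add: sum_distrib_left)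
  also have "\<dots> \<le> l ^ (m + 1) * (\<Sum>i. l ^ i)"
    using assms \<open>finite S\<close> by (intro mult_left_mono sum_le_suminf summable_geometric) auto
  also have "\<dots> = l ^ m * (l / (1 - l))" using assms by (simp add: suminf_geometric)
  finally show "fsum l S \<le> l ^ m * (l / (1 - l))" .
qed

lemma fsum_split:
  assumes "finite S"
  shows "fsum l S = fsum l (S \<inter> {1..m}) + fsum l (S - {1..m})"
  unfolding fsum_def using assms sum.Int_Diff by blast

text \<open>When n > 4 k, the sums are cut at m = 2 k. As l^2 < 1/2 and l/(1-l) <= 2, the tails are
  at most 2 * 2^-k, so the truncated sums are still within 4 * 2^-k. The known bound applies at m
  and k - 2, and the cut-off digits add the factor 4^(n-m).\<close>

lemma few_close_pairs_all_scales:
  assumes l: "1/2 < l" "l < 2/3" and t: "0 < t" "t \<le> 1" and few: "few_close_pairs l t"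
  obtains C n0 where "1 \<le> C"
    "\<And>n k. n0 \<le> n \<Longrightarrow> real (card (close_pairs l n k)) \<le> C * 4 ^ n * 2 powr (- (real k * t))"
proof -
  obtain n0 where n0: "\<And>n k. n0 \<le> n \<Longrightarrow> n \<le> 4 * k \<Longrightarrow>
      real (card (close_pairs l n k)) < 4 ^ n * 2 powr (- (real k * t))"
    using few unfolding few_close_pairs_def by blast
  \<comment> \<open>The power covers 2^(k t) for the finitely many k <= n0 + 5 and the factor 5 of
    the truncation case.\<close>
  define C :: real where "C = 2 ^ (n0 + 5)"
  have "1 \<le> C" by (simp add: C_def)
  moreover have "real (card (close_pairs l n k)) \<le> C * 4 ^ n * 2 powr (- (real k * t))" if n: "n0 \<le> n" for n k
  proof -
    consider "n \<le> 4 * k" | "k \<le> n0 + 5" | "4 * k < n" "n0 + 5 < k" by linarith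
    then show ?thesis
    proof cases
      case 1
      have "4 ^ n * 2 powr (- (real k * t)) \<le> C * (4 ^ n * 2 powr (- (real k * t)))"
        using mult_right_mono[OF \<open>1 \<le> C\<close>, of "4 ^ n * 2 powr (- (real k * t))"] by simp
      then show ?thesis using n0[OF n 1] unfolding mult.assoc by linarith
    next
      case 2
      have "real k * t \<le> real (n0 + 5) * 1" using 2 t by (intro mult_mono) auto
      then have "2 powr 0 \<le> 2 powr (real (n0 + 5) + - (real k * t))" by (intro powr_mono) auto
      also have "\<dots> = C * 2 powr (- (real k * t))" unfolding powr_add C_def by (subst powr_realpow) auto
      finally have "4 ^ n * 1 \<le> 4 ^ n * (C * 2 powr (- (real k * t)))" by (intro mult_left_mono) auto
      moreover have "real (card (close_pairs l n k)) \<le> 4 ^ n"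
        using card_close_pairs_le[of l n k] by (metis of_nat_le_iff of_nat_numeral of_nat_power)
      ultimately have "real (card (close_pairs l n k)) \<le> 4 ^ n * (C * 2 powr (- (real k * t)))" by linarith
      then show ?thesis by (simp add: mult.assoc mult.left_commute)
    next
      case 3
      define m where "m = 2 * k"
      \<comment> \<open>Different sets may have equal truncations, hence the diagonal. Its 2^m
        elements are at most 4^m 2^(-k t), because k t <= m.\<close>
      define D where "D = close_pairs l m (k - 2) \<union> (\<lambda>S. (S, S)) ` Pow {1..m}"
      let ?f = "\<lambda>(S, T). ((S \<inter> {1..m}, T \<inter> {1..m}), (S - {1..m}, T - {1..m}))"
      have "card (close_pairs l n k) \<le> card (D \<times> (Pow {m + 1..n} \<times> Pow {m + 1..n}))"
      proof (rule card_inj_on_le)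
        show "inj_on ?f (close_pairs l n k)" 
        proof (rule inj_onI)
          fix p p' :: "nat set \<times> nat set" assume "?f p = ?f p'"
          then have eq: "fst p \<inter> {1..m} = fst p' \<inter> {1..m}" "snd p \<inter> {1..m} = snd p' \<inter> {1..m}"
            "fst p - {1..m} = fst p' - {1..m}" "snd p - {1..m} = snd p' - {1..m}"
            by (simp_all only: case_prod_beta prod.inject)
          have "fst p = fst p'" by (subst (1 2) Int_Diff_Un[of _ "{1..m}", symmetric]) (simp only: eq)
          moreover have "snd p = snd p'" by (subst (1 2) Int_Diff_Un[of _ "{1..m}", symmetric]) (simp only: eq)
          ultimately show "p = p'" by (rule prod_eqI)
        qed
        show "?f ` close_pairs l n k \<subseteq> D \<times> (Pow {m + 1..n} \<times> Pow {m + 1..n})"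
        proof
          fix y assume "y \<in> ?f ` close_pairs l n k"
          then obtain p where "p \<in> close_pairs l n k" "y = ?f p" by (elim imageE)
          moreover obtain S T where "p = (S, T)" by (cases p)
          ultimately have ST: "(S, T) \<in> close_pairs l n k" "y = ?f (S, T)" by simp_all
          have sub: "S \<subseteq> {1..n}" "T \<subseteq> {1..n}" and cl: "\<bar>fsum l S - fsum l T\<bar> \<le> (1/2) ^ k"
            using ST by (auto simp: close_pairs_def)
          have fin: "finite S" "finite T" using sub finite_subset by blast+
          have bd: "0 \<le> fsum l (U - {1..m})" "fsum l (U - {1..m}) \<le> 2 * (1/2) ^ k" if "U \<subseteq> {1..n}" for U
          proof -
            have U: "U - {1..m} \<subseteq> {m + 1..n}" using that by auto
            show "0 \<le> fsum l (U - {1..m})" using fsum_mono_bounds(1)[OF _ _ U] l by simp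
            have "fsum l (U - {1..m}) \<le> l ^ m * (l / (1 - l))" using fsum_mono_bounds(2)[OF _ _ U] l by simp
            also have "\<dots> \<le> (1/2) ^ k * 2"
            proof (rule mult_mono)
              have "l ^ 2 \<le> (2/3) ^ 2" using l by (intro power_mono) auto
              then have "(l ^ 2) ^ k \<le> (1/2) ^ k" using l by (intro power_mono) (auto simp: power2_eq_square)
              then show "l ^ m \<le> (1/2) ^ k" by (simp add: m_def power_mult)
              show "l / (1 - l) \<le> 2" using l by (simp add: field_simps)
            qed (use l in auto)
            finally show "fsum l (U - {1..m}) \<le> 2 * (1/2) ^ k" by simp
          qed
          have "\<bar>fsum l (S \<inter> {1..m}) - fsum l (T \<inter> {1..m})\<bar> \<le> 3 * (1/2) ^ k"
            using cl bd[OF sub(1)] bd[OF sub(2)] fsum_split[OF fin(1), of l m] fsum_split[OF fin(2), of l m]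
            by linarith
          also have "\<dots> \<le> 4 * (1/2) ^ k" by simp
          also have "\<dots> = (1/2) ^ (k - 2)"
          proof -
            have "k = 2 + (k - 2)" using 3 by simp
            then have "(1/2 :: real) ^ k = (1/2)^2 * (1/2) ^ (k - 2)" by (metis power_add)
            then show ?thesis by (simp add: power2_eq_square)
          qed
          finally have "(S \<inter> {1..m}, T \<inter> {1..m}) \<in> D"
            by (auto simp: D_def close_pairs_def)
          with ST(2) sub show "y \<in> D \<times> (Pow {m + 1..n} \<times> Pow {m + 1..n})" by auto
        qed
      qed (simp add: D_def)
      also have "\<dots> = card D * 4 ^ (n - m)"
        by (simp add: card_cartesian_product card_Pow flip: power_mult_distrib)
      finally have "real (card (close_pairs l n k)) \<le> real (card D) * 4 ^ (n - m)"
        by (metis of_nat_le_iff of_nat_mult of_nat_numeral of_nat_power)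
      also have "\<dots> \<le> (5 * 4 ^ m * 2 powr (- (real k * t))) * 4 ^ (n - m)"
      proof (intro mult_right_mono)
        have "card D \<le> card (close_pairs l m (k - 2)) + 2 ^ m"
          unfolding D_def by (rule order_trans[OF card_Un_le]) (auto simp: card_image inj_on_def card_Pow)
        then have "real (card D) \<le> real (card (close_pairs l m (k - 2))) + 2 ^ m"
          by (metis of_nat_add of_nat_le_iff of_nat_numeral of_nat_power)
        also have "\<dots> \<le> 4 ^ m * 2 powr (- (real (k - 2) * t)) + 2 ^ m"
        proof -
          have "n0 \<le> m" "m \<le> 4 * (k - 2)" using 3 by (auto simp: m_def)
          then show ?thesis using n0[of m "k - 2"] by linarith
        qed
        also have "2 powr (- (real (k - 2) * t)) \<le> 4 * 2 powr (- (real k * t))"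
        proof -
          have "2 powr (- (real (k - 2) * t)) = 2 powr (2 * t + - (real k * t))"
            using 3 by (simp add: of_nat_diff algebra_simps)
          also have "\<dots> \<le> 2 powr (2 + - (real k * t))" using t by simp
          also have "\<dots> = 4 * 2 powr (- (real k * t))" unfolding powr_add by simp
          finally show ?thesis .
        qed
        also have "(2 :: real) ^ m \<le> 4 ^ m * 2 powr (- (real k * t))"
        proof -
          have "real k * t \<le> real k * 1" using t by (intro mult_left_mono) auto
          then have "0 \<le> real m + - (real k * t)" by (simp add: m_def)
          then have "1 \<le> 2 powr (real m + - (real k * t))" by (intro ge_one_powr_ge_zero) auto
          also have "\<dots> = 2 ^ m * 2 powr (- (real k * t))" unfolding powr_add by (simp add: powr_realpow)
          finally have "2 ^ m * 1 \<le> (2 :: real) ^ m * (2 ^ m * 2 powr (- (real k * t)))"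
            by (intro mult_left_mono) auto
          also have "\<dots> = 4 ^ m * 2 powr (- (real k * t))"
            by (simp add: mult.assoc[symmetric] flip: power_mult_distrib)
          finally show ?thesis by simp
        qed
        finally show "real (card D) \<le> 5 * 4 ^ m * 2 powr (- (real k * t))"
          by (simp add: mult_left_mono)
      qed auto
      also have "\<dots> = 5 * 4 ^ n * 2 powr (- (real k * t))"
      proof -
        have "m \<le> n" using 3 by (simp add: m_def)
        then have "(4 :: real) ^ m * 4 ^ (n - m) = 4 ^ n" by (simp flip: power_add)
        then show ?thesis by (simp add: algebra_simps)
      qed
      also have "\<dots> \<le> C * 4 ^ n * 2 powr (- (real k * t))"
      proof (intro mult_right_mono)
        have "(5 :: real) \<le> 2 ^ 5" by simp
        also have "\<dots> \<le> 2 ^ (n0 + 5)" by (intro power_increasing) auto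
        finally show "5 \<le> C" by (simp add: C_def)
      qed auto
      finally show ?thesis .
    qed
  qed
  ultimately show thesis by (rule that)
qed

section \<open>Frostman measures on small intervals\<close>

text \<open>\<open>m q z\<close> is the mass of \<open>[z / 2\<^sup>q, (z + 1) / 2\<^sup>q)\<close>.\<close>
definition flow :: "(nat \<Rightarrow> int \<Rightarrow> real) \<Rightarrow> bool" where
  "flow m \<longleftrightarrow> (\<forall>q z. 0 \<le> m q z \<and> m q z = m (Suc q) (2 * z) + m (Suc q) (2 * z + 1))"

text \<open>The order of quantifiers matters: \<open>C\<close> is fixed before the level
  \<open>L\<close>, so that a large \<open>L\<close> can absorb it. \<open>M\<close> bounds the
  density, depends on \<open>L\<close> but not on the interval \<open>y\<close>, and allows the next
  replacement. \<open>L'\<close> is the level at which the support already lies in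
  \<open>G\<close>.\<close>

definition locally_thick :: "real \<Rightarrow> real set \<Rightarrow> bool" where
  "locally_thick t G \<longleftrightarrow>
     (\<exists>C L0. \<forall>L\<ge>L0. \<exists>L'>L. \<exists>M. \<forall>y. \<exists>u. flow u \<and> (\<forall>z. u L z = (if z = y then 1 else 0)) \<and>
        (\<forall>q\<ge>L. \<forall>z. u q z \<le> C * 2 powr (- (real (q - L) * t))) \<and>
        (\<forall>q z. u q z \<le> M * (1 / 2) ^ q) \<and>
        (\<forall>z. 0 < u L' z \<longrightarrow> dyad_int L' z \<subseteq> G))"

text \<open>The normalised counting measure of the points \<open>p i\<close>, smeared uniformly over
  intervals of level \<open>N\<close>. The smearing is what gives it a bounded density.\<close>

definition point_flow :: "'p set \<Rightarrow> ('p \<Rightarrow> real) \<Rightarrow> nat \<Rightarrow> nat \<Rightarrow> int \<Rightarrow> real" where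
  "point_flow P p N q z =
     (if q \<le> N then real (card {i \<in> P. dyad q (p i) = z}) / real (card P)
      else real (card {i \<in> P. dyad N (p i) = z div 2 ^ (q - N)}) / real (card P) * (1 / 2) ^ (q - N))"

lemma flow_point_flow:
  assumes "finite P"
  shows "flow (point_flow P p N)"
  unfolding flow_def
proof (intro allI conjI)
  fix q z
  show "0 \<le> point_flow P p N q z" by (simp add: point_flow_def)
  show "point_flow P p N q z = point_flow P p N (Suc q) (2 * z) + point_flow P p N (Suc q) (2 * z + 1)"
  proof (cases "q < N")
    case True
    have "{i \<in> P. dyad q (p i) = z} = {i \<in> P. dyad (Suc q) (p i) = 2 * z} \<union> {i \<in> P. dyad (Suc q) (p i) = 2 * z + 1}"
    proof -
      have "dyad q x = z \<longleftrightarrow> dyad (Suc q) x = 2 * z \<or> dyad (Suc q) x = 2 * z + 1" for x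
        using dyad_Suc_div[of q x] by presburger
      then show ?thesis by blast
    qed
    moreover have "card ({i \<in> P. dyad (Suc q) (p i) = 2 * z} \<union> {i \<in> P. dyad (Suc q) (p i) = 2 * z + 1}) =
        card {i \<in> P. dyad (Suc q) (p i) = 2 * z} + card {i \<in> P. dyad (Suc q) (p i) = 2 * z + 1}"
      using assms by (intro card_Un_disjoint) auto
    ultimately show ?thesis using True by (simp add: point_flow_def add_divide_distrib)
  next
    case False
    then have N: "N \<le> q" by simp
    have "2 * z div 2 ^ (Suc q - N) = z div 2 ^ (q - N)" "(2 * z + 1) div 2 ^ (Suc q - N) = z div 2 ^ (q - N)"
      using N by (simp_all add: Suc_diff_le zdiv_zmult2_eq)
    moreover have "(1 / 2 :: real) ^ (q - N) = (1 / 2) ^ (Suc q - N) + (1 / 2) ^ (Suc q - N)"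
      using N by (simp add: Suc_diff_le)
    moreover have high: "point_flow P p N q' z' = real (card {i \<in> P. dyad N (p i) = z' div 2 ^ (q' - N)}) / real (card P) * (1 / 2) ^ (q' - N)"
      if "N \<le> q'" for q' z'
      using that by (cases "q' = N") (auto simp: point_flow_def)
    ultimately show ?thesis
      using N by (simp only: high[OF N] high[OF le_SucI[OF N]] distrib_left)
  qed
qed

text \<open>Only the levels from L to L' need a count: below L' the mass halves at each level, and
  1/2 <= 2^-t because t <= 1. The smeared points have density at most 2^L'.\<close>

lemma locally_thickI:
  assumes "0 \<le> C" "t \<le> 1"
    and "\<And>L. L0 \<le> L \<Longrightarrow> \<exists>L'>L. \<forall>y. \<exists>(P :: 'p set) p. finite P \<and> P \<noteq> {} \<and>
      (\<forall>i\<in>P. dyad L (p i) = y \<and> dyad_int L' (dyad L' (p i)) \<subseteq> G) \<and>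
      (\<forall>q z. L \<le> q \<longrightarrow> q \<le> L' \<longrightarrow>
         real (card {i \<in> P. dyad q (p i) = z}) \<le> C * 2 powr (- (real (q - L) * t)) * real (card P))"
  shows "locally_thick t G"
  unfolding locally_thick_def
proof (rule exI[of _ C], rule exI[of _ L0], intro allI impI)
  fix L assume "L0 \<le> L"
  from assms(3)[OF this] obtain N where N: "L < N" and ex: "\<forall>y. \<exists>(P :: 'p set) p. finite P \<and> P \<noteq> {} \<and>
      (\<forall>i\<in>P. dyad L (p i) = y \<and> dyad_int N (dyad N (p i)) \<subseteq> G) \<and>
      (\<forall>q z. L \<le> q \<longrightarrow> q \<le> N \<longrightarrow>
         real (card {i \<in> P. dyad q (p i) = z}) \<le> C * 2 powr (- (real (q - L) * t)) * real (card P))"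
    by blast
  have "\<exists>u. flow u \<and> (\<forall>z. u L z = (if z = y then 1 else 0)) \<and>
        (\<forall>q\<ge>L. \<forall>z. u q z \<le> C * 2 powr (- (real (q - L) * t))) \<and>
        (\<forall>q z. u q z \<le> 2 ^ N * (1 / 2) ^ q) \<and>
        (\<forall>z. 0 < u N z \<longrightarrow> dyad_int N z \<subseteq> G)" for y
  proof -
    obtain P :: "'p set" and p where P: "finite P" "P \<noteq> {}"
      and loc: "\<And>i. i \<in> P \<Longrightarrow> dyad L (p i) = y" "\<And>i. i \<in> P \<Longrightarrow> dyad_int N (dyad N (p i)) \<subseteq> G"
      and fr: "\<And>q z. L \<le> q \<Longrightarrow> q \<le> N \<Longrightarrow>
         real (card {i \<in> P. dyad q (p i) = z}) \<le> C * 2 powr (- (real (q - L) * t)) * real (card P)"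
      using ex[rule_format, of y] by blast
    define u where "u = point_flow P p N"
    have cP: "0 < real (card P)" using P by (simp add: card_gt_0_iff)
    have le1: "real (card {i \<in> P. Q i}) / real (card P) \<le> 1" for Q
      using P by (auto simp: divide_le_eq_1 card_mono)
    have low: "real (card {i \<in> P. dyad q (p i) = z}) / real (card P) \<le> C * 2 powr (- (real (q - L) * t))"
      if "L \<le> q" "q \<le> N" for q z
      using fr[OF that, of z] cP by (simp add: divide_le_eq)
    have "u q z \<le> C * 2 powr (- (real (q - L) * t))" if "L \<le> q" for q z
    proof (cases "q \<le> N")
      case True
      with low that show ?thesis by (simp add: u_def point_flow_def)
    next
      case False
      have "u q z \<le> C * 2 powr (- (real (N - L) * t)) * 2 powr (- (real (q - N) * t))"
      proof -
        have "real (q - N) * t \<le> real (q - N) * 1" using \<open>t \<le> 1\<close> by (intro mult_left_mono) auto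
        then have "(1 / 2) ^ (q - N) \<le> 2 powr (- (real (q - N) * t))"
          using half_power_powr[of "q - N" 1] by simp
        moreover have "u q z = real (card {i \<in> P. dyad N (p i) = z div 2 ^ (q - N)}) / real (card P) * (1 / 2) ^ (q - N)"
          using False by (simp only: u_def point_flow_def if_False)
        ultimately show ?thesis using low[of N "z div 2 ^ (q - N)"] N \<open>0 \<le> C\<close>
          by (simp only:, intro mult_mono) simp_all
      qed
      also have "\<dots> = C * 2 powr (- (real (q - L) * t))"
        using False N by (simp add: of_nat_diff algebra_simps flip: powr_add)
      finally show ?thesis .
    qed
    moreover have "u q z \<le> 2 ^ N * (1 / 2) ^ q" for q z
    proof (cases "q \<le> N")
      case True
      then have "(2 :: real) ^ q \<le> 2 ^ N" by (intro power_increasing) auto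
      then have "1 \<le> (2 :: real) ^ N * (1 / 2) ^ q" by (simp add: power_one_over field_simps)
      with le1[of "\<lambda>i. dyad q (p i) = z"] True show ?thesis by (simp add: u_def point_flow_def)
    next
      case False
      have "(1 / 2) ^ (q - N) = (2 :: real) ^ N * (1 / 2) ^ q"
        using False by (simp add: power_diff power_one_over field_simps)
      with False le1[of "\<lambda>i. dyad N (p i) = z div 2 ^ (q - N)"] show ?thesis
        using mult_right_mono[OF le1, of "(1 / 2) ^ (q - N)"] by (simp add: u_def point_flow_def)
    qed
    moreover have "u L z = (if z = y then 1 else 0)" for z
    proof -
      have "{i \<in> P. dyad L (p i) = z} = (if z = y then P else {})" using loc by auto
      then show ?thesis using N cP by (simp add: u_def point_flow_def)
    qed
    moreover have "dyad_int N z \<subseteq> G" if "0 < u N z" for z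
    proof -
      have "{i \<in> P. dyad N (p i) = z} \<noteq> {}"
      proof
        assume "{i \<in> P. dyad N (p i) = z} = {}"
        with that show False by (simp only: u_def point_flow_def card.empty) simp
      qed
      with loc show ?thesis by auto
    qed
    moreover have "flow u" unfolding u_def by (rule flow_point_flow[OF P(1)])
    ultimately show ?thesis by blast
  qed
  with N show "\<exists>L'>L. \<exists>M. \<forall>y. \<exists>u. flow u \<and> (\<forall>z. u L z = (if z = y then 1 else 0)) \<and>
        (\<forall>q\<ge>L. \<forall>z. u q z \<le> C * 2 powr (- (real (q - L) * t))) \<and>
        (\<forall>q z. u q z \<le> M * (1 / 2) ^ q) \<and>
        (\<forall>z. 0 < u L' z \<longrightarrow> dyad_int L' z \<subseteq> G)" by blast
qed

text \<open>Markov's inequality: the sets S with too many partners at scale k number at most 2^n (C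
  / C1) r^k with r = 2^(t2-t). Giving up t - t2 in the exponent makes this summable in k, and
  \<open>C1\<close> is chosen so that at most half of all sets are discarded, whatever
  \<open>N\<close> is.\<close>

lemma separated_subfamily:
  assumes C: "0 < C" and t: "t2 < t"
    and card: "\<And>k. real (card (close_pairs l n k)) \<le> C * 4 ^ n * 2 powr (- (real k * t))"
    and C1: "C1 = 2 * C / (1 - 2 powr (t2 - t))"
  obtains P where "P \<subseteq> Pow {1..n}" "2 ^ n \<le> 2 * real (card P)"
    "\<And>S k. S \<in> P \<Longrightarrow> k \<le> N \<Longrightarrow>
        real (card {T. (S, T) \<in> close_pairs l n k}) \<le> C1 * 2 ^ n * 2 powr (- (real k * t2))"
proof -
  define r :: real where "r = 2 powr (t2 - t)"
  have r: "0 < r" "r < 1" using t by (auto simp: r_def powr_less_one)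
  have "0 < C1" using C r by (simp add: C1 r_def)
  define B where "B k = {S \<in> Pow {1..n}. C1 * 2 ^ n * 2 powr (- (real k * t2)) < real (card {T. (S, T) \<in> close_pairs l n k})}" for k
  have finB: "finite (B k)" for k unfolding B_def by simp
  have fin: "finite {T. (S, T) \<in> close_pairs l n k}" for S k
    by (rule finite_subset[of _ "Pow {1..n}"]) (auto simp: close_pairs_def)
  have cB: "real (card (B k)) \<le> 2 ^ n * (C / C1) * r ^ k" for k
  proof -
    have "(\<Sum>S\<in>B k. card {T. (S, T) \<in> close_pairs l n k}) = card (SIGMA S:B k. {T. (S, T) \<in> close_pairs l n k})"
      using finB fin by (subst card_SigmaI) auto
    also have "\<dots> \<le> card (close_pairs l n k)" by (intro card_mono) auto
    finally have "(\<Sum>S\<in>B k. real (card {T. (S, T) \<in> close_pairs l n k})) \<le> real (card (close_pairs l n k))"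
      by (metis of_nat_le_iff of_nat_sum)
    moreover have "(\<Sum>S\<in>B k. C1 * 2 ^ n * 2 powr (- (real k * t2))) \<le> (\<Sum>S\<in>B k. real (card {T. (S, T) \<in> close_pairs l n k}))"
      by (intro sum_mono) (auto simp: B_def)
    ultimately have "real (card (B k)) * (C1 * 2 ^ n * 2 powr (- (real k * t2))) \<le> C * 4 ^ n * 2 powr (- (real k * t))"
      using card[of k] by simp
    also have "\<dots> = (2 ^ n * (C / C1) * r ^ k) * (C1 * 2 ^ n * 2 powr (- (real k * t2)))"
    proof -
      have "r ^ k * 2 powr (- (real k * t2)) = 2 powr (- (real k * t))"
        by (simp add: r_def powr_power algebra_simps flip: powr_add)
      moreover have "(4 :: real) ^ n = 2 ^ n * 2 ^ n" by (simp flip: power_mult_distrib)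
      ultimately have "C * 4 ^ n * 2 powr (- (real k * t)) = C * (2 ^ n * 2 ^ n) * (r ^ k * 2 powr (- (real k * t2)))"
        by simp
      moreover have "(2 ^ n * (C / C1) * r ^ k) * (C1 * 2 ^ n * 2 powr (- (real k * t2))) =
          (C / C1 * C1) * (2 ^ n * 2 ^ n) * (r ^ k * 2 powr (- (real k * t2)))"
        by (simp only: mult_ac)
      moreover have "C / C1 * C1 = C" using \<open>0 < C1\<close> by simp
      ultimately show ?thesis by (simp only:)
    qed
    finally show ?thesis by (rule mult_right_le_imp_le) (use \<open>0 < C1\<close> in simp)
  qed
  define P where "P = Pow {1..n} - (\<Union>k\<le>N. B k)"
  have "real (card (\<Union>k\<le>N. B k)) \<le> (\<Sum>k\<le>N. real (card (B k)))"
    using card_UN_le[of "{..N}" B] by (metis finite_atMost of_nat_le_iff of_nat_sum)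
  also have "\<dots> \<le> (\<Sum>k\<le>N. 2 ^ n * (C / C1) * r ^ k)" by (intro sum_mono cB)
  also have "\<dots> = 2 ^ n * (C / C1) * (\<Sum>k\<le>N. r ^ k)" by (simp add: sum_distrib_left)
  also have "\<dots> \<le> 2 ^ n * (C / C1) * (1 / (1 - r))"
  proof (intro mult_left_mono)
    have "(\<Sum>k\<le>N. r ^ k) \<le> (\<Sum>k. r ^ k)"
      using r by (intro sum_le_suminf summable_geometric) auto
    then show "(\<Sum>k\<le>N. r ^ k) \<le> 1 / (1 - r)" using r by (simp add: suminf_geometric)
  qed (use C \<open>0 < C1\<close> in auto)
  also have "\<dots> = 2 ^ n / 2" using C r by (simp add: C1 r_def[symmetric] field_simps)
  finally have bad: "real (card (\<Union>k\<le>N. B k)) \<le> 2 ^ n / 2" .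
  have "card (Pow {1..n}) \<le> card (P \<union> (\<Union>k\<le>N. B k))"
    unfolding P_def using finB by (intro card_mono) auto
  also have "\<dots> \<le> card P + card (\<Union>k\<le>N. B k)" by (rule card_Un_le)
  finally have "2 ^ n \<le> card P + card (\<Union>k\<le>N. B k)" by (simp add: card_Pow)
  then have "2 ^ n \<le> real (card P) + real (card (\<Union>k\<le>N. B k))"
    by (metis of_nat_add of_nat_le_iff of_nat_numeral of_nat_power)
  with bad have "2 ^ n \<le> 2 * real (card P)" by simp
  moreover have "P \<subseteq> Pow {1..n}" by (auto simp: P_def)
  moreover have "real (card {T. (S, T) \<in> close_pairs l n k}) \<le> C1 * 2 ^ n * 2 powr (- (real k * t2))"
    if "S \<in> P" "k \<le> N" for S k
    using that unfolding P_def B_def by fastforce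
  ultimately show thesis using that[of P] by blast
qed

section \<open>Thickness of the approximation sets\<close>

text \<open>The remainder is kept in [0, l^K d], where l^K d = l^(K+1) + l^(K+1) d. The digit K + 1
  is taken when the remainder exceeds l^(K+1) d, and it fits because l > 1/2 gives d >= 1.\<close>

lemma greedy_expansion:
  assumes l: "1/2 < l" "l < 1" and d: "d = l / (1 - l)" and u: "0 \<le> u" "u \<le> d"
  shows "\<exists>w. w \<subseteq> {1..K} \<and> fsum l w \<le> u \<and> u - fsum l w \<le> l ^ K * d"
proof (induction K)
  case 0
  then show ?case using u by (intro exI[of _ "{}"]) (auto simp: fsum_def)
next
  case (Suc K)
  then obtain w where w: "w \<subseteq> {1..K}" "fsum l w \<le> u" "u - fsum l w \<le> l ^ K * d" by blast
  have dd: "d = l + l * d" using d l by (simp add: field_simps)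
  have "1 \<le> d" using d l by (simp add: le_divide_eq)
  show ?case
  proof (cases "u - fsum l w \<le> l ^ Suc K * d")
    case True
    with w show ?thesis by (intro exI[of _ w]) auto
  next
    case False
    have "finite w" "Suc K \<notin> w" using w(1) finite_subset by auto
    then have "fsum l (insert (Suc K) w) = l ^ Suc K + fsum l w" by (simp add: fsum_def)
    moreover have "l ^ Suc K \<le> l ^ Suc K * d" using \<open>1 \<le> d\<close> l by simp
    moreover have "l ^ K * d = l ^ Suc K + l ^ Suc K * d" by (subst dd) (simp add: algebra_simps)
    ultimately show ?thesis using w False by (intro exI[of _ "insert (Suc K) w"]) auto
  qed
qed

lemma fsum_le_geometric:
  assumes "0 < l" "l < 1" "w \<subseteq> {1..K}"
  shows "fsum l w \<le> l / (1 - l) - l ^ K * (l / (1 - l))"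
proof -
  have "fsum l w \<le> fsum l {1..K}"
    unfolding fsum_def using assms by (intro sum_mono2) auto
  also have "\<dots> = l / (1 - l) - l ^ K * (l / (1 - l))"
  proof (induction K)
    case (Suc K)
    define g where "g = l / (1 - l)"
    have "g = l + l * g" using assms by (simp add: g_def field_simps)
    then have "l ^ K * g = l ^ Suc K + l ^ Suc K * g" by (metis distrib_left mult.assoc power_Suc2)
    moreover have "fsum l {1..Suc K} = fsum l {1..K} + l ^ Suc K" by (simp add: fsum_def)
    ultimately show ?case using Suc unfolding g_def by simp
  qed (simp add: fsum_def)
  finally show ?thesis .
qed

text \<open>The points whose preimage under \<open>x \<mapsto> c + \<rho> x\<close> lies, modulo \<open>diam(I\<^sub>l)\<close>, in the \<open>m\<close>-th set of
  the intersection that defines \<open>W\<^sub>l(\<alpha>)\<close>.\<close>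
definition approx_set :: "real \<Rightarrow> real \<Rightarrow> real \<Rightarrow> real \<Rightarrow> nat \<Rightarrow> real set" where
  "approx_set l \<alpha> c \<rho> m =
     {c + \<rho> * (real_of_int k * (l / (1 - l)) + v) | k v. v \<in> I_int l \<and>
        (\<exists>n\<ge>m. \<exists>S\<subseteq>{1..n}. \<bar>v - fsum l S\<bar> < 2 powr (- (real n * \<alpha>)))}"

lemma dyad_int_dist:
  assumes "x \<in> dyad_int q z" "y \<in> dyad_int q z"
  shows "\<bar>x - y\<bar> \<le> (1 / 2) ^ q"
proof -
  have "(z + 1) / 2 ^ q - z / 2 ^ q = (1 / 2 :: real) ^ q"
    by (simp add: power_divide flip: diff_divide_distrib)
  with assms show ?thesis unfolding dyad_int_def by auto
qed

lemma same_dyad_dist: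
  assumes "dyad q x = dyad q y"
  shows "\<bar>x - y\<bar> \<le> (1 / 2) ^ q"
  using dyad_int_dist[of x q "dyad q x" y] in_dyad_int[of x q] in_dyad_int[of y q] assms by simp

lemma fsum_shift: "fsum l ((+) K ` S) = l ^ K * fsum l S"
  by (simp add: fsum_def sum.reindex power_add sum_distrib_left)

text \<open>A greedy prefix of length K aims at the midpoint of the given dyadic interval; two fixed
  digits follow, and then a free block S from a separated family. The points are a copy of the
  \<open>fsum l S\<close> scaled by \<rho> l^(K+2), and |\<rho>| l^(K+2) >= 2^-(L+5), so counts of
  close pairs carry over with a constant independent of L and y.\<close>

lemma locally_thick_approx_set:
  assumes l: "1/2 < l" "l < 2/3" and \<alpha>: "1 \<le> \<alpha>" and t: "0 < t2" "t2 < t" "t \<le> 1" "\<alpha> * t2 < 1"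
    and few: "few_close_pairs l t" and "\<rho> \<noteq> 0"
  shows "locally_thick t2 (approx_set l \<alpha> c \<rho> m)"
proof -
  define d where "d = l / (1 - l)"
  have dd: "d = l + l * d" using l by (simp add: d_def field_simps)
  have d: "1 \<le> d" "d \<le> 2" using l by (auto simp: d_def field_simps)
  obtain C n0 where C: "1 \<le> C"
    and few': "\<And>n k. n0 \<le> n \<Longrightarrow> real (card (close_pairs l n k)) \<le> C * 4 ^ n * 2 powr (- (real k * t))"
    using few_close_pairs_all_scales[OF l less_trans[OF t(1,2)] t(3) few] by blast
  define C1 where "C1 = 2 * C / (1 - 2 powr (t2 - t))"
  have "0 < C1" using C t by (simp add: C1_def powr_less_one)
  \<comment> \<open>For L >= A the preimage of a dyadic interval has length \<eta> <= 1, which makes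
    K below positive; A also absorbs \<rho> in the choice of N.\<close>
  obtain A where A: "(1 / 2) ^ A < \<bar>\<rho>\<bar>"
    using real_arch_pow_inv[of "\<bar>\<rho>\<bar>" "1/2"] \<open>\<rho> \<noteq> 0\<close> by auto
  show ?thesis
  \<comment> \<open>The 64 is 2^5 for a shift by five levels times 2, since P contains at least half
    of all words. The summand 1 counts S besides its partners.\<close>
  proof (rule locally_thickI[where C = "64 * (1 + C1)" and ?L0.0 = A])
    fix L assume "A \<le> L"
    define \<eta> where "\<eta> = (1 / 2) ^ L / \<bar>\<rho>\<bar>"
    have "(1 / 2) ^ L \<le> (1 / 2 :: real) ^ A" using \<open>A \<le> L\<close> by (intro power_decreasing) auto
    with A have "(1 / 2) ^ L \<le> \<bar>\<rho>\<bar>" by linarith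
    then have \<eta>: "0 < \<eta>" "\<eta> \<le> 1" using \<open>\<rho> \<noteq> 0\<close> by (auto simp: \<eta>_def divide_le_eq)
    \<comment> \<open>All continuations of the prefix stay within half the preimage interval of its
      midpoint, while minimality of K keeps l^K >= \<eta>/8.\<close>
    define K where "K = (LEAST k. l ^ k * d < \<eta> / 2)"
    obtain k where "l ^ k < \<eta> / (2 * d)"
      using real_arch_pow_inv[of "\<eta> / (2 * d)" l] \<eta> d l by auto
    then have "l ^ k * d < \<eta> / 2" using d by (simp add: field_simps)
    then have K: "l ^ K * d < \<eta> / 2" unfolding K_def by (rule LeastI)
    have "K \<noteq> 0" using K \<eta> d by (cases K) auto
    then have "\<not> l ^ (K - 1) * d < \<eta> / 2" unfolding K_def by (intro not_less_Least) auto
    then have "l * (\<eta> / 2) \<le> l * (l ^ (K - 1) * d)" using l by (intro mult_left_mono) auto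
    also have "\<dots> = l ^ K * d" using \<open>K \<noteq> 0\<close> by (cases K) auto
    finally have "l * (\<eta> / 2) \<le> l ^ K * d" .
    moreover have "1/2 * (\<eta> / 2) \<le> l * (\<eta> / 2)" using l \<eta> by (intro mult_right_mono) auto
    ultimately have "\<eta> / 4 \<le> l ^ K * d" by simp
    moreover have "l ^ K * d \<le> l ^ K * 2" using d l by (intro mult_left_mono) auto
    ultimately have K_low: "\<eta> / 8 \<le> l ^ K" by simp
    have "1 / 4 \<le> l ^ 2" using power_mono[of "1/2" l 2] l by (simp add: power2_eq_square)
    then have "\<eta> / 8 * (1 / 4) \<le> l ^ K * l ^ 2" using K_low l by (intro mult_mono) auto
    then have "\<eta> / 32 \<le> l ^ (K + 2)" unfolding power_add by simp
    then have "\<bar>\<rho>\<bar> * (\<eta> / 32) \<le> \<bar>\<rho>\<bar> * l ^ (K + 2)" by (intro mult_left_mono) auto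
    then have scale: "(1 / 2) ^ (L + 5) \<le> \<bar>\<rho>\<bar> * l ^ (K + 2)"
      using \<open>\<rho> \<noteq> 0\<close> by (simp add: \<eta>_def power_add power_one_over)
    \<comment> \<open>n must satisfy N t2 <= n, with N about (K + 2 + n) \<alpha>. This is possible
      because \<alpha> t2 < 1; \<open>X\<close> collects the terms that do not grow with n.\<close>
    define X where "X = (real A + 2 + real (K + 2) * \<alpha>) * t2"
    define n where "n = max (max n0 m) (max L (nat \<lceil>X / (1 - \<alpha> * t2)\<rceil>))"
    have n: "n0 \<le> n" "m \<le> n" "L \<le> n" by (auto simp: n_def)
    have "X / (1 - \<alpha> * t2) \<le> real n" unfolding n_def by linarith
    then have X: "X \<le> real n * (1 - \<alpha> * t2)" using t by (simp add: divide_le_eq)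
    \<comment> \<open>2^-N is below |\<rho>| 2^(-(K+2+n) \<alpha>), so a whole dyadic interval of
      level N around a constructed point is approximated by the same sum of length K + 2 +
      n.\<close>
    define N where "N = A + nat \<lceil>real (K + 2 + n) * \<alpha>\<rceil> + 1"
    have "0 \<le> real (K + 2 + n) * \<alpha>" using \<alpha> by simp
    then have N: "real A + real (K + 2 + n) * \<alpha> + 1 \<le> real N" "real N \<le> real A + real (K + 2 + n) * \<alpha> + 2"
      unfolding N_def by linarith+
    have "real N * t2 \<le> (real A + real (K + 2 + n) * \<alpha> + 2) * t2" using N t by (intro mult_right_mono) auto
    also have "\<dots> = X + real n * (\<alpha> * t2)" by (simp add: X_def algebra_simps)
    also have "\<dots> \<le> real n" using X by (simp add: algebra_simps)
    finally have Nt: "real N * t2 \<le> real n" .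
    have Kn: "real (K + 2 + n) \<le> real (K + 2 + n) * \<alpha>" using \<alpha> mult_left_mono[of 1 \<alpha> "real (K + 2 + n)"] by simp
    with N n have "real L < real N" by linarith
    then have "L < N" by simp
    define \<epsilon> where "\<epsilon> = 2 powr (- (real (K + 2 + n) * \<alpha>))"
    have "- (real (K + 2 + n) * \<alpha>) \<le> - real (K + 2)" using Kn by linarith
    then have "\<epsilon> \<le> 2 powr (- real (K + 2))" unfolding \<epsilon>_def by (intro powr_mono) auto
    also have "\<dots> = (1 / 2) ^ (K + 2)" using half_power_powr[of "K + 2" 1] by simp
    also have "\<dots> \<le> l ^ (K + 2)" using l by (intro power_mono) auto
    finally have \<epsilon>_le: "\<epsilon> \<le> l ^ (K + 2)" .
    have N_eps: "(1 / 2) ^ N / \<bar>\<rho>\<bar> < \<epsilon>"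
    proof -
      have "(1 / 2) ^ N = (1 / 2 :: real) ^ A * 2 powr (- (real N - real A))"
        using half_power_powr[of N 1] half_power_powr[of A 1] by (simp flip: powr_add)
      also have "\<dots> < (1 / 2) ^ A * \<epsilon>"
        unfolding \<epsilon>_def using N by (intro mult_strict_left_mono) auto
      also have "\<dots> \<le> \<bar>\<rho>\<bar> * \<epsilon>" using A by (intro mult_right_mono) (auto simp: \<epsilon>_def)
      finally show ?thesis using \<open>\<rho> \<noteq> 0\<close> by (simp add: divide_less_eq mult.commute)
    qed
    obtain P where P: "P \<subseteq> Pow {1..n}" "2 ^ n \<le> 2 * real (card P)"
      and sep: "\<And>S k. S \<in> P \<Longrightarrow> k \<le> N \<Longrightarrow>
        real (card {T. (S, T) \<in> close_pairs l n k}) \<le> C1 * 2 ^ n * 2 powr (- (real k * t2))"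
      using separated_subfamily[of C t2 t l n C1 N] C t few'[OF n(1)] C1_def by auto
    have finP: "finite P" by (rule finite_subset[OF P(1)]) simp
    have "0 < real (card P)" using P(2) by (smt (verit) zero_less_power)
    then have "P \<noteq> {}" by auto
    have "\<exists>p. \<forall>i\<in>P. dyad L (p i) = y \<and> dyad_int N (dyad N (p i)) \<subseteq> approx_set l \<alpha> c \<rho> m \<and>
        (\<forall>T. p i - p T = \<rho> * l ^ (K + 2) * (fsum l i - fsum l T))" for y
    proof -
      define mid where "mid = (real_of_int y + 1 / 2) / 2 ^ L"
      define x0 where "x0 = (mid - c) / \<rho>"
      define k0 where "k0 = \<lfloor>x0 / d\<rfloor>"
      define u where "u = x0 - real_of_int k0 * d"
      have "real_of_int k0 \<le> x0 / d" "x0 / d \<le> real_of_int k0 + 1" unfolding k0_def by linarith+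
      then have u: "0 \<le> u" "u \<le> d" using d by (auto simp: u_def field_simps)
      obtain w where w: "w \<subseteq> {1..K}" "fsum l w \<le> u" "u - fsum l w \<le> l ^ K * d"
        using greedy_expansion[of l d u K] l u d_def by auto
      have w_le: "fsum l w + l ^ K * d \<le> d" using fsum_le_geometric[of l w K] w l by (simp add: d_def)
      have w_nn: "0 \<le> fsum l w" using l by (auto simp: fsum_def intro!: sum_nonneg)
      \<comment> \<open>Digit 1 at position K + 1 and digit 0 at K + 2 keep v S at least l^(K+2)
        away from both ends of I_l, so an error below \<epsilon> <= l^(K+2) does not leave
        it.\<close>
      define v where "v S = fsum l w + (l ^ (K + 1) + l ^ (K + 2) * fsum l S)" for S
      define p where "p S = c + \<rho> * (real_of_int k0 * d + v S)" for S
      have "dyad L (p S) = y \<and> dyad_int N (dyad N (p S)) \<subseteq> approx_set l \<alpha> c \<rho> m" if "S \<in> P" for S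
      proof
        have S: "S \<subseteq> {0 + 1..n}" using that P by auto
        have fS: "0 \<le> fsum l S" "fsum l S \<le> d" using fsum_mono_bounds[OF _ _ S, of l] l by (auto simp: d_def)
        have lK: "l ^ K * d = l ^ (K + 1) + l ^ (K + 2) + l ^ (K + 2) * d"
        proof -
          have "l ^ K * d = l ^ K * (l + l * (l + l * d))" using dd by simp
          then show ?thesis by (simp add: algebra_simps power_add power2_eq_square)
        qed
        have up: "l ^ (K + 2) * fsum l S \<le> l ^ (K + 2) * d" "0 \<le> l ^ (K + 2) * fsum l S"
          using fS l by (auto intro!: mult_left_mono)
        have pow: "0 < l ^ (K + 1)" "0 < l ^ (K + 2)" "l ^ (K + 2) \<le> l ^ (K + 1)" using l by auto
        have "\<bar>v S - u\<bar> \<le> l ^ K * d" using w up lK pow unfolding v_def by linarith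
        with K have "\<bar>v S - u\<bar> < \<eta> / 2" by linarith
        moreover have "p S - mid = \<rho> * (v S - u)"
          using \<open>\<rho> \<noteq> 0\<close> by (simp add: p_def u_def x0_def field_simps)
        ultimately have "\<bar>p S - mid\<bar> < \<bar>\<rho>\<bar> * (\<eta> / 2)" using \<open>\<rho> \<noteq> 0\<close> by (simp add: abs_mult)
        then have "\<bar>p S - mid\<bar> < (1 / 2) ^ L / 2" using \<open>\<rho> \<noteq> 0\<close> by (simp add: \<eta>_def)
        then have "2 ^ L * \<bar>p S - mid\<bar> < 1 / 2" by (simp add: power_one_over field_simps)
        moreover have "2 ^ L * p S - (real_of_int y + 1 / 2) = 2 ^ L * (p S - mid)"
          by (simp add: mid_def field_simps)
        ultimately have "\<bar>2 ^ L * p S - (real_of_int y + 1 / 2)\<bar> < 1 / 2"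
          by (simp add: abs_mult)
        then show "dyad L (p S) = y" unfolding dyad_def by linarith
        show "dyad_int N (dyad N (p S)) \<subseteq> approx_set l \<alpha> c \<rho> m"
        proof
          fix z assume "z \<in> dyad_int N (dyad N (p S))"
          then have z: "\<bar>z - p S\<bar> \<le> (1 / 2) ^ N" using dyad_int_dist in_dyad_int by blast
          define v' where "v' = (z - c) / \<rho> - real_of_int k0 * d"
          have "v' - v S = (z - p S) / \<rho>" using \<open>\<rho> \<noteq> 0\<close> by (simp add: v'_def p_def field_simps)
          then have "\<bar>v' - v S\<bar> \<le> (1 / 2) ^ N / \<bar>\<rho>\<bar>" using z by (simp add: abs_divide divide_right_mono)
          with N_eps have close: "\<bar>v' - v S\<bar> < \<epsilon>" by linarith
          have "0 \<le> v'" using close \<epsilon>_le w_nn up pow unfolding v_def by linarith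
          moreover have "v' \<le> d" using close \<epsilon>_le w_le up pow lK unfolding v_def by linarith
          ultimately have "v' \<in> I_int l" by (simp add: I_int_def d_def)
          moreover have "\<bar>v' - fsum l (w \<union> ({K + 1} \<union> (+) (K + 2) ` S))\<bar> < 2 powr (- (real (K + 2 + n) * \<alpha>))"
          proof -
            have fin: "finite w" "finite S" using w S finite_subset by blast+
            have "fsum l (w \<union> ({K + 1} \<union> (+) (K + 2) ` S)) = fsum l w + fsum l ({K + 1} \<union> (+) (K + 2) ` S)"
              unfolding fsum_def using fin w(1) by (intro sum.union_disjoint) auto
            also have "fsum l ({K + 1} \<union> (+) (K + 2) ` S) = fsum l {K + 1} + fsum l ((+) (K + 2) ` S)"
              unfolding fsum_def using fin by (intro sum.union_disjoint) auto
            also have "fsum l w + (fsum l {K + 1} + fsum l ((+) (K + 2) ` S)) = v S"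
              unfolding v_def fsum_shift by (simp add: fsum_def)
            finally show ?thesis using close by (simp only: \<epsilon>_def)
          qed
          moreover have "w \<union> ({K + 1} \<union> (+) (K + 2) ` S) \<subseteq> {1..K + 2 + n}" using w S by auto
          moreover have "m \<le> K + 2 + n" using n by simp
          moreover have "z = c + \<rho> * (real_of_int k0 * (l / (1 - l)) + v')"
            using \<open>\<rho> \<noteq> 0\<close> by (simp add: v'_def d_def)
          ultimately show "z \<in> approx_set l \<alpha> c \<rho> m" unfolding approx_set_def by blast
        qed
      qed
      moreover have "p S - p T = \<rho> * l ^ (K + 2) * (fsum l S - fsum l T)" for S T
        by (simp add: p_def v_def algebra_simps)
      ultimately show ?thesis by blast
    qed
    then obtain p where p: "\<And>y S. S \<in> P \<Longrightarrow> dyad L (p y S) = y \<and> dyad_int N (dyad N (p y S)) \<subseteq> approx_set l \<alpha> c \<rho> m"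
      "\<And>y S T. S \<in> P \<Longrightarrow> p y S - p y T = \<rho> * l ^ (K + 2) * (fsum l S - fsum l T)" by metis
    have frost: "real (card {S \<in> P. dyad q (p y S) = z}) \<le> 64 * (1 + C1) * 2 powr (- (real (q - L) * t2)) * real (card P)"
      if q: "L \<le> q" "q \<le> N" for q y z
    proof (cases "q < L + 5")
      case True
      have "real (q - L) * t2 \<le> 5 * 1" using True t by (intro mult_mono) auto
      then have "2 powr (- 5) \<le> 2 powr (- (real (q - L) * t2))" by (intro powr_mono) auto
      moreover have "2 powr (- 5 :: real) = 1 / 32" using powr_realpow[of "2 :: real" 5] by (simp add: powr_minus_divide)
      ultimately have "64 * 1 * (1 / 32) \<le> 64 * (1 + C1) * 2 powr (- (real (q - L) * t2))"
        using \<open>0 < C1\<close> by (intro mult_mono) auto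
      then have "1 * real (card P) \<le> 64 * (1 + C1) * 2 powr (- (real (q - L) * t2)) * real (card P)"
        by (intro mult_right_mono) auto
      moreover have "card {S \<in> P. dyad q (p y S) = z} \<le> card P" using finP by (intro card_mono) auto
      ultimately show ?thesis by linarith
    next
      case False
      \<comment> \<open>By \<open>scale\<close>, two points in a common interval of level q come
        from sums at most 2^-k apart.\<close>
      define k where "k = q - L - 5"
      have k: "q = L + 5 + k" "k \<le> N" using False q by (auto simp: k_def)
      show ?thesis
      proof (cases "{S \<in> P. dyad q (p y S) = z} = {}")
        case True
        show ?thesis unfolding True using \<open>0 < C1\<close> by simp
      next
        case False
        then obtain S where S: "S \<in> P" "dyad q (p y S) = z" by blast
        have "{T \<in> P. dyad q (p y T) = z} \<subseteq> insert S {T. (S, T) \<in> close_pairs l n k}"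
        proof
          fix T assume T: "T \<in> {T \<in> P. dyad q (p y T) = z}"
          have "\<bar>p y S - p y T\<bar> \<le> (1 / 2) ^ q" using S T by (intro same_dyad_dist) auto
          then have "\<bar>\<rho>\<bar> * l ^ (K + 2) * \<bar>fsum l S - fsum l T\<bar> \<le> (1 / 2) ^ (L + 5) * (1 / 2) ^ k"
            using p(2)[OF S(1), of y T] l unfolding k power_add[symmetric] by (simp add: abs_mult)
          moreover have "(1 / 2) ^ (L + 5) * \<bar>fsum l S - fsum l T\<bar> \<le> \<bar>\<rho>\<bar> * l ^ (K + 2) * \<bar>fsum l S - fsum l T\<bar>"
            by (intro mult_right_mono scale) auto
          ultimately have "(1 / 2) ^ (L + 5) * \<bar>fsum l S - fsum l T\<bar> \<le> (1 / 2) ^ (L + 5) * (1 / 2) ^ k" by linarith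
          then have "\<bar>fsum l S - fsum l T\<bar> \<le> (1 / 2) ^ k" by (rule mult_left_le_imp_le) simp
          then show "T \<in> insert S {T. (S, T) \<in> close_pairs l n k}"
            using S T P(1) by (auto simp: close_pairs_def)
        qed
        moreover have fin: "finite {T. (S, T) \<in> close_pairs l n k}"
          by (rule finite_subset[of _ "Pow {1..n}"]) (auto simp: close_pairs_def)
        ultimately have "card {T \<in> P. dyad q (p y T) = z} \<le> card (insert S {T. (S, T) \<in> close_pairs l n k})"
          by (intro card_mono) auto
        also have "\<dots> \<le> Suc (card {T. (S, T) \<in> close_pairs l n k})" by (rule card_insert_le_m1[THEN order_trans]) auto
        finally have "real (card {T \<in> P. dyad q (p y T) = z}) \<le> 1 + real (card {T. (S, T) \<in> close_pairs l n k})" by linarith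
        \<comment> \<open>The 1 for S itself is absorbed since k t2 <= N t2 <= n; this is the use of
          \<alpha> t2 < 1.\<close>
        also have "\<dots> \<le> 2 ^ n * 2 powr (- (real k * t2)) + C1 * 2 ^ n * 2 powr (- (real k * t2))"
        proof (intro add_mono sep S k)
          have "real k * t2 \<le> real N * t2" using k t by (intro mult_right_mono) auto
          then have "0 \<le> real n + - (real k * t2)" using Nt by linarith
          then have "1 \<le> 2 powr (real n + - (real k * t2))" by (intro ge_one_powr_ge_zero) auto
          then show "1 \<le> 2 ^ n * 2 powr (- (real k * t2))" unfolding powr_add by (simp add: powr_realpow)
        qed
        also have "\<dots> = (1 + C1) * 2 powr (- (real k * t2)) * 2 ^ n" by (simp add: algebra_simps)
        also have "\<dots> \<le> (1 + C1) * (32 * 2 powr (- (real (q - L) * t2))) * (2 * real (card P))"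
        proof (intro mult_mono P order.refl)
          have "- (real k * t2) \<le> 5 + - (real (q - L) * t2)" using t by (simp add: k algebra_simps)
          then have "2 powr (- (real k * t2)) \<le> 2 powr (5 + - (real (q - L) * t2))" by (intro powr_mono) auto
          also have "\<dots> = 32 * 2 powr (- (real (q - L) * t2))"
            unfolding powr_add using powr_realpow[of "2 :: real" 5] by simp
          finally show "2 powr (- (real k * t2)) \<le> 32 * 2 powr (- (real (q - L) * t2))" .
        qed (use \<open>0 < C1\<close> in auto)
        finally show ?thesis by (simp add: algebra_simps)
      qed
    qed
    show "\<exists>L'>L. \<forall>y. \<exists>(P :: nat set set) p. finite P \<and> P \<noteq> {} \<and>
      (\<forall>i\<in>P. dyad L (p i) = y \<and> dyad_int L' (dyad L' (p i)) \<subseteq> approx_set l \<alpha> c \<rho> m) \<and>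
      (\<forall>q z. L \<le> q \<longrightarrow> q \<le> L' \<longrightarrow>
         real (card {i \<in> P. dyad q (p i) = z}) \<le> 64 * (1 + C1) * 2 powr (- (real (q - L) * t2)) * real (card P))"
    proof (rule exI[of _ N], intro conjI allI)
      fix y
      show "\<exists>(P :: nat set set) p. finite P \<and> P \<noteq> {} \<and>
      (\<forall>i\<in>P. dyad L (p i) = y \<and> dyad_int N (dyad N (p i)) \<subseteq> approx_set l \<alpha> c \<rho> m) \<and>
      (\<forall>q z. L \<le> q \<longrightarrow> q \<le> N \<longrightarrow>
         real (card {i \<in> P. dyad q (p i) = z}) \<le> 64 * (1 + C1) * 2 powr (- (real (q - L) * t2)) * real (card P))"
        by (rule exI[of _ P], rule exI[of _ "p y"]) (use finP \<open>P \<noteq> {}\<close> p(1) frost in blast)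
    qed (rule \<open>L < N\<close>)
  qed (use \<open>0 < C1\<close> t in auto)
qed

section \<open>Combining measures on the dyadic tree\<close>

lemma flow_nonneg: "flow m \<Longrightarrow> 0 \<le> m q z"
  unfolding flow_def by blast

lemma flow_split: "flow m \<Longrightarrow> m q z = m (Suc q) (2 * z) + m (Suc q) (2 * z + 1)"
  unfolding flow_def by blast

lemma flow_child_le: "flow m \<Longrightarrow> m (Suc q) z \<le> m q (z div 2)"
proof -
  assume m: "flow m"
  have "z = 2 * (z div 2) \<or> z = 2 * (z div 2) + 1" by presburger
  moreover have "m q (z div 2) = m (Suc q) (2 * (z div 2)) + m (Suc q) (2 * (z div 2) + 1)"
    by (rule flow_split[OF m])
  moreover have "0 \<le> m (Suc q) (2 * (z div 2))" "0 \<le> m (Suc q) (2 * (z div 2) + 1)"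
    using m flow_nonneg by blast+
  ultimately show ?thesis by (metis add_increasing add_increasing2 order.refl)
qed

lemma flow_ancestor_le:
  assumes "flow m"
  shows "m (r + k) z \<le> m r (z div 2 ^ k)"
proof (induction k arbitrary: z)
  case (Suc k)
  have "m (r + Suc k) z \<le> m (r + k) (z div 2)" using flow_child_le[OF assms] by simp
  also have "\<dots> \<le> m r (z div 2 div 2 ^ k)" by (rule Suc)
  also have "z div 2 div 2 ^ k = z div 2 ^ Suc k" by (simp add: zdiv_zmult2_eq)
  finally show ?case .
qed simp

lemma flow_descendants:
  assumes "flow m"
  shows "m r y = (\<Sum>z\<in>{y * 2 ^ k..<(y + 1) * 2 ^ k}. m (r + k) z)"
proof (induction k)
  case 0
  have "{y..<y + 1} = {y}" by auto
  then show ?case by simp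
next
  case (Suc k)
  let ?I = "{y * 2 ^ k..<(y + 1) * 2 ^ k}"
  have split: "{y * 2 ^ Suc k..<(y + 1) * 2 ^ Suc k} = (\<lambda>z. 2 * z) ` ?I \<union> (\<lambda>z. 2 * z + 1) ` ?I"
  proof (intro set_eqI)
    fix x :: int
    have "x \<in> (\<lambda>z. 2 * z) ` ?I \<union> (\<lambda>z. 2 * z + 1) ` ?I \<longleftrightarrow> x div 2 \<in> ?I"
    proof
      assume "x div 2 \<in> ?I"
      moreover have "x = 2 * (x div 2) \<or> x = 2 * (x div 2) + 1" by presburger
      ultimately show "x \<in> (\<lambda>z. 2 * z) ` ?I \<union> (\<lambda>z. 2 * z + 1) ` ?I" by blast
    qed auto
    also have "\<dots> \<longleftrightarrow> x \<in> {y * 2 ^ Suc k..<(y + 1) * 2 ^ Suc k}"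
      by simp linarith
    finally show "x \<in> {y * 2 ^ Suc k..<(y + 1) * 2 ^ Suc k} \<longleftrightarrow>
      x \<in> (\<lambda>z. 2 * z) ` ?I \<union> (\<lambda>z. 2 * z + 1) ` ?I" by simp
  qed
  have disj: "(\<lambda>z. 2 * z) ` ?I \<inter> (\<lambda>z. 2 * z + 1) ` ?I = {}" by (auto, presburger)
  have "(\<Sum>z\<in>{y * 2 ^ Suc k..<(y + 1) * 2 ^ Suc k}. m (r + Suc k) z) =
      (\<Sum>z\<in>(\<lambda>z. 2 * z) ` ?I. m (r + Suc k) z) + (\<Sum>z\<in>(\<lambda>z. 2 * z + 1) ` ?I. m (r + Suc k) z)"
    unfolding split by (rule sum.union_disjoint) (use disj in auto)
  also have "\<dots> = (\<Sum>z\<in>?I. m (r + Suc k) (2 * z) + m (r + Suc k) (2 * z + 1))"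
    by (simp add: sum.reindex inj_on_def sum.distrib)
  also have "\<dots> = (\<Sum>z\<in>?I. m (r + k) z)"
    unfolding add_Suc_right by (intro sum.cong refl flow_split[symmetric] assms)
  also have "\<dots> = m r y" by (rule Suc.IH[symmetric])
  finally show ?case by (rule sym)
qed

lemma div_power2_bounds:
  fixes z :: int
  shows "z div 2 ^ k * 2 ^ k \<le> z" "z < (z div 2 ^ k + 1) * 2 ^ k"
proof -
  have "z div 2 ^ k * 2 ^ k + z mod 2 ^ k = z" by (rule div_mult_mod_eq)
  moreover have "0 \<le> z mod 2 ^ k" by (rule pos_mod_sign) simp
  moreover have "z mod 2 ^ k < 2 ^ k" by (rule pos_mod_bound) simp
  moreover have "(z div 2 ^ k + 1) * 2 ^ k = z div 2 ^ k * 2 ^ k + 2 ^ k"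
    by (simp only: distrib_right mult_1)
  ultimately show "z div 2 ^ k * 2 ^ k \<le> z" "z < (z div 2 ^ k + 1) * 2 ^ k" by linarith+
qed

lemma dyad_int_subset: "dyad_int (r + k) z \<subseteq> dyad_int r (z div 2 ^ k)"
proof
  fix x assume x: "x \<in> dyad_int (r + k) z"
  define y where "y = z div 2 ^ k"
  have "y * 2 ^ k \<le> z" "z + 1 \<le> (y + 1) * 2 ^ k"
    using div_power2_bounds[where z = z and k = k] unfolding y_def by linarith+
  then have "real_of_int (y * 2 ^ k) \<le> real_of_int z" "real_of_int (z + 1) \<le> real_of_int ((y + 1) * 2 ^ k)"
    by (simp_all only: of_int_le_iff)
  then have "real_of_int y * 2 ^ k \<le> 2 ^ (r + k) * x" "2 ^ (r + k) * x \<le> (real_of_int y + 1) * 2 ^ k"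
    using x by (auto simp: dyad_int_def field_simps)
  then have "(real_of_int y) * 2 ^ k \<le> (2 ^ r * x) * 2 ^ k" "(2 ^ r * x) * 2 ^ k \<le> (real_of_int y + 1) * 2 ^ k"
    by (simp_all add: power_add mult_ac)
  then have "real_of_int y \<le> 2 ^ r * x" "2 ^ r * x \<le> real_of_int y + 1" by auto
  then show "x \<in> dyad_int r (z div 2 ^ k)" unfolding y_def[symmetric] by (simp add: dyad_int_def field_simps)
qed

text \<open>The Frostman constant is exactly 1 and must survive every refinement. The density bound
  may grow from step to step, so it is only asserted to exist.\<close>

definition tame_flow :: "real \<Rightarrow> (nat \<Rightarrow> int \<Rightarrow> real) \<Rightarrow> bool" where
  "tame_flow t m \<longleftrightarrow> flow m \<and> m 0 0 = 1 \<and> (\<forall>z. z \<noteq> 0 \<longrightarrow> m 0 z = 0) \<and>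
     (\<forall>q z. m q z \<le> 2 powr (- (real q * t))) \<and> (\<exists>M. \<forall>q z. m q z \<le> M * (1 / 2) ^ q)"

definition flow_support :: "(nat \<Rightarrow> int \<Rightarrow> real) \<Rightarrow> nat \<Rightarrow> real set" where
  "flow_support m N = (\<Union>z\<in>{z. 0 < m N z}. dyad_int N z)"

lemma uniform_flow_tame:
  assumes "0 < t" "t \<le> 1"
  shows "tame_flow t (\<lambda>q z. if z div 2 ^ q = 0 then (1 / 2) ^ q else 0)"
  unfolding tame_flow_def flow_def
proof (intro conjI allI exI)
  fix q :: nat and z :: int
  have "2 * z div 2 ^ Suc q = z div 2 ^ q" "(2 * z + 1) div 2 ^ Suc q = z div 2 ^ q"
    by (simp_all add: zdiv_zmult2_eq)
  then show "(if z div 2 ^ q = 0 then (1 / 2) ^ q else 0) =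
    (if 2 * z div 2 ^ Suc q = 0 then (1 / 2) ^ Suc q else 0) +
    (if (2 * z + 1) div 2 ^ Suc q = 0 then (1 / 2) ^ Suc q else (0 :: real))" by simp
  have "real q * t \<le> real q * 1" using assms by (intro mult_left_mono) auto
  then have "(1 / 2) ^ q \<le> 2 powr (- (real q * t))" using half_power_powr[of q 1] by simp
  then show "(if z div 2 ^ q = 0 then (1 / 2) ^ q else 0) \<le> 2 powr (- (real q * t))" by simp
  show "(if z div 2 ^ q = 0 then (1 / 2) ^ q else 0) \<le> (1 :: real) * (1 / 2) ^ q" by simp
qed auto

text \<open>Below level L the mass of an interval is at most M 2^-L * C 2^(-(q-L) t) = (M C
  2^(L(t-1))) 2^(-q t), and the bracket is at most 1 for L large. The masses up to level L are
  unchanged, so earlier supports still contain the new one.\<close>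

lemma refine_flow:
  assumes m: "tame_flow t m" and t: "0 < t" "t < 1" and G: "locally_thick t G"
  obtains m' N' where "tame_flow t m'" "N < N'" "\<And>q z. q \<le> N \<Longrightarrow> m' q z = m q z" "flow_support m' N' \<subseteq> G"
proof -
  have fl: "flow m" using m by (simp add: tame_flow_def)
  obtain M where M: "\<And>q z. m q z \<le> M * (1 / 2) ^ q" using m unfolding tame_flow_def by blast
  have "0 \<le> M" using M[of 0 0] flow_nonneg[OF fl, of 0 0] by simp
  define Q where "Q C L L' M y u \<longleftrightarrow> flow u \<and> (\<forall>z. u L z = (if z = y then 1 else 0)) \<and>
        (\<forall>q\<ge>L. \<forall>z. u q z \<le> C * 2 powr (- (real (q - L) * t))) \<and>
        (\<forall>q z. u q z \<le> M * (1 / 2) ^ q) \<and>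
        (\<forall>z. 0 < u L' z \<longrightarrow> dyad_int L' z \<subseteq> G)" for C L L' M y u
  from G[unfolded locally_thick_def, folded Q_def] obtain C L0
    where thick: "\<And>L. L0 \<le> L \<Longrightarrow> \<exists>L'>L. \<exists>M. \<forall>y. \<exists>u. Q C L L' M y u" by blast
  have r: "0 < (2 powr (t - 1) :: real)" "(2 powr (t - 1) :: real) < 1" using t by (auto simp: powr_less_one)
  obtain L1 where L1: "(2 powr (t - 1)) ^ L1 < 1 / (M * \<bar>C\<bar> + 1)"
    using real_arch_pow_inv[of "1 / (M * \<bar>C\<bar> + 1)" "2 powr (t - 1)"] r \<open>0 \<le> M\<close> by (auto simp: add_nonneg_pos)
  define L where "L = max N (max L0 L1)"
  have L: "N \<le> L" "L0 \<le> L" "L1 \<le> L" by (auto simp: L_def)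
  have small: "M * \<bar>C\<bar> * 2 powr (real L * (t - 1)) \<le> 1"
  proof -
    have "2 powr (real L * (t - 1)) = (2 powr (t - 1)) ^ L" by (simp add: powr_power mult.commute)
    also have "\<dots> \<le> (2 powr (t - 1)) ^ L1" using r L by (intro power_decreasing) auto
    also have "\<dots> \<le> 1 / (M * \<bar>C\<bar> + 1)" using L1 by simp
    finally have "M * \<bar>C\<bar> * 2 powr (real L * (t - 1)) \<le> M * \<bar>C\<bar> * (1 / (M * \<bar>C\<bar> + 1))"
      using \<open>0 \<le> M\<close> by (intro mult_left_mono) auto
    also have "\<dots> \<le> 1" using \<open>0 \<le> M\<close> by (simp add: divide_le_eq add_nonneg_pos)
    finally show ?thesis .
  qed
  obtain L' M1 where "L < L'" and ex: "\<forall>y. \<exists>u. Q C L L' M1 y u"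
    using thick[OF L(2)] by blast
  from choice[OF ex] obtain u where "\<forall>y. Q C L L' M1 y (u y)" by (rule exE)
  then have Q: "Q C L L' M1 y (u y)" for y by (rule spec)
  have u: "\<And>y. flow (u y)" "\<And>y z. u y L z = (if z = y then 1 else 0)"
    "\<And>y q z. L \<le> q \<Longrightarrow> u y q z \<le> C * 2 powr (- (real (q - L) * t))"
    "\<And>y q z. u y q z \<le> M1 * (1 / 2) ^ q"
    "\<And>y z. 0 < u y L' z \<Longrightarrow> dyad_int L' z \<subseteq> G"
    using Q unfolding Q_def by simp_all
  \<comment> \<open>The two branches agree at q = L because u y has its unit mass at y;
    \<open>high\<close> therefore holds from L on.\<close>
  define m' where "m' q z = (if q \<le> L then m q z else m L (z div 2 ^ (q - L)) * u (z div 2 ^ (q - L)) q z)" for q z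
  have high: "m' q z = m L (z div 2 ^ (q - L)) * u (z div 2 ^ (q - L)) q z" if "L \<le> q" for q z
    using that u(2) by (cases "q = L") (auto simp: m'_def)
  have "flow m'"
    unfolding flow_def
  proof (intro allI conjI)
    fix q z
    show "0 \<le> m' q z" using flow_nonneg[OF fl] flow_nonneg[OF u(1)] by (simp add: m'_def)
    show "m' q z = m' (Suc q) (2 * z) + m' (Suc q) (2 * z + 1)"
    proof (cases "q < L")
      case True
      moreover have "m q z = m (Suc q) (2 * z) + m (Suc q) (2 * z + 1)" by (rule flow_split[OF fl])
      ultimately show ?thesis by (simp add: m'_def)
    next
      case False
      then have q: "L \<le> q" by simp
      have div: "2 * z div 2 ^ (Suc q - L) = z div 2 ^ (q - L)" "(2 * z + 1) div 2 ^ (Suc q - L) = z div 2 ^ (q - L)"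
        using q by (simp_all add: Suc_diff_le zdiv_zmult2_eq)
      have "u y q z = u y (Suc q) (2 * z) + u y (Suc q) (2 * z + 1)" for y
        by (rule flow_split[OF u(1)])
      then show ?thesis
        by (simp only: high[OF q] high[OF le_SucI[OF q]] div distrib_left)
    qed
  qed
  have bound: "m' q z \<le> 2 powr (- (real q * t))" for q z
  proof (cases "q \<le> L")
    case True
    then show ?thesis using m by (simp add: m'_def tame_flow_def)
  next
    case False
    then have q: "L \<le> q" by simp
    have "m' q z \<le> (M * (1 / 2) ^ L) * (\<bar>C\<bar> * 2 powr (- (real (q - L) * t)))"
      unfolding high[OF q]
    proof (intro mult_mono M)
      have "u y q z \<le> C * 2 powr (- (real (q - L) * t))" for y by (rule u(3)[OF q])
      also have "C * 2 powr (- (real (q - L) * t)) \<le> \<bar>C\<bar> * 2 powr (- (real (q - L) * t))"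
        by (intro mult_right_mono) auto
      finally show "u (z div 2 ^ (q - L)) q z \<le> \<bar>C\<bar> * 2 powr (- (real (q - L) * t))" .
    qed (use \<open>0 \<le> M\<close> flow_nonneg[OF u(1)] in auto)
    also have "\<dots> = (M * \<bar>C\<bar> * 2 powr (real L * (t - 1))) * 2 powr (- (real q * t))"
    proof -
      have "(1 / 2 :: real) ^ L = 2 powr (- real L)" using half_power_powr[of L 1] by simp
      moreover have "2 powr (- real L) * 2 powr (- (real (q - L) * t)) = 2 powr (real L * (t - 1)) * (2 powr (- (real q * t)) :: real)"
        using q by (simp add: of_nat_diff algebra_simps flip: powr_add)
      ultimately show ?thesis by (simp only: mult_ac)
    qed
    also have "\<dots> \<le> 1 * 2 powr (- (real q * t))" by (intro mult_right_mono small) auto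
    finally show ?thesis by simp
  qed
  have dens: "m' q z \<le> max M (M * \<bar>M1\<bar>) * (1 / 2) ^ q" for q z
  proof (cases "q \<le> L")
    case True
    have "m' q z \<le> M * (1 / 2) ^ q" using True M by (simp add: m'_def)
    also have "\<dots> \<le> max M (M * \<bar>M1\<bar>) * (1 / 2) ^ q" by (intro mult_right_mono) auto
    finally show ?thesis .
  next
    case False
    then have q: "L \<le> q" by simp
    have "m' q z \<le> M * (\<bar>M1\<bar> * (1 / 2) ^ q)"
      unfolding high[OF q]
    proof (intro mult_mono)
      have "m L (z div 2 ^ (q - L)) \<le> M * (1 / 2) ^ L" by (rule M)
      also have "\<dots> \<le> M * 1" using \<open>0 \<le> M\<close> by (intro mult_left_mono power_le_one) auto
      finally show "m L (z div 2 ^ (q - L)) \<le> M" by simp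
      have "u (z div 2 ^ (q - L)) q z \<le> M1 * (1 / 2) ^ q" by (rule u(4))
      also have "\<dots> \<le> \<bar>M1\<bar> * (1 / 2) ^ q" by (intro mult_right_mono) auto
      finally show "u (z div 2 ^ (q - L)) q z \<le> \<bar>M1\<bar> * (1 / 2) ^ q" .
    qed (use \<open>0 \<le> M\<close> flow_nonneg[OF u(1)] in auto)
    also have "\<dots> \<le> max M (M * \<bar>M1\<bar>) * (1 / 2) ^ q"
      unfolding mult.assoc[symmetric] by (intro mult_right_mono) auto
    finally show ?thesis .
  qed
  show thesis
  proof (rule that[of m' L'])
    show "tame_flow t m'"
      using \<open>flow m'\<close> bound dens m unfolding tame_flow_def by (auto simp: m'_def[of 0])
    show "N < L'" using L \<open>L < L'\<close> by simp
    show "m' q z = m q z" if "q \<le> N" for q z using that L by (simp add: m'_def)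
    show "flow_support m' L' \<subseteq> G"
      unfolding flow_support_def
    proof (rule UN_least)
      fix z assume "z \<in> {z. 0 < m' L' z}"
      then have "0 < m L (z div 2 ^ (L' - L)) * u (z div 2 ^ (L' - L)) L' z"
        using high[of L' z] \<open>L < L'\<close> by simp
      then have "0 < u (z div 2 ^ (L' - L)) L' z"
        using flow_nonneg[OF fl, of L "z div 2 ^ (L' - L)"] flow_nonneg[OF u(1), of "z div 2 ^ (L' - L)" L' z]
        by (metis less_eq_real_def mult_zero_right)
      then show "dyad_int L' z \<subseteq> G" by (rule u(5))
    qed
  qed
qed

lemma flow_support_antimono:
  assumes m: "flow m" and eq: "\<And>z. m' r z = m r z" and m': "flow m'" and "r \<le> q"
  shows "flow_support m' q \<subseteq> flow_support m r"
proof -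
  have "dyad_int q z \<subseteq> flow_support m r" if "0 < m' q z" for z
  proof -
    have "0 < m' r (z div 2 ^ (q - r))"
      using flow_ancestor_le[OF m', of r "q - r" z] \<open>r \<le> q\<close> that by simp
    moreover have "dyad_int q z \<subseteq> dyad_int r (z div 2 ^ (q - r))"
      using dyad_int_subset[of r "q - r" z] \<open>r \<le> q\<close> by simp
    ultimately show ?thesis unfolding flow_support_def eq by blast
  qed
  then show ?thesis unfolding flow_support_def[of m' q] by blast
qed

lemma tame_flow_outside:
  assumes "tame_flow t m" "z \<notin> {0..<2 ^ N}"
  shows "m N z = 0"
proof -
  have "z div 2 ^ N \<noteq> 0" using assms(2) div_power2_bounds[of z N] by auto
  then have "m 0 (z div 2 ^ N) = 0" using assms by (simp add: tame_flow_def)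
  moreover have "m N z \<le> m 0 (z div 2 ^ N)" "0 \<le> m N z"
    using flow_ancestor_le[of m 0 N z] flow_nonneg[of m N z] assms by (auto simp: tame_flow_def)
  ultimately show ?thesis by simp
qed

lemma compact_flow_support:
  assumes "tame_flow t m"
  shows "compact (flow_support m N)"
  unfolding flow_support_def
proof (rule compact_UN)
  have "{z. 0 < m N z} \<subseteq> {0..<2 ^ N}" using tame_flow_outside[OF assms, of _ N] by fastforce
  then show "finite {z. 0 < m N z}" using finite_subset by blast
qed (simp add: dyad_int_def)

lemma tame_flow_total:
  assumes "tame_flow t m"
  shows "(\<Sum>z\<in>{0..<2 ^ N}. m N z) = 1"
  using flow_descendants[of m 0 0 N] assms by (simp add: tame_flow_def)

text \<open>The factor \<open>4\<close>: a set of diameter at most \<open>2\<^sup>-\<^sup>q\<close> meets at most four closed dyadic intervals of level \<open>q\<close>.\<close>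
lemma tame_flow_mass_le:
  assumes m: "tame_flow t m" and V: "\<And>x y. x \<in> V \<Longrightarrow> y \<in> V \<Longrightarrow> \<bar>x - y\<bar> \<le> (1 / 2) ^ q" and "q \<le> N"
  shows "(\<Sum>z\<in>{z \<in> {0..<2 ^ N}. dyad_int N z \<inter> V \<noteq> {}}. m N z) \<le> 4 * 2 powr (- (real q * t))"
proof (cases "V = {}")
  case False
  then obtain v where "v \<in> V" by blast
  define y0 where "y0 = dyad q v"
  have fl: "flow m" using m by (simp add: tame_flow_def)
  have near: "z div 2 ^ (N - q) \<in> {y0 - 2..y0 + 1}" if z: "dyad_int N z \<inter> V \<noteq> {}" for z
  proof -
    obtain x where x: "x \<in> dyad_int N z" "x \<in> V" using z by blast
    have "x \<in> dyad_int q (z div 2 ^ (N - q))" using dyad_int_subset[of q "N - q" z] x \<open>q \<le> N\<close> by auto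
    then have "real_of_int (z div 2 ^ (N - q)) \<le> 2 ^ q * x" "2 ^ q * x \<le> real_of_int (z div 2 ^ (N - q)) + 1"
      by (auto simp: dyad_int_def field_simps)
    moreover have "\<bar>2 ^ q * x - 2 ^ q * v\<bar> \<le> 1"
    proof -
      have "2 ^ q * \<bar>x - v\<bar> \<le> 2 ^ q * (1 / 2) ^ q" using V[OF x(2) \<open>v \<in> V\<close>] by (intro mult_left_mono) auto
      moreover have "2 ^ q * (1 / 2 :: real) ^ q = 1" by (simp flip: power_mult_distrib)
      moreover have "\<bar>2 ^ q * x - 2 ^ q * v\<bar> = 2 ^ q * \<bar>x - v\<bar>" by (simp add: abs_mult flip: right_diff_distrib)
      ultimately show ?thesis by linarith
    qed
    moreover have "real_of_int y0 \<le> 2 ^ q * v" "2 ^ q * v < real_of_int y0 + 1"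
      unfolding y0_def dyad_def by linarith+
    ultimately have "real_of_int (z div 2 ^ (N - q)) < real_of_int (y0 + 2)" "real_of_int (y0 - 2) - 1 < real_of_int (z div 2 ^ (N - q))"
      by linarith+
    then show ?thesis by (simp add: less_le_not_le)
  qed
  have "{z \<in> {0..<2 ^ N}. dyad_int N z \<inter> V \<noteq> {}} \<subseteq> (\<Union>y\<in>{y0 - 2..y0 + 1}. {y * 2 ^ (N - q)..<(y + 1) * 2 ^ (N - q)})"
  proof
    fix z assume z: "z \<in> {z \<in> {0..<2 ^ N}. dyad_int N z \<inter> V \<noteq> {}}"
    have "z \<in> {(z div 2 ^ (N - q)) * 2 ^ (N - q)..<(z div 2 ^ (N - q) + 1) * 2 ^ (N - q)}"
      using div_power2_bounds[of z "N - q"] by simp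
    with near[of z] z show "z \<in> (\<Union>y\<in>{y0 - 2..y0 + 1}. {y * 2 ^ (N - q)..<(y + 1) * 2 ^ (N - q)})" by blast
  qed
  then have "(\<Sum>z\<in>{z \<in> {0..<2 ^ N}. dyad_int N z \<inter> V \<noteq> {}}. m N z) \<le>
      (\<Sum>z\<in>(\<Union>y\<in>{y0 - 2..y0 + 1}. {y * 2 ^ (N - q)..<(y + 1) * 2 ^ (N - q)}). m N z)"
    by (intro sum_mono2 flow_nonneg fl) auto
  also have "\<dots> \<le> (\<Sum>y\<in>{y0 - 2..y0 + 1}. \<Sum>z\<in>{y * 2 ^ (N - q)..<(y + 1) * 2 ^ (N - q)}. m N z)"
    by (intro sum_UN_nonneg_le flow_nonneg fl) auto
  also have "\<dots> = (\<Sum>y\<in>{y0 - 2..y0 + 1}. m q y)"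
    using flow_descendants[OF fl, of q _ "N - q"] \<open>q \<le> N\<close> by simp
  also have "\<dots> \<le> (\<Sum>y\<in>{y0 - 2..y0 + 1}. 2 powr (- (real q * t)))"
    using m by (intro sum_mono) (simp add: tame_flow_def)
  finally show ?thesis by simp
qed simp

text \<open>Each flow agrees with its predecessor up to level \<open>N i\<close>, so an interval
  charged later lies inside one charged earlier and the supports are nested.\<close>

lemma refined_flow_sequence:
  assumes t: "0 < t" "t < 1" and thick: "\<And>i :: nat. locally_thick t (G i)"
  obtains m N where "\<And>i. tame_flow t (m i)" "\<And>i. i \<le> N i"
    "\<And>i j. i \<le> j \<Longrightarrow> flow_support (m j) (N j) \<subseteq> flow_support (m i) (N i)"
    "\<And>i. flow_support (m (Suc i)) (N (Suc i)) \<subseteq> G i"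
proof -
  define Q where "Q i p p' \<longleftrightarrow> snd p < snd p' \<and> (\<forall>q\<le>snd p. \<forall>z. fst p' q z = fst p q z) \<and>
      flow_support (fst p') (snd p') \<subseteq> G i"
    for i and p p' :: "(nat \<Rightarrow> int \<Rightarrow> real) \<times> nat"
  have "\<exists>f. \<forall>i. tame_flow t (fst (f i)) \<and> Q i (f i) (f (Suc i))"
  proof (rule dependent_nat_choice[where P = "\<lambda>_ p. tame_flow t (fst p)" and Q = Q])
    show "\<exists>p :: (nat \<Rightarrow> int \<Rightarrow> real) \<times> nat. tame_flow t (fst p)"
      using uniform_flow_tame[OF t(1) less_imp_le[OF t(2)]]
      by (intro exI[of _ "(\<lambda>q z. if z div 2 ^ q = 0 then (1 / 2) ^ q else 0, 0)"]) (simp only: fst_conv)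
    fix p :: "(nat \<Rightarrow> int \<Rightarrow> real) \<times> nat" and i assume p: "tame_flow t (fst p)"
    obtain m' N' where "tame_flow t m'" "snd p < N'" "\<And>q z. q \<le> snd p \<Longrightarrow> m' q z = fst p q z"
      "flow_support m' N' \<subseteq> G i"
      using refine_flow[OF p t thick[of i], where N = "snd p"] by blast
    then have "tame_flow t (fst (m', N')) \<and> Q i p (m', N')" by (simp add: Q_def)
    then show "\<exists>p'. tame_flow t (fst p') \<and> Q i p p'" by (rule exI)
  qed
  then obtain f where "\<forall>i. tame_flow t (fst (f i)) \<and> Q i (f i) (f (Suc i))" by (rule exE)
  then have f: "\<And>i. tame_flow t (fst (f i))" "\<And>i. Q i (f i) (f (Suc i))" by simp_all
  define K where "K i = flow_support (fst (f i)) (snd (f i))" for i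
  have fl: "flow (fst (f i))" for i using f(1) by (simp add: tame_flow_def)
  have "K (Suc i) \<subseteq> K i" for i
    unfolding K_def using f(2)[of i] by (intro flow_support_antimono fl) (auto simp: Q_def)
  then have "K j \<subseteq> K i" if "i \<le> j" for i j using that by (rule lift_Suc_antimono_le)
  moreover have "i \<le> snd (f i)" for i
  proof (induction i)
    case (Suc i)
    then show ?case using f(2)[of i] by (simp add: Q_def)
  qed simp
  moreover have "K (Suc i) \<subseteq> G i" for i using f(2)[of i] by (simp add: Q_def K_def)
  ultimately show thesis
    using f(1) unfolding K_def by (intro that[of "\<lambda>i. fst (f i)" "\<lambda>i. snd (f i)"])
qed

section \<open>The mass distribution principle on finite levels\<close>

text \<open>Rounds a diameter to a dyadic scale, losing a factor 2. A diameter 0 has no closest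
  scale, so a scale of cost below e is taken. The strict inequality leaves room for an open
  enlargement.\<close>

lemma exists_level:
  fixes D :: real
  assumes D: "0 \<le> D" "D \<le> 1 / 4" and t: "0 < t" "t < 1" "\<tau> \<le> t" and "0 < e"
  shows "\<exists>q. D < (1 / 2) ^ q \<and> 2 powr (- (real q * t)) \<le> 2 * (if D = 0 then 0 else D powr \<tau>) + e"
proof (cases "D = 0")
  case True
  have "(2 powr (- t)) < (1 :: real)" using t by (simp add: powr_less_one)
  then obtain q where "(2 powr (- t)) ^ q < e" using real_arch_pow_inv[of e "2 powr (- t)"] \<open>0 < e\<close> by auto
  moreover have "(2 powr (- t)) ^ q = 2 powr (- (real q * t))" by (simp add: powr_power mult.commute)
  ultimately show ?thesis using True by (intro exI[of _ q]) auto
next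
  case False
  define q where "q = (LEAST q. (1 / 2) ^ Suc q \<le> D)"
  obtain q0 where "(1 / 2) ^ q0 < D" using real_arch_pow_inv[of D "1/2"] False D by auto
  then have "(1 / 2) ^ Suc q0 \<le> D" by (simp add: field_simps)
  then have q: "(1 / 2) ^ Suc q \<le> D" unfolding q_def by (rule LeastI)
  have less: "D < (1 / 2) ^ q"
  proof (cases q)
    case 0
    then show ?thesis using D by simp
  next
    case (Suc q')
    then have "q' < q" by simp
    then have "\<not> (1 / 2) ^ Suc q' \<le> D" unfolding q_def by (rule not_less_Least)
    then show ?thesis using Suc by simp
  qed
  have "2 powr (- (real q * t)) = ((1 / 2) ^ q) powr t" by (simp add: half_power_powr)
  also have "\<dots> \<le> (2 * D) powr t" using q t D by (intro powr_mono2) auto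
  also have "\<dots> = 2 powr t * D powr t" using D by (simp add: powr_mult)
  also have "\<dots> \<le> 2 powr 1 * D powr \<tau>"
    using D t False by (intro mult_mono powr_mono powr_mono') auto
  finally show ?thesis using less False \<open>0 < e\<close> by (intro exI[of _ q]) auto
qed

text \<open>An open enlargement of a cheap cover of X contains the intersection of the nested
  compact supports, hence one of them, and finitely many of its sets suffice. At a fine enough level
  these few sets would have to carry total mass 1.\<close>

lemma thick_intersection:
  assumes t: "0 < t" "t < 1" and thick: "\<And>i :: nat. locally_thick t (G i)"
    and sub: "(\<Inter>i. G i) \<subseteq> X" and \<tau>: "0 \<le> \<tau>" "\<tau> \<le> t"
  shows "hausdorff_measure \<tau> X \<noteq> 0"
proof
  assume "hausdorff_measure \<tau> X = 0"
  \<comment> \<open>Cost 1/16 becomes at most 2/16 + 1/16 = 3/16 after rounding to dyadic scales,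
    below the 1/4 that mass 1 and the factor 4 of \<open>tame_flow_mass_le\<close> require.\<close>
  then have "hausdorff_premeasure \<tau> (1 / 4) X < ennreal (1 / 16)"
    unfolding hausdorff_measure_eq_0_iff by simp
  then obtain U where U: "X \<subseteq> (\<Union>i. U i)" "\<And>i. bounded (U i)" "\<And>i. diameter (U i) \<le> 1 / 4"
    "(\<Sum>i. diam_power \<tau> (U i)) < ennreal (1 / 16)"
    using hausdorff_premeasure_cover[of \<tau> "1 / 4" X "ennreal (1 / 16)"] by blast
  have D: "0 \<le> diameter (U i)" for i using diameter_ge_0[OF U(2)] .
  define e :: "nat \<Rightarrow> real" where "e i = 1 / 16 * (1 / 2) ^ Suc i" for i
  have "0 < e i" for i by (simp add: e_def)
  then have "\<forall>i. \<exists>q. diameter (U i) < (1 / 2) ^ q \<and>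
      2 powr (- (real q * t)) \<le> 2 * (if diameter (U i) = 0 then 0 else diameter (U i) powr \<tau>) + e i"
    using exists_level[OF D U(3) t \<tau>(2)] by blast
  from choice[OF this] obtain q where "\<forall>i. diameter (U i) < (1 / 2) ^ q i \<and>
      2 powr (- (real (q i) * t)) \<le> 2 * (if diameter (U i) = 0 then 0 else diameter (U i) powr \<tau>) + e i"
    by (rule exE)
  then have q: "\<And>i. diameter (U i) < (1 / 2) ^ q i"
    "\<And>i. 2 powr (- (real (q i) * t)) \<le> 2 * (if diameter (U i) = 0 then 0 else diameter (U i) powr \<tau>) + e i"
    by blast+
  have q_le: "ennreal (2 powr (- (real (q i) * t))) \<le> 2 * diam_power \<tau> (U i) + ennreal (e i)" for i
  proof -
    have "ennreal (if diameter (U i) = 0 then 0 else diameter (U i) powr \<tau>) \<le> diam_power \<tau> (U i)"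
      using D[of i] by (auto simp: diam_power_def)
    then have "ennreal (2 * (if diameter (U i) = 0 then 0 else diameter (U i) powr \<tau>)) \<le> 2 * diam_power \<tau> (U i)"
      by (simp add: ennreal_mult mult_left_mono)
    then have "ennreal (2 * (if diameter (U i) = 0 then 0 else diameter (U i) powr \<tau>) + e i) \<le> 2 * diam_power \<tau> (U i) + ennreal (e i)"
      by (subst ennreal_plus) (auto simp: e_def intro!: add_right_mono)
    with ennreal_leI[OF q(2)[of i]] show ?thesis by (rule order_trans)
  qed
  \<comment> \<open>Half the slack: enlarging by r on both sides keeps the diameter at most
    2^-q.\<close>
  define r where "r i = ((1 / 2) ^ q i - diameter (U i)) / 2" for i
  have r: "0 < r i" for i using q(1) by (simp add: r_def)
  define V where "V i = (\<Union>u\<in>U i. ball u (r i))" for i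
  have openV: "open (V i)" for i by (auto simp: V_def)
  have UV: "U i \<subseteq> V i" for i using r by (force simp: V_def)
  have diamV: "\<bar>x - y\<bar> \<le> (1 / 2) ^ q i" if xy: "x \<in> V i" "y \<in> V i" for x y i
  proof -
    obtain u v where uv: "u \<in> U i" "\<bar>u - x\<bar> < r i" "v \<in> U i" "\<bar>v - y\<bar> < r i"
      using xy by (auto simp: V_def dist_real_def)
    have "\<bar>u - v\<bar> \<le> diameter (U i)"
      using diameter_bounded_bound[OF U(2) uv(1) uv(3)] by (simp add: dist_real_def)
    with uv have "\<bar>x - y\<bar> \<le> diameter (U i) + 2 * r i" by linarith
    moreover have "2 * (a / 2) = a" for a :: real by simp
    then have "2 * r i = (1 / 2) ^ q i - diameter (U i)" unfolding r_def .
    ultimately show ?thesis by linarith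
  qed
  obtain m N where tame: "\<And>i. tame_flow t (m i)" and N: "\<And>i. i \<le> N i"
    and anti: "\<And>i j. i \<le> j \<Longrightarrow> flow_support (m j) (N j) \<subseteq> flow_support (m i) (N i)"
    and suppG: "\<And>i. flow_support (m (Suc i)) (N (Suc i)) \<subseteq> G i"
    using refined_flow_sequence[where G = G, OF t thick] by blast
  define K where "K i = flow_support (m i) (N i)" for i
  have comp: "compact (K i)" for i unfolding K_def by (rule compact_flow_support[OF tame])
  define VV where "VV = (\<Union>i. V i)"
  have "(\<Inter>i. K i) \<subseteq> (\<Inter>i. G i)" using suppG unfolding K_def by blast
  also have "\<dots> \<subseteq> X" by (rule sub)
  also have "\<dots> \<subseteq> (\<Union>i. U i)" by (rule U(1))
  also have "\<dots> \<subseteq> VV" unfolding VV_def by (intro UN_mono UV order.refl)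
  finally have KV: "(\<Inter>i. K i) \<subseteq> VV" .
  have "open VV" unfolding VV_def using openV by blast
  have "\<exists>i. K i \<subseteq> VV"
  proof (rule ccontr)
    assume none: "\<not> ?thesis"
    have "\<Inter> (range (\<lambda>i. K i - VV)) \<noteq> {}"
    proof (rule compact_nest)
      show "compact (K i - VV)" for i using comp \<open>open VV\<close> by (rule compact_diff)
      show "K i - VV \<noteq> {}" for i using none by (simp add: Diff_eq_empty_iff)
      show "K j - VV \<subseteq> K i - VV" if "i \<le> j" for i j
        using anti[OF that] unfolding K_def by (rule Diff_mono) simp
    qed
    then obtain x where "\<forall>i. x \<in> K i \<and> x \<notin> VV" by auto
    with KV show False by blast
  qed
  then obtain i where "K i \<subseteq> (\<Union>i. V i)" unfolding VV_def by blast
  then obtain F where F: "finite F" "K i \<subseteq> (\<Union>n\<in>F. V n)"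
    using compactE_image[OF comp, of UNIV V i] openV by auto
  \<comment> \<open>As N j >= j, the level N j is at least every q n with n in F, which
    \<open>tame_flow_mass_le\<close> needs.\<close>
  define j where "j = max i (Max (insert 0 (q ` F)))"
  have qj: "q n \<le> N j" if "n \<in> F" for n
  proof -
    have "q n \<le> Max (insert 0 (q ` F))" using that F by (intro Max_ge) auto
    then show ?thesis using N[of j] unfolding j_def by linarith
  qed
  have Kj: "K j \<subseteq> (\<Union>n\<in>F. V n)" using F anti[of i j] unfolding K_def j_def by auto
  have nn: "0 \<le> m j (N j) z" for z using tame[of j] flow_nonneg by (simp add: tame_flow_def)
  define A where "A n = {z \<in> {0..<2 ^ N j}. dyad_int (N j) z \<inter> V n \<noteq> {}}" for n
  have "1 = (\<Sum>z\<in>{0..<2 ^ N j}. m j (N j) z)" by (rule tame_flow_total[OF tame, symmetric])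
  also have "\<dots> = (\<Sum>z\<in>(\<Union>n\<in>F. A n). m j (N j) z)"
  proof (rule sum.mono_neutral_right)
    show "\<forall>z\<in>{0..<2 ^ N j} - (\<Union>n\<in>F. A n). m j (N j) z = 0"
    proof
      fix z assume z: "z \<in> {0..<2 ^ N j} - (\<Union>n\<in>F. A n)"
      show "m j (N j) z = 0"
      proof (rule ccontr)
        assume "m j (N j) z \<noteq> 0"
        with nn[of z] have "dyad_int (N j) z \<subseteq> K j" by (auto simp: K_def flow_support_def less_le)
        moreover have "z / 2 ^ N j \<in> dyad_int (N j) z" by (simp add: dyad_int_def divide_right_mono)
        ultimately obtain n where "n \<in> F" "z / 2 ^ N j \<in> V n" using Kj by blast
        with z \<open>z / 2 ^ N j \<in> dyad_int (N j) z\<close> show False by (auto simp: A_def)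
      qed
    qed
  qed (auto simp: A_def)
  also have "\<dots> \<le> (\<Sum>n\<in>F. \<Sum>z\<in>A n. m j (N j) z)"
  proof (rule sum_UN_nonneg_le[OF F(1)])
    show "finite (A n)" for n by (rule finite_subset[of _ "{0..<2 ^ N j}"]) (auto simp: A_def)
  qed (rule nn)
  also have "\<dots> \<le> (\<Sum>n\<in>F. 4 * 2 powr (- (real (q n) * t)))"
    unfolding A_def by (intro sum_mono tame_flow_mass_le tame diamV qj)
  also have "\<dots> = 4 * (\<Sum>n\<in>F. 2 powr (- (real (q n) * t)))" by (simp add: sum_distrib_left)
  finally have ge: "1 / 4 \<le> (\<Sum>n\<in>F. 2 powr (- (real (q n) * t)))" by simp
  have "ennreal (\<Sum>n\<in>F. 2 powr (- (real (q n) * t))) = (\<Sum>n\<in>F. ennreal (2 powr (- (real (q n) * t))))"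
    by (intro sum_ennreal[symmetric]) auto
  also have "\<dots> \<le> (\<Sum>n\<in>F. 2 * diam_power \<tau> (U n) + ennreal (e n))" by (intro sum_mono q_le)
  also have "\<dots> \<le> (\<Sum>n. 2 * diam_power \<tau> (U n) + ennreal (e n))" by (intro sum_le_suminf F) auto
  also have "\<dots> = (\<Sum>n. 2 * diam_power \<tau> (U n)) + (\<Sum>n. ennreal (e n))" by (intro suminf_add[symmetric]) auto
  also have "(\<Sum>n. ennreal (e n)) = ennreal (1 / 16)"
    using sums_mult[OF power_half_series, of "1 / 16"] by (intro suminf_ennreal_eq) (auto simp: e_def)
  also have "(\<Sum>n. 2 * diam_power \<tau> (U n)) = 2 * (\<Sum>n. diam_power \<tau> (U n))" by (rule ennreal_suminf_cmult)
  also have "2 * (\<Sum>n. diam_power \<tau> (U n)) + ennreal (1 / 16) \<le> 2 * ennreal (1 / 16) + ennreal (1 / 16)"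
    using U(4) by (intro add_right_mono mult_left_mono) auto
  also have "\<dots> = ennreal (3 / 16)"
  proof -
    have "2 * ennreal (1 / 16) = ennreal (2 * (1 / 16))" by (simp only: ennreal_mult) simp
    then show ?thesis by (simp flip: ennreal_plus)
  qed
  finally have "(\<Sum>n\<in>F. 2 powr (- (real (q n) * t))) \<le> 3 / 16"
    by (subst (asm) ennreal_le_iff) auto
  with ge show False by simp
qed

section \<open>The periodic extension of the limsup set\<close>

text \<open>The distances of f x from f 0 and f 1 determine it on the line: subtracting the two
  squared identities removes the quadratic term and leaves a linear equation.\<close>

lemma is_similarity_affine:
  assumes "is_similarity f"
  obtains c \<rho> where "\<rho> \<noteq> 0" "\<And>x. f x = c + \<rho> * x"
proof -
  obtain r where r: "0 < r" "\<And>x y. \<bar>f x - f y\<bar> = r * \<bar>x - y\<bar>"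
    using assms by (auto simp: is_similarity_def dist_real_def)
  define \<rho> where "\<rho> = f 1 - f 0"
  have \<rho>: "\<bar>\<rho>\<bar> = r" using r(2)[of 1 0] by (simp add: \<rho>_def)
  have "f x = f 0 + \<rho> * x" for x
  proof -
    define g where "g = f x - f 0"
    have "\<bar>g\<bar> = \<bar>\<rho> * x\<bar>" using r(2)[of x 0] \<rho> by (simp add: g_def abs_mult)
    then have "g\<^sup>2 = (\<rho> * x)\<^sup>2" by (metis power2_abs)
    moreover have "\<bar>g - \<rho>\<bar> = \<bar>\<rho> * (x - 1)\<bar>" using r(2)[of x 1] \<rho> by (simp add: g_def \<rho>_def abs_mult)
    then have "(g - \<rho>)\<^sup>2 = (\<rho> * (x - 1))\<^sup>2" by (metis power2_abs)
    ultimately have "\<rho> * g = \<rho> * (\<rho> * x)" by (auto simp: power2_eq_square algebra_simps)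
    then show ?thesis using \<rho> r(1) by (auto simp: g_def)
  qed
  moreover have "\<rho> \<noteq> 0" using \<rho> r(1) by auto
  ultimately show thesis using that by blast
qed

context
  fixes l d \<alpha> :: real
  assumes l: "1/2 < l" "l < 2/3" and d: "d = l / (1 - l)"
begin

lemma period_pos: "0 < d"
  using l d by simp

lemma diameter_I_int: "diameter (I_int l) = d"
  using period_pos d by (simp add: I_int_def)

lemma W_setI:
  assumes "v \<in> I_int l" "\<And>m. \<exists>n\<ge>m. \<exists>S\<subseteq>{1..n}. \<bar>v - fsum l S\<bar> < 2 powr (- (real n * \<alpha>))"
  shows "v \<in> W_set l \<alpha>"
  unfolding W_set_def
proof (rule INT_I)
  fix m :: nat
  obtain n S where n: "m \<le> n" "S \<subseteq> {1..n}" "\<bar>v - fsum l S\<bar> < 2 powr (- (real n * \<alpha>))"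
    using assms(2) by blast
  define w where "w = restrict (indicat_real S) {1..n}"
  have "w \<in> {1..n} \<rightarrow>\<^sub>E {0, 1}" by (auto simp: w_def indicator_def)
  moreover have "(\<Sum>i=1..n. w i * l ^ i) = fsum l S"
  proof -
    have "(\<Sum>i=1..n. w i * l ^ i) = (\<Sum>i\<in>{1..n}. if i \<in> S then l ^ i else 0)"
      by (intro sum.cong) (auto simp: w_def indicator_def)
    also have "\<dots> = (\<Sum>i\<in>{1..n} \<inter> S. l ^ i)" by (rule sum.inter_restrict[symmetric]) simp
    also have "{1..n} \<inter> S = S" using n by blast
    finally show ?thesis by (simp add: fsum_def)
  qed
  ultimately show "v \<in> (\<Union>n\<in>{m..}. \<Union>\<omega> \<in> {1..n} \<rightarrow>\<^sub>E {0, 1::real}.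
        {x \<in> I_int l. \<bar>x - (\<Sum>i=1..n. \<omega> i * l ^ i)\<bar> < 2 powr (- (real n * \<alpha>))})"
    using n assms(1) by (intro UN_I[of n] UN_I[of w]) auto
qed

text \<open>The empty word approximates 0 at every length. Thus all of d \<int> lies in the periodic
  extension, which settles the points with two representations, v = 0 and v = d.\<close>

lemma zero_in_W_set: "0 \<in> W_set l \<alpha>"
proof (rule W_setI)
  show "0 \<in> I_int l" using l by (simp add: I_int_def)
  show "\<exists>n\<ge>m. \<exists>S\<subseteq>{1..n}. \<bar>0 - fsum l S\<bar> < 2 powr (- (real n * \<alpha>))" for m
    by (intro exI[of _ m] conjI exI[of _ "{}"]) (auto simp: fsum_def)
qed

lemma fractional_part_unique:
  assumes x: "x = real_of_int k * d + v" and v: "0 \<le> v" "v \<le> d" and "x \<notin> range (\<lambda>k. d * real_of_int k)"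
  shows "v = x - real_of_int \<lfloor>x / d\<rfloor> * d" "0 < v" "v < d"
proof -
  have "v \<noteq> 0" using assms by (auto simp: mult.commute)
  moreover have "v \<noteq> d"
  proof
    assume "v = d"
    then have "x = d * real_of_int (k + 1)" using x by (simp add: algebra_simps)
    with assms(4) show False by blast
  qed
  ultimately show *: "0 < v" "v < d" using v by auto
  have "\<lfloor>x / d\<rfloor> = k" using * period_pos unfolding x by (simp add: floor_eq_iff field_simps)
  then show "v = x - real_of_int \<lfloor>x / d\<rfloor> * d" using x by simp
qed

text \<open>The translate k in \<open>approx_set\<close> could change with m. Off the lattice d
  \<int> it is unique, so a single v is approximated for every m.\<close>

lemma Inter_approx_set_subset:
  assumes "\<rho> \<noteq> 0"
  shows "(\<Inter>m. approx_set l \<alpha> c \<rho> m) \<subseteq> (\<lambda>x. c + \<rho> * x) ` {a + d * of_int k | a k. a \<in> W_set l \<alpha>}"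
proof
  fix z assume z: "z \<in> (\<Inter>m. approx_set l \<alpha> c \<rho> m)"
  define x where "x = (z - c) / \<rho>"
  have "x \<in> {a + d * of_int k | a k. a \<in> W_set l \<alpha>}"
  proof (cases "x \<in> range (\<lambda>k. d * real_of_int k)")
    case True
    then obtain k where "x = 0 + d * of_int k" by auto
    with zero_in_W_set show ?thesis by blast
  next
    case False
    define v where "v = x - real_of_int \<lfloor>x / d\<rfloor> * d"
    have v: "v \<in> I_int l \<and> (\<exists>n\<ge>m. \<exists>S\<subseteq>{1..n}. \<bar>v - fsum l S\<bar> < 2 powr (- (real n * \<alpha>)))" for m
    proof -
      have "z \<in> approx_set l \<alpha> c \<rho> m" using z by blast
      then obtain k v' where z': "z = c + \<rho> * (real_of_int k * d + v')" "v' \<in> I_int l"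
          and ex: "\<exists>n\<ge>m. \<exists>S\<subseteq>{1..n}. \<bar>v' - fsum l S\<bar> < 2 powr (- (real n * \<alpha>))"
        unfolding approx_set_def d by blast
      have "x = real_of_int k * d + v'" using z'(1) \<open>\<rho> \<noteq> 0\<close> by (simp add: x_def)
      then have "v' = v"
        unfolding v_def using fractional_part_unique(1)[of x k v'] z'(2) False by (auto simp: I_int_def d)
      with z' ex show ?thesis by simp
    qed
    have "v \<in> W_set l \<alpha>" by (rule W_setI) (use v in blast)+
    moreover have "x = v + d * of_int \<lfloor>x / d\<rfloor>" by (simp add: v_def)
    ultimately show ?thesis by blast
  qed
  moreover have "z = c + \<rho> * x" using \<open>\<rho> \<noteq> 0\<close> by (simp add: x_def)
  ultimately show "z \<in> (\<lambda>x. c + \<rho> * x) ` {a + d * of_int k | a k. a \<in> W_set l \<alpha>}" by blast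
qed

text \<open>A countable union of G_delta sets need not be G_delta. Off the lattice, however, the
  translates of (0, d) are disjoint and open, so union over translates commutes with the
  intersection over m; the lattice itself is closed and is added as a second G_delta set.\<close>

lemma gdelta_periodic_W_set: "gdelta_in euclidean {a + d * of_int k | a k. a \<in> W_set l \<alpha>}"
proof -
  define O' where "O' m = (\<Union>n\<in>{m..}. \<Union>\<omega> \<in> {1..n} \<rightarrow>\<^sub>E {0, 1::real}.
        {x. \<bar>x - (\<Sum>i=1..n. \<omega> i * l ^ i)\<bar> < 2 powr (- (real n * \<alpha>))})" for m :: nat
  have W: "W_set l \<alpha> = I_int l \<inter> (\<Inter>m. O' m)" unfolding W_set_def O'_def by auto
  have "open (O' m)" for m
    unfolding O'_def by (intro open_UN ballI open_Collect_less continuous_intros)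
  define V where "V m = (\<Union>k. {x. 0 < x - real_of_int k * d} \<inter> {x. x - real_of_int k * d < d} \<inter>
      (\<lambda>x. x - real_of_int k * d) -` O' m)" for m
  have openV: "open (V m)" for m
    unfolding V_def
    by (intro open_UN ballI open_Int open_Collect_less continuous_intros open_vimage \<open>open (O' m)\<close>)
  define Z where "Z = range (\<lambda>k. d * real_of_int k)"
  have "{a + d * of_int k | a k. a \<in> W_set l \<alpha>} = Z \<union> (\<Inter>m. V m)"
  proof (intro set_eqI iffI)
    fix x assume "x \<in> {a + d * of_int k | a k. a \<in> W_set l \<alpha>}"
    then obtain a k where a: "a \<in> W_set l \<alpha>" "x = a + d * of_int k" by blast
    show "x \<in> Z \<union> (\<Inter>m. V m)"
    proof (cases "x \<in> Z")
      case False
      have "0 \<le> a" "a \<le> d" using a(1) unfolding W by (auto simp: I_int_def d)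
      then have "0 < a" "a < d" using fractional_part_unique[of x k a] a(2) False by (auto simp: Z_def)
      moreover have "a \<in> O' m" for m using a(1) unfolding W by blast
      moreover have "x - real_of_int k * d = a" using a(2) by simp
      ultimately have "x \<in> V m" for m unfolding V_def by (intro UN_I[of k]) auto
      then show ?thesis by blast
    qed simp
  next
    fix x assume x: "x \<in> Z \<union> (\<Inter>m. V m)"
    show "x \<in> {a + d * of_int k | a k. a \<in> W_set l \<alpha>}"
    proof (cases "x \<in> Z")
      case True
      then obtain k where "x = 0 + d * of_int k" by (auto simp: Z_def)
      with zero_in_W_set show ?thesis by blast
    next
      case False
      define v where "v = x - real_of_int \<lfloor>x / d\<rfloor> * d"
      have v: "0 < v \<and> v < d \<and> v \<in> O' m" for m
      proof -
        have "x \<in> V m" using x False by blast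
        then obtain k where k: "0 < x - real_of_int k * d" "x - real_of_int k * d < d" "x - real_of_int k * d \<in> O' m"
          unfolding V_def by auto
        have "x - real_of_int k * d = v"
          unfolding v_def using k False by (intro fractional_part_unique(1)[of x k]) (auto simp: Z_def)
        with k show ?thesis by simp
      qed
      then have "v \<in> W_set l \<alpha>" unfolding W by (auto simp: I_int_def d less_imp_le)
      moreover have "x = v + d * of_int \<lfloor>x / d\<rfloor>" by (simp add: v_def)
      ultimately show ?thesis by blast
    qed
  qed
  moreover have "closed Z"
  proof -
    have "Z = (\<lambda>x. d *\<^sub>R x) ` \<int>" by (auto simp: Z_def Ints_def)
    then show ?thesis by (simp only:) (rule closed_scaling, simp)
  qed
  then have "gdelta_in euclidean Z" by (intro closed_imp_gdelta_in metrizable_space_euclidean) simp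
  moreover have "gdelta_in euclidean (\<Inter>m. V m)"
    using openV by (intro gdelta_in_Inter open_imp_gdelta_in) auto
  ultimately show ?thesis by (simp add: gdelta_in_Un)
qed

end

lemma hausdorff_dim_thick_intersection:
  assumes "0 < t" "t < 1" "\<And>i :: nat. locally_thick t (G i)" "(\<Inter>i. G i) \<subseteq> X"
  shows "ereal t \<le> hausdorff_dim X"
  unfolding hausdorff_dim_def
proof (rule Inf_greatest, clarify)
  fix \<tau> :: real assume "0 \<le> \<tau>" "hausdorff_measure \<tau> X = 0"
  then show "ereal t \<le> ereal \<tau>" using thick_intersection[OF assms, of \<tau>] by force
qed

lemma hausdorff_dim_nonneg: "0 \<le> hausdorff_dim A"
  unfolding hausdorff_dim_def by (rule Inf_greatest) auto

text \<open>It suffices to reach each t < s <= 1/\<alpha>, for which \<alpha> t < 1. The exponent t'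
  strictly between t and s provides the margin spent in \<open>separated_subfamily\<close>.\<close>

lemma W_set_large_intersection_on:
  assumes l: "1/2 < l" "l < 2/3" and \<alpha>: "1 < \<alpha>" and s: "0 \<le> s" "s \<le> 1 / \<alpha>"
    and few: "\<And>t. t < s \<Longrightarrow> \<exists>t'. t < t' \<and> t' < s \<and> few_close_pairs l t'"
  shows "W_set l \<alpha> \<in> large_intersection_on s (I_int l)"
proof -
  define d where "d = l / (1 - l)"
  define A where "A = {a + d * of_int k | a k. a \<in> W_set l \<alpha>}"
  have "1 / \<alpha> < 1" using \<alpha> by simp
  then have "s < 1" using s by linarith
  have "ereal s \<le> hausdorff_dim (\<Inter>j. f j ` A)"
    if f: "\<And>j. is_similarity (f j)" for f :: "nat \<Rightarrow> real \<Rightarrow> real"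
  proof (rule ccontr)
    assume "\<not> ereal s \<le> hausdorff_dim (\<Inter>j. f j ` A)"
    then have "hausdorff_dim (\<Inter>j. f j ` A) < ereal s" by simp
    \<comment> \<open>Such a t is positive because dimensions are nonnegative; for s = 0 the
      contradiction is already here.\<close>
    from ereal_dense2[OF this] obtain t
      where t: "hausdorff_dim (\<Inter>j. f j ` A) < ereal t" "ereal t < ereal s" by blast
    have "0 < t" using order_le_less_trans[OF hausdorff_dim_nonneg t(1)] by simp
    have "t < s" using t(2) by simp
    have "\<exists>c \<rho>. \<rho> \<noteq> 0 \<and> (\<forall>x. f j x = c + \<rho> * x)" for j
      by (rule is_similarity_affine[OF f[of j]]) blast
    then obtain c where "\<forall>j. \<exists>\<rho>. \<rho> \<noteq> 0 \<and> (\<forall>x. f j x = c j + \<rho> * x)" using choice by meson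
    then obtain \<rho> where "\<forall>j. \<rho> j \<noteq> 0 \<and> (\<forall>x. f j x = c j + \<rho> j * x)" using choice by meson
    then have c\<rho>: "\<And>j. \<rho> j \<noteq> 0" "\<And>j x. f j x = c j + \<rho> j * x" by blast+
    obtain t' where t': "t < t'" "t' < s" "few_close_pairs l t'" using few[OF \<open>t < s\<close>] by blast
    \<comment> \<open>Enumerating the pairs (j, m) merges all similar images and all stages of their
      limsup sets into one sequence.\<close>
    define G where "G i = (case prod_decode i of (j, m) \<Rightarrow> approx_set l \<alpha> (c j) (\<rho> j) m)" for i
    have "\<alpha> * t < 1"
    proof -
      have "\<alpha> * t < \<alpha> * s" using \<open>t < s\<close> \<alpha> by simp
      also have "\<dots> \<le> 1" using s \<alpha> by (simp add: le_divide_eq mult.commute)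
      finally show ?thesis .
    qed
    have "ereal t \<le> hausdorff_dim (\<Inter>j. f j ` A)"
    proof (rule hausdorff_dim_thick_intersection)
      show "locally_thick t (G i)" for i
        unfolding G_def using l \<alpha> \<open>0 < t\<close> t' \<open>s < 1\<close> \<open>\<alpha> * t < 1\<close> c\<rho>(1)
        by (auto split: prod.split intro!: locally_thick_approx_set[where t = t'])
      show "(\<Inter>i. G i) \<subseteq> (\<Inter>j. f j ` A)"
      proof (rule INT_greatest)
        fix j
        have "(\<Inter>i. G i) \<subseteq> (\<Inter>m. approx_set l \<alpha> (c j) (\<rho> j) m)"
        proof (rule INT_greatest)
          fix m
          have "G (prod_encode (j, m)) = approx_set l \<alpha> (c j) (\<rho> j) m" by (simp add: G_def)
          then show "(\<Inter>i. G i) \<subseteq> approx_set l \<alpha> (c j) (\<rho> j) m" by blast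
        qed
        also have "\<dots> \<subseteq> (\<lambda>x. c j + \<rho> j * x) ` A"
          unfolding A_def by (rule Inter_approx_set_subset[OF l d_def c\<rho>(1)])
        also have "(\<lambda>x. c j + \<rho> j * x) = f j" using c\<rho>(2) by auto
        finally show "(\<Inter>i. G i) \<subseteq> f j ` A" .
      qed
    qed (use \<open>0 < t\<close> \<open>t < s\<close> \<open>s < 1\<close> in auto)
    with t(1) show False by simp
  qed
  moreover have "gdelta_in euclidean A"
    unfolding A_def by (rule gdelta_periodic_W_set[OF l d_def])
  moreover have "W_set l \<alpha> \<subseteq> I_int l" by (auto simp: W_set_def)
  ultimately show ?thesis
    unfolding large_intersection_on_def large_intersection_def diameter_I_int[OF l d_def] A_def by blast
qed

theorem theorem2:
  fixes \<alpha> s :: real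
  assumes "\<alpha> > 1" and "0 \<le> s" and "s \<le> 1 / \<alpha>"
  shows "hausdorff_dim {l :: real. l \<in> {1/2<..<2/3} \<and>
           W_set l \<alpha> \<notin> large_intersection_on s (I_int l)} \<le> ereal s"
proof (rule hausdorff_dim_le)
  show "0 \<le> s" by (rule assms)
  have "1 / \<alpha> < 1" using assms by simp
  then show "s < 1" using assms by linarith
  fix s' :: real assume s': "s < s'" "s' < 1"
  \<comment> \<open>The exponents s - 1/(i+1) increase to s, so countably many null sets handle
    every t < s. They may be negative, which the estimate for exceptional parameters allows.\<close>
  define B where "B i = {l \<in> {1/2<..<2/3}. \<not> few_close_pairs l (s - 1 / real (Suc i))}" for i
  have "hausdorff_measure s' (\<Union>i. B i) = 0"
  proof (rule hausdorff_measure_null_UN)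
    fix i
    have "0 < 1 / real (Suc i)" by simp
    then have "s - 1 / real (Suc i) < s'" using s' by linarith
    then show "hausdorff_measure s' (B i) = 0"
      unfolding B_def using s' assms by (intro hausdorff_measure_exceptional_params) auto
  qed
  moreover have "{l. l \<in> {1/2<..<2/3} \<and> W_set l \<alpha> \<notin> large_intersection_on s (I_int l)} \<subseteq> (\<Union>i. B i)"
  proof (rule subsetI, rule ccontr)
    fix l assume l: "l \<in> {l. l \<in> {1/2<..<2/3} \<and> W_set l \<alpha> \<notin> large_intersection_on s (I_int l)}" "l \<notin> (\<Union>i. B i)"
    then have few: "few_close_pairs l (s - 1 / real (Suc i))" for i by (auto simp: B_def)
    have "W_set l \<alpha> \<in> large_intersection_on s (I_int l)"
    proof (rule W_set_large_intersection_on)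
      fix t assume "t < s"
      then obtain i where "inverse (real (Suc i)) < s - t" using reals_Archimedean[of "s - t"] by auto
      then show "\<exists>t'. t < t' \<and> t' < s \<and> few_close_pairs l t'"
        using few[of i] by (intro exI[of _ "s - 1 / real (Suc i)"]) (auto simp: inverse_eq_divide)
    qed (use l assms in auto)
    with l show False by simp
  qed
  ultimately show "hausdorff_measure s' {l. l \<in> {1/2<..<2/3} \<and> W_set l \<alpha> \<notin> large_intersection_on s (I_int l)} = 0"
    using hausdorff_measure_null_mono by blast
qed

end
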